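(* Let $\alpha$ be an irrational number with bounded continued fraction coefficients. Let $(\xi_n)_{n\ge1}=(\xi_n(\omega))_{n\ge1}$ be a sequence of i.i.d. $\{0,1\}$-valued random variables with mean $1/2$, defined on some probability space $(\Omega,\mathcal A,\mathbb P)$, which induce a random sequence $(n_k)_{k\ge1}=(n_k(\omega))_{k\ge1}$ as the sequence of all numbers in $\{n\ge1:\xi_n=1\}$, sorted in increasing order. Set $$P_N=\prod_{k=1}^N|2\sin(\pi n_k\alpha)|.$$ Then for all $\varepsilon>0$ we have, $\mathbb P$-almost surely, $$P_N\le\exp\left(\left(\frac{\pi}{\sqrt{12}}+\varepsilon\right)\sqrt{N\log\log N}\right)$$ for all sufficiently large $N$, and $$P_N\ge\exp\left(\left(\frac{\pi}{\sqrt{12}}-\varepsilon\right)\sqrt{N\log\log N}\right)$$ for infinitely many $N$.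
   Context: "Bounded continued fraction coefficients" means that the partial quotients $a_i$ in $\alpha=[a_0;a_1,a_2,\dots]$ form a bounded sequence. (The set $\{n\ge1:\xi_n=1\}$ is almost surely infinite, so $(n_k)_{k\ge1}$ is almost surely well defined.) *)

theory Defs
  imports "HOL-Probability.Probability"
begin

text \<open>
  Regular continued fraction expansion \<open>x = [a\<^sub>0; a\<^sub>1, a\<^sub>2, \<dots>]\<close> by the usual algorithm: the complete
  quotients are \<open>x\<^sub>0 = x\<close>, \<open>x\<^sub>i\<^sub>+\<^sub>1 = 1 / (x\<^sub>i - \<lfloor>x\<^sub>i\<rfloor>)\<close> and the partial quotients are \<open>a\<^sub>i = \<lfloor>x\<^sub>i\<rfloor>\<close>.
  For irrational \<open>x\<close> the algorithm never divides by zero; for rational \<open>x\<close> it does not signal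
  termination, so the definitions are meant for irrational arguments only.
\<close>

primrec cf_complete_quotient :: "real \<Rightarrow> nat \<Rightarrow> real" where
  "cf_complete_quotient x 0 = x"
| "cf_complete_quotient x (Suc i) = 1 / frac (cf_complete_quotient x i)"

definition cf_coeff :: "real \<Rightarrow> nat \<Rightarrow> int" where
  "cf_coeff x i = \<lfloor>cf_complete_quotient x i\<rfloor>"

definition bounded_cf_coeffs :: "real \<Rightarrow> bool" where
  "bounded_cf_coeffs x \<longleftrightarrow> (\<exists>B. \<forall>i. \<bar>cf_coeff x i\<bar> \<le> B)"

lemma cf_complete_quotient_irrational:
  assumes "x \<notin> \<rat>"
  shows "cf_complete_quotient x i \<notin> \<rat>"
proof (induction i)
  case 0
  then show ?case using assms by simp
next
  case (Suc i)
  let ?y = "cf_complete_quotient x i"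
  show ?case
  proof
    assume "cf_complete_quotient x (Suc i) \<in> \<rat>"
    then have "inverse (1 / frac ?y) \<in> \<rat>"
      by (metis Rats_inverse cf_complete_quotient.simps(2))
    then have "frac ?y + of_int \<lfloor>?y\<rfloor> \<in> \<rat>"
      by (intro Rats_add) auto
    then show False using Suc by (simp add: frac_def)
  qed
qed

lemma cf_complete_quotient_step:
  shows "cf_complete_quotient x i = cf_coeff x i + 1 / cf_complete_quotient x (Suc i)"
  by (simp add: cf_coeff_def frac_def)

lemma cf_coeff_Suc_ge_1:
  assumes "x \<notin> \<rat>"
  shows "cf_coeff x (Suc i) \<ge> 1"
proof -
  let ?y = "cf_complete_quotient x i"
  have "?y \<notin> \<int>"
    using cf_complete_quotient_irrational[OF assms, of i] Ints_subset_Rats by blast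
  then have "0 < frac ?y" "frac ?y < 1"
    by (simp_all add: frac_lt_1)
  then have "1 \<le> 1 / frac ?y" by simp
  then show ?thesis by (simp add: cf_coeff_def)
qed

text \<open>
  \<open>random_index \<xi> \<omega> k\<close> is \<open>n\<^sub>k(\<omega>)\<close> for \<open>k \<ge> 1\<close>: \<^const>\<open>enumerate\<close> counts from \<open>0\<close>, hence the shift.
  The value is meaningful only if \<open>{n \<ge> 1. \<xi> n \<omega> = 1}\<close> is infinite.
\<close>

definition random_index :: "(nat \<Rightarrow> 'a \<Rightarrow> real) \<Rightarrow> 'a \<Rightarrow> nat \<Rightarrow> nat" where
  "random_index \<xi> \<omega> k = enumerate {n. n \<ge> 1 \<and> \<xi> n \<omega> = 1} (k - 1)"

definition random_sine_product :: "real \<Rightarrow> (nat \<Rightarrow> 'a \<Rightarrow> real) \<Rightarrow> 'a \<Rightarrow> nat \<Rightarrow> real" where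
  "random_sine_product \<alpha> \<xi> \<omega> N = (\<Prod>k=1..N. \<bar>2 * sin (pi * real (random_index \<xi> \<omega> k) * \<alpha>)\<bar>)"

end

theory Submission
  imports Defs "HOL-Real_Asymp.Real_Asymp"
begin

text \<open>
  Write \<open>f(x) = ln |2 sin(\<pi>x)|\<close> and \<open>r\<^sub>n = 2\<xi>\<^sub>n - 1\<close>. Up to time \<open>m\<close> the logarithm of the product is
  \<open>(\<Sum> f(n\<alpha>) + \<Sum> r\<^sub>n f(n\<alpha>)) / 2\<close>, and about \<open>m/2\<close> indices have been selected. For badly approximable
  \<open>\<alpha>\<close> the first sum is \<open>O(log\<^sup>2 m)\<close>, by the Fourier series \<open>f(x) = - \<Sum> cos(2\<pi>kx)/k\<close> and the spacing of
  the points \<open>n\<alpha>\<close>, and \<open>\<Sum> f(n\<alpha>)\<^sup>2\<close> is asymptotic to \<open>m \<integral> f\<^sup>2 = m \<pi>\<^sup>2/12\<close>. The second sum is a sum of independent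
  variables, to which Kolmogorov's law of the iterated logarithm applies, since \<open>f(n\<alpha>) = O(log n)\<close>.
  Its upper half rests on an exponential maximal inequality, its lower half on a lower bound for the
  tail that is derived from moment generating functions alone.
\<close>

section \<open>Continued fractions and badly approximable numbers\<close>

text \<open>Origin of the constant: with \<sigma>^2 = \<pi>^2/12 the second sum reaches sqrt(2
  \<sigma>^2 m ln ln m). The factor 1/2 in front and m ~ 2N turn this into \<sigma> sqrt(N ln ln N).
  The integral of f^2 is the Parseval sum of 1/(2k^2).

  Obstacle: f is unbounded near the integers, so equidistribution of n\<alpha> alone gives neither a
  first sum of order o(sqrt m) nor the mean of f^2. The partial quotients act only through the bound
  c/n for the distance of n\<alpha> to the integers. Applied to differences of indices it also
  spaces the points, which limits how many of them lie near an integer.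

  The Abel mean ln |1 - r exp(2\<pi>ix)| stands in for f, having an absolutely convergent series and
  an explicit distance from f. Its parameter has two regimes: 1 - r = 1/M^2 for the first sum, where
  the error is added up over M points, and r fixed near 1 for the mean square, where the error has
  to be small on average, uniformly in M.

  Replacing m by 2N requires a law of large numbers for the selected indices; it comes from the same
  iterated logarithm bound with all weights 1 or all weights -1.\<close>

fun cf_den :: "real \<Rightarrow> nat \<Rightarrow> int" where
  "cf_den x 0 = 1"
| "cf_den x (Suc 0) = cf_coeff x 1"
| "cf_den x (Suc (Suc k)) = cf_coeff x (Suc (Suc k)) * cf_den x (Suc k) + cf_den x k"

fun cf_num :: "real \<Rightarrow> nat \<Rightarrow> int" where
  "cf_num x 0 = cf_coeff x 0"
| "cf_num x (Suc 0) = cf_coeff x 0 * cf_coeff x 1 + 1"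
| "cf_num x (Suc (Suc k)) = cf_coeff x (Suc (Suc k)) * cf_num x (Suc k) + cf_num x k"

definition cf_err :: "real \<Rightarrow> nat \<Rightarrow> real" where
  "cf_err x k = of_int (cf_den x k) * x - of_int (cf_num x k)"

lemma cf_complete_quotient_Suc_gt_1:
  assumes "x \<notin> \<rat>"
  shows "cf_complete_quotient x (Suc i) > 1"
proof -
  let ?y = "cf_complete_quotient x i"
  have "?y \<notin> \<int>"
    using cf_complete_quotient_irrational[OF assms, of i] Ints_subset_Rats by blast
  then have "0 < frac ?y" "frac ?y < 1"
    by (simp_all add: frac_lt_1)
  then show ?thesis by simp
qed

text \<open>The errors satisfy the recurrence of the denominators. Writing the partial quotient as
  \<open>y - 1 / z\<close> with consecutive complete quotients carries the ratio of errors from one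
  index to the next. As complete quotients exceed 1, the errors alternate in sign and
  shrink.\<close>

lemma cf_err_step:
  assumes "x \<notin> \<rat>"
  shows "cf_err x k = - cf_complete_quotient x (k+2) * cf_err x (Suc k)"
proof (induction k)
  case 0
  define y where "y = cf_complete_quotient x 1"
  define z where "z = cf_complete_quotient x 2"
  have y: "y > 1" "z > 1" using cf_complete_quotient_Suc_gt_1[OF assms]
    by (simp_all only: y_def z_def One_nat_def numeral_2_eq_2)
  have 1: "x = cf_coeff x 0 + 1 / y"
    using cf_complete_quotient_step[of x 0] by (simp add: y_def)
  have 2: "y = cf_coeff x 1 + 1 / z"
    using cf_complete_quotient_step[of x 1] unfolding y_def z_def numeral_2_eq_2 One_nat_def .
  have e0: "cf_err x 0 = 1 / y" using 1 by (simp add: cf_err_def)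
  have "cf_err x (Suc 0) = cf_coeff x 1 * (x - cf_coeff x 0) - 1"
    by (simp add: cf_err_def algebra_simps)
  also have "x - cf_coeff x 0 = 1 / y" using 1 by linarith
  also have "cf_coeff x 1 = y - 1 / z" using 2 by linarith
  finally have "cf_err x (Suc 0) = - (1 / (y * z))" using y by (simp add: field_simps)
  then have "cf_err x 0 = - z * cf_err x (Suc 0)" using e0 y by simp
  then show ?case by (simp only: z_def add_0)
next
  case (Suc k)
  define y where "y = cf_complete_quotient x (k+2)"
  define z where "z = cf_complete_quotient x (k+3)"
  have y: "y > 1" "z > 1" using cf_complete_quotient_Suc_gt_1[OF assms]
    by (simp_all only: y_def z_def add_2_eq_Suc' numeral_3_eq_3 add_Suc_right)
  have 2: "y = cf_coeff x (k+2) + 1 / z"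
    using cf_complete_quotient_step[of x "k+2"] by (simp only: y_def z_def numeral_2_eq_2 numeral_3_eq_3 add_Suc_right add_0_right)
  have "cf_err x (Suc (Suc k)) = cf_coeff x (k+2) * cf_err x (Suc k) + cf_err x k"
    by (simp add: cf_err_def algebra_simps)
  also have "cf_err x k = - y * cf_err x (Suc k)" using Suc by (simp add: y_def)
  also have "real_of_int (cf_coeff x (k+2)) = y - 1 / z" using 2 by linarith
  finally have "cf_err x (Suc (Suc k)) = - (1/z) * cf_err x (Suc k)" by (simp add: algebra_simps)
  then have "cf_err x (Suc k) = - z * cf_err x (Suc (Suc k))" using y by simp
  moreover have "z = cf_complete_quotient x (Suc k + 2)" by (simp only: z_def numeral_2_eq_2 numeral_3_eq_3 add_Suc_right add_Suc)
  ultimately show ?case by (simp only:)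
qed

lemma cf_err_0: "x \<notin> \<rat> \<Longrightarrow> cf_err x 0 > 0"
  using Ints_subset_Rats by (auto simp: cf_err_def cf_coeff_def frac_def[symmetric] frac_gt_0_iff)

lemma cf_err_sign:
  assumes "x \<notin> \<rat>"
  shows "cf_err x k * cf_err x (Suc k) < 0" "\<bar>cf_err x (Suc k)\<bar> \<le> \<bar>cf_err x k\<bar>"
proof -
  have nz: "cf_err x k \<noteq> 0" for k
  proof (induction k)
    case 0 then show ?case using cf_err_0[OF assms] by simp
  next
    case (Suc k) then show ?case using cf_err_step[OF assms, of k] by auto
  qed
  have z: "cf_complete_quotient x (k+2) > 1" using cf_complete_quotient_Suc_gt_1[OF assms, of "Suc k"] by simp
  have "cf_err x k * cf_err x (Suc k) = - cf_complete_quotient x (k+2) * (cf_err x (Suc k))\<^sup>2"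
    by (subst cf_err_step[OF assms]) (simp add: power2_eq_square)
  also have "\<dots> < 0" using z nz[of "Suc k"]
    by (simp add: mult_less_0_iff del: cf_complete_quotient.simps add_2_eq_Suc')
  finally show "cf_err x k * cf_err x (Suc k) < 0" .
  show "\<bar>cf_err x (Suc k)\<bar> \<le> \<bar>cf_err x k\<bar>"
    using z by (simp add: cf_err_step[OF assms, of k] abs_mult mult_le_cancel_right1 del: cf_complete_quotient.simps)
qed

lemma cf_det: "cf_den x (Suc k) * cf_num x k - cf_den x k * cf_num x (Suc k) = (-1)^(Suc k)"
  by (induction k) (auto simp: algebra_simps)

lemma cf_den_pos: "x \<notin> \<rat> \<Longrightarrow> cf_den x k \<ge> 1"
proof (induction k rule: cf_den.induct[of _ ])
  case (2 x) then show ?case using cf_coeff_Suc_ge_1[of x 0] by simp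
next
  case (3 x k)
  have "cf_coeff x (Suc (Suc k)) * cf_den x (Suc k) \<ge> 1 * 1"
    using 3 cf_coeff_Suc_ge_1[of x "Suc k"] by (intro mult_mono) auto
  then show ?case using 3 by simp
qed auto

text \<open>Strict growth starts at index 1, because the denominators at 0 and 1 are both 1 when the
  first partial quotient is 1.\<close>

lemma cf_den_less: "x \<notin> \<rat> \<Longrightarrow> cf_den x (Suc k) < cf_den x (Suc (Suc k))"
  using cf_den_pos[of x k] cf_den_pos[of x "Suc k"] cf_coeff_Suc_ge_1[of x "Suc k"]
  by (simp add: add_pos_nonneg) (smt (verit) mult_le_cancel_right1)

lemma cf_den_le: "x \<notin> \<rat> \<Longrightarrow> cf_den x k \<le> cf_den x (Suc k)"
  using cf_den_less[of x "k-1"] cf_den_pos[of x "Suc 0"] by (cases k) auto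

lemma cf_den_ge: "x \<notin> \<rat> \<Longrightarrow> cf_den x k \<ge> int k"
proof (induction k)
  case (Suc k)
  then show ?case using cf_den_less[of x "k-1"] cf_den_pos[of x "Suc 0"] by (cases k) auto
qed simp

text \<open>The point where bounded partial quotients enter: consecutive denominators have bounded
  ratio.\<close>

lemma cf_den_bounded:
  assumes x: "x \<notin> \<rat>" and B: "\<And>i. \<bar>cf_coeff x i\<bar> \<le> B"
  shows "cf_den x (Suc k) \<le> (B + 1) * cf_den x k"
proof (cases k)
  case 0
  then show ?thesis using B[of 1] by simp
next
  case (Suc l)
  have "cf_coeff x (Suc (Suc l)) * cf_den x (Suc l) \<le> B * cf_den x (Suc l)"
    using B[of "Suc (Suc l)"] cf_den_pos[OF x, of "Suc l"] by (intro mult_right_mono) auto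
  then show ?thesis using Suc cf_den_le[OF x, of l] by (simp add: algebra_simps)
qed

text \<open>Solving \<open>(n, p) = u (q\<^sub>k, p\<^sub>k) + v (q\<^sub>k\<^sub>+\<^sub>1, p\<^sub>k\<^sub>+\<^sub>1)\<close> over the integers, \<open>n < q\<^sub>k\<^sub>+\<^sub>1\<close> forces \<open>u \<noteq> 0\<close> and
  opposite signs of \<open>u\<close> and \<open>v\<close>, so that the two errors, themselves of opposite sign, add up.\<close>
lemma cf_best_approximation:
  assumes x: "x \<notin> \<rat>" and n: "0 < n" "n < cf_den x (Suc k)"
  shows "\<bar>of_int n * x - of_int p\<bar> \<ge> \<bar>cf_err x k\<bar>"
proof -
  \<comment> \<open>Cramer's rule: the determinant of the system is \<open>- s\<close> with s = 1 or
    s = -1, so the solutions u and v are integers.\<close>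
  define s :: int where "s = (-1)^(Suc k)"
  have s: "s * s = 1" by (simp add: s_def flip: power_add)
  define u where "u = s * (cf_den x (Suc k) * p - cf_num x (Suc k) * n)"
  define v where "v = s * (cf_num x k * n - cf_den x k * p)"
  note det = cf_det[of x k, folded s_def]
  have "u * cf_den x k + v * cf_den x (Suc k) =
     s * n * (cf_den x (Suc k) * cf_num x k - cf_den x k * cf_num x (Suc k))"
    by (simp add: u_def v_def algebra_simps)
  then have n_eq: "n = u * cf_den x k + v * cf_den x (Suc k)"
    using s unfolding det by (simp add: mult.commute mult.left_commute)
  have "u * cf_num x k + v * cf_num x (Suc k) =
     s * p * (cf_den x (Suc k) * cf_num x k - cf_den x k * cf_num x (Suc k))"
    by (simp add: u_def v_def algebra_simps)
  then have p_eq: "p = u * cf_num x k + v * cf_num x (Suc k)"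
    using s unfolding det by (simp add: mult.commute mult.left_commute)
  have eq: "of_int n * x - of_int p = of_int u * cf_err x k + of_int v * cf_err x (Suc k)"
    by (subst n_eq, subst p_eq) (simp add: cf_err_def algebra_simps)
  have q: "cf_den x k \<ge> 1" "cf_den x (Suc k) \<ge> 1" using cf_den_pos[OF x] by auto
  have "\<not> (u \<ge> 1 \<and> v \<ge> 1)"
  proof
    assume "u \<ge> 1 \<and> v \<ge> 1"
    then have "u * cf_den x k \<ge> 1 * 1" "v * cf_den x (Suc k) \<ge> 1 * cf_den x (Suc k)"
      using q by (intro mult_mono; simp)+
    then show False using n n_eq by linarith
  qed
  moreover have "\<not> (u \<le> 0 \<and> v \<le> 0)"
  proof
    assume "u \<le> 0 \<and> v \<le> 0"
    then have "u * cf_den x k \<le> 0" "v * cf_den x (Suc k) \<le> 0"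
      using q by (simp_all add: mult_nonpos_nonneg)
    then show False using n n_eq by linarith
  qed
  moreover have "u \<noteq> 0"
  proof
    assume "u = 0"
    then have "v * cf_den x (Suc k) < 1 * cf_den x (Suc k)" "0 < v * cf_den x (Suc k)"
      using n n_eq by simp_all
    then show False using q by (simp add: zero_less_mult_iff)
  qed
  ultimately have uv: "(u \<ge> 1 \<and> v \<le> 0) \<or> (u \<le> -1 \<and> v \<ge> 0)" by linarith
  have "(cf_err x k > 0 \<and> cf_err x (Suc k) < 0) \<or> (cf_err x k < 0 \<and> cf_err x (Suc k) > 0)"
    using cf_err_sign(1)[OF x, of k] by (auto simp: mult_less_0_iff)
  moreover have "\<bar>a\<bar> \<le> \<bar>U * a + V * b\<bar>"
    if "a > 0 \<and> b < 0 \<or> a < 0 \<and> b > 0" "U \<ge> 1 \<and> V \<le> 0 \<or> U \<le> -1 \<and> V \<ge> 0" for a b U V :: real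
  proof -
    have "U * a * (V * b) \<ge> 0"
      using that by (auto simp: zero_le_mult_iff mult_le_0_iff)
    then have "\<bar>U * a + V * b\<bar> = \<bar>U * a\<bar> + \<bar>V * b\<bar>"
      unfolding zero_le_mult_iff[of "U * a"] by arith
    moreover have "1 * \<bar>a\<bar> \<le> \<bar>U\<bar> * \<bar>a\<bar>" using that by (intro mult_right_mono) auto
    ultimately show ?thesis using abs_ge_zero[of "V * b"] unfolding abs_mult by linarith
  qed
  ultimately show ?thesis unfolding eq using uv
    by (smt (verit) of_int_1 of_int_le_iff of_int_minus of_int_0)
qed

text \<open>Since p is arbitrary, this bounds the distance of n\<alpha> to the nearest integer. The
  constant may always be shrunk; \<open>c \<le> 1\<close> ensures \<open>1 \<le> M / c\<close> for
  positive M and \<open>0 \<le> ln (1 / c)\<close>.\<close>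

locale badly_approximable =
  fixes \<alpha> c :: real
  assumes c: "0 < c" "c \<le> 1"
    and approx: "\<And>(n::nat) (p::int). n \<ge> 1 \<Longrightarrow> c / real n \<le> \<bar>real n * \<alpha> - of_int p\<bar>"

text \<open>Let n lie between the denominators q_k and q_(k+1). Best approximation reduces the claim
  to the error at k; the determinant identity makes this error at least 1/(2 q_(k+1)), and q_(k+1)
  is at most (B + 1) q_k, hence at most (B + 1) n.\<close>

lemma bounded_cf_coeffs_badly_approximable:
  assumes x: "x \<notin> \<rat>" and b: "bounded_cf_coeffs x"
  shows "\<exists>c. badly_approximable x c"
proof -
  obtain B where B: "\<And>i. \<bar>cf_coeff x i\<bar> \<le> B" using b unfolding bounded_cf_coeffs_def by blast
  have B1: "B \<ge> 1" using cf_coeff_Suc_ge_1[OF x, of 0] B[of "Suc 0"] by linarith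
  define c where "c = 1 / (2 * (real_of_int B + 1))"
  have c: "0 < c" "c \<le> 1" using B1 by (simp_all add: c_def)
  have approx: "c / n \<le> \<bar>of_int n * x - of_int p\<bar>" if n: "n \<ge> 1" for n p :: int
  proof -
    define k where "k = (LEAST k. n < cf_den x (Suc k))"
    have ex: "\<exists>k. n < cf_den x (Suc k)"
      using cf_den_ge[OF x, of "Suc (nat n)"] n by (intro exI[of _ "nat n"]) linarith
    have k1: "n < cf_den x (Suc k)" unfolding k_def using LeastI_ex[OF ex] .
    have k2: "cf_den x k \<le> n"
    proof (cases k)
      case 0 then show ?thesis using n by simp
    next
      case (Suc l)
      then have "\<not> n < cf_den x (Suc l)" unfolding k_def by (metis lessI not_less_Least)
      then show ?thesis using Suc by simp
    qed
    let ?d = "cf_err x k" and ?d' = "cf_err x (Suc k)"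
    let ?q = "real_of_int (cf_den x k)" and ?q' = "real_of_int (cf_den x (Suc k))"
    have q: "?q \<ge> 1" "?q' \<ge> 1" using cf_den_pos[OF x] by simp_all
    have "real_of_int (cf_den x (Suc k) * cf_num x k - cf_den x k * cf_num x (Suc k)) = (-1)^(Suc k)"
      by (subst cf_det) simp
    moreover have "?q' * ?d - ?q * ?d' =
        - real_of_int (cf_den x (Suc k) * cf_num x k - cf_den x k * cf_num x (Suc k))"
      unfolding cf_err_def by (simp add: algebra_simps)
    ultimately have "\<bar>?q' * ?d - ?q * ?d'\<bar> = \<bar>(-1)^(Suc k)\<bar>"
      by (simp only: abs_minus_cancel)
    then have "1 = \<bar>?q' * ?d - ?q * ?d'\<bar>"
      by (simp only: power_abs abs_minus_cancel abs_one power_one)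
    also have "\<dots> \<le> ?q' * \<bar>?d\<bar> + ?q * \<bar>?d'\<bar>"
      using q abs_triangle_ineq4[of "?q' * ?d" "?q * ?d'"] by (simp add: abs_mult)
    also have "\<dots> \<le> ?q' * \<bar>?d\<bar> + ?q' * \<bar>?d\<bar>"
      using q cf_err_sign(2)[OF x, of k] cf_den_le[OF x, of k] by (intro add_left_mono mult_mono) auto
    also have "\<dots> \<le> 2 * (?q' * \<bar>?d\<bar>)" by simp
    also have "?q' \<le> (B + 1) * ?q" using cf_den_bounded[OF x B, of k]
      by (metis of_int_le_iff of_int_mult)
    also have "(B + 1) * ?q \<le> (B + 1) * real_of_int n" using B1 k2 by (intro mult_left_mono) auto
    finally have "1 \<le> 2 * ((B + 1) * real_of_int n * \<bar>?d\<bar>)" by (simp add: mult_right_mono)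
    then have "1 \<le> \<bar>?d\<bar> * (2 * (real_of_int B + 1) * real_of_int n)" by (simp add: algebra_simps)
    then have "1 / (2 * (real_of_int B + 1) * real_of_int n) \<le> \<bar>?d\<bar>"
      using n B1 by (subst pos_divide_le_eq) auto
    then have "c / n \<le> \<bar>?d\<bar>" by (simp add: c_def)
    also have "\<dots> \<le> \<bar>of_int n * x - of_int p\<bar>" using cf_best_approximation[OF x _ k1] n by simp
    finally show ?thesis .
  qed
  have "badly_approximable x c"
  proof
    show "c / real n \<le> \<bar>real n * x - of_int p\<bar>" if "n \<ge> 1" for n :: nat and p
      using approx[of "int n" p] that by simp
  qed (use c in auto)
  then show ?thesis by blast
qed

section \<open>Spacing of the multiples of a badly approximable number\<close>

text \<open>Passing to -\<alpha> turns statements about \<open>frac\<close>, the distance to the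
  integer below, into statements about the distance to the integer above.\<close>

lemma badly_approximable_uminus:
  assumes "badly_approximable \<alpha> c"
  shows "badly_approximable (- \<alpha>) c"
proof -
  interpret badly_approximable \<alpha> c by fact
  show ?thesis
  proof
    show "c / real n \<le> \<bar>real n * - \<alpha> - of_int p\<bar>" if "n \<ge> 1" for n p
      using approx[OF that, of "-p"] by simp
  qed (use c in auto)
qed

context badly_approximable
begin

lemma frac_ge: "n \<ge> 1 \<Longrightarrow> c / real n \<le> frac (real n * \<alpha>)"
  using approx[of n "\<lfloor>real n * \<alpha>\<rfloor>"] by (simp add: frac_def)

lemma frac_pos: "n \<ge> 1 \<Longrightarrow> 0 < frac (real n * \<alpha>)"
  using frac_ge[of n] c by (smt (verit) divide_pos_pos of_nat_0_less_iff less_le_trans zero_less_one)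

lemma not_Ints: "n \<ge> 1 \<Longrightarrow> real n * \<alpha> \<notin> \<int>"
  using frac_pos[of n] by (simp add: frac_gt_0_iff)

text \<open>Two of the points \<open>n \<alpha> mod 1\<close>, \<open>n \<le> M\<close>, are more than \<open>c / M\<close> apart, so each interval
  \<open>[jc/M, (j+1)c/M)\<close> contains at most one of them, and none if \<open>j = 0\<close>.\<close>
lemma sum_frac_le:
  fixes \<phi> :: "real \<Rightarrow> real"
  assumes mono: "\<And>s t. 0 < s \<Longrightarrow> s \<le> t \<Longrightarrow> \<phi> t \<le> \<phi> s" and nonneg: "\<And>t. 0 < t \<Longrightarrow> 0 \<le> \<phi> t"
  shows "(\<Sum>n=1..M. \<phi> (frac (real n * \<alpha>))) \<le> (\<Sum>j=1..nat \<lfloor>real M / c\<rfloor>. \<phi> (real j * c / real M))"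
proof (cases "M = 0")
  case False
  define h where "h n = nat \<lfloor>frac (real n * \<alpha>) * (real M / c)\<rfloor>" for n :: nat
  have Mc: "real M / c > 0" using False c by simp
  have h_le: "real (h n) \<le> frac (real n * \<alpha>) * (real M / c)"
    and h_gt: "frac (real n * \<alpha>) * (real M / c) < real (h n) + 1" for n

  proof -
    have "0 \<le> frac (real n * \<alpha>) * (real M / c)" using Mc by (intro mult_nonneg_nonneg) auto
    then show "real (h n) \<le> frac (real n * \<alpha>) * (real M / c)"
      and "frac (real n * \<alpha>) * (real M / c) < real (h n) + 1"
      unfolding h_def by linarith+
  qed
  have h_ge1: "h n \<ge> 1" if n: "n \<in> {1..M}" for n
  proof -
    have "1 = c / real M * (real M / c)" using c False by simp
    also have "\<dots> \<le> c / real n * (real M / c)"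
      using n c by (intro mult_right_mono frac_le) auto
    also have "\<dots> \<le> frac (real n * \<alpha>) * (real M / c)"
      using n Mc by (intro mult_right_mono frac_ge) auto
    finally show ?thesis using le_floor_iff[of 1] by (simp add: h_def le_nat_iff)
  qed
  have h_ub: "h n \<le> nat \<lfloor>real M / c\<rfloor>" for n
    unfolding h_def using frac_lt_1[of "real n * \<alpha>"] Mc
    by (intro nat_mono floor_mono) (metis frac_ge_0 less_imp_le mult_left_le_one_le times_divide_eq_right)
  have "inj_on h {1..M}"
  proof (rule linorder_inj_onI')
    fix m n assume mn: "m \<in> {1..M}" "n \<in> {1..M}" "m < n"
    show "h m \<noteq> h n"
    proof
      assume "h m = h n"
      then have "\<bar>frac (real n * \<alpha>) * (real M / c) - frac (real m * \<alpha>) * (real M / c)\<bar> < 1"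
        using h_le[of m] h_gt[of m] h_le[of n] h_gt[of n] by linarith
      then have "\<bar>frac (real n * \<alpha>) - frac (real m * \<alpha>)\<bar> * (real M / c) < 1"
        using Mc by (simp add: left_diff_distrib[symmetric] abs_mult c abs_of_pos[OF c(1)] del: times_divide_eq_right)
      then have "\<bar>frac (real n * \<alpha>) - frac (real m * \<alpha>)\<bar> < c / real M"
        using Mc c by (simp add: field_simps)
      \<comment> \<open>The difference of two points is (n - m)\<alpha> up to an integer, so
        \<open>approx\<close> at the index n - m, which is at most M, separates them.\<close>
      moreover have "frac (real n * \<alpha>) - frac (real m * \<alpha>) =
          real (n - m) * \<alpha> - of_int (\<lfloor>real n * \<alpha>\<rfloor> - \<lfloor>real m * \<alpha>\<rfloor>)"
        using mn by (simp add: frac_def of_nat_diff algebra_simps)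
      moreover have "1 \<le> n - m" using mn by simp
      ultimately have "c / real (n - m) < c / real M"
        using approx[of "n - m" "\<lfloor>real n * \<alpha>\<rfloor> - \<lfloor>real m * \<alpha>\<rfloor>"] by simp
      moreover have "c / real M \<le> c / real (n - m)" using mn c by (intro divide_left_mono) auto
      ultimately show False by simp
    qed
  qed
  have "(\<Sum>n=1..M. \<phi> (frac (real n * \<alpha>))) \<le> (\<Sum>n=1..M. \<phi> (real (h n) * c / real M))"
  proof (rule sum_mono)
    fix n assume n: "n \<in> {1..M}"
    have "real (h n) * c / real M \<le> frac (real n * \<alpha>)"
      using h_le[of n] False c by (simp add: field_simps)
    moreover have "0 < real (h n) * c / real M" using h_ge1[OF n] c False by simp
    ultimately show "\<phi> (frac (real n * \<alpha>)) \<le> \<phi> (real (h n) * c / real M)" by (rule mono[rotated])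
  qed
  also have "\<dots> = (\<Sum>j\<in>h ` {1..M}. \<phi> (real j * c / real M))"
    using \<open>inj_on h {1..M}\<close> by (simp add: sum.reindex)
  also have "\<dots> \<le> (\<Sum>j=1..nat \<lfloor>real M / c\<rfloor>. \<phi> (real j * c / real M))"
  proof (rule sum_mono2)
    show "h ` {1..M} \<subseteq> {1..nat \<lfloor>real M / c\<rfloor>}" using h_ge1 h_ub by auto
    show "0 \<le> \<phi> (real j * c / real M)" if "j \<in> {1..nat \<lfloor>real M / c\<rfloor>} - h ` {1..M}" for j
      using that c False by (intro nonneg) auto
  qed simp
  finally show ?thesis .
qed simp

end

section \<open>The function \<open>ln |2 sin (\<pi>x)|\<close>\<close>

lemma abs_sin_pi_frac: "\<bar>sin (pi * x)\<bar> = sin (pi * frac x)"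
proof -
  have "pi * x = pi * frac x + of_int \<lfloor>x\<rfloor> * pi" by (simp add: frac_def algebra_simps)
  moreover have sz: "sin (of_int \<lfloor>x\<rfloor> * pi) = 0"
    by (metis Ints_of_int mult.commute sin_times_pi_eq_0)
  ultimately have "sin (pi * x) = sin (pi * frac x) * cos (of_int \<lfloor>x\<rfloor> * pi)"
    by (simp add: sin_add)
  moreover have "\<bar>cos (of_int \<lfloor>x\<rfloor> * pi)\<bar> = 1"
    using sin_cos_squared_add[of "of_int \<lfloor>x\<rfloor> * pi"] sz by (simp add: abs_square_eq_1)
  moreover have "sin (pi * frac x) \<ge> 0"
    using frac_lt_1[of x] frac_ge_0[of x] by (intro sin_ge_zero) (auto simp: mult_le_cancel_left1)
  ultimately show ?thesis by (simp add: abs_mult)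
qed

text \<open>Concavity would give 2t. The cubic Taylor bound is enough: for y = \<pi>t at most 8/5 it
  yields sin y \<ge> (1 - 64/150) y, and y \<ge> 3t.\<close>

lemma sin_pi_ge:
  fixes t :: real
  assumes "0 \<le> t" "t \<le> 1/2"
  shows "t \<le> sin (pi * t)"
proof -
  have pi: "3 < pi" "pi < 16/5" using pi_approx by auto
  define y where "y = pi * t"
  have y: "0 \<le> y" "y \<le> 8/5" "3 * t \<le> y"
    using assms pi mult_mono[of pi "16/5" t "1/2"] mult_right_mono[of 3 pi t] by (auto simp: y_def)
  have "\<bar>sin y - y\<bar> \<le> y ^ 3 / 6"
    using Maclaurin_sin_bound[of y 3] y
    by (simp add: sin_coeff_def numeral_3_eq_3)
  moreover have "y ^ 3 / 6 \<le> y * (8/5 * (8/5)) / 6"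
    unfolding power3_eq_cube mult.assoc using y by (intro divide_right_mono mult_left_mono mult_mono) auto
  ultimately have "sin y \<ge> y - y * (64 / 150)" unfolding abs_le_iff by simp
  then show ?thesis using y assms unfolding y_def[symmetric] by linarith
qed

lemma min_frac_le_abs_sin: "min (frac x) (1 - frac x) \<le> \<bar>sin (pi * x)\<bar>"
proof (cases "frac x \<le> 1/2")
  case True
  then show ?thesis using sin_pi_ge[of "frac x"] by (simp add: abs_sin_pi_frac)
next
  case False
  have "sin (pi * (1 - frac x)) = sin (pi * frac x)"
    by (simp add: right_diff_distrib sin_diff)
  then show ?thesis using sin_pi_ge[of "1 - frac x"] False frac_lt_1[of x] by (simp add: abs_sin_pi_frac)
qed

text \<open>The distance to the nearest integer is the smaller of two one-sided distances; for
  nonnegative \<phi> the value at the minimum is at most the sum of both values. This splits a sum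
  over sines into two one-sided sums, for \<alpha> and for -\<alpha>.\<close>

lemma antimono_abs_sin_le:
  fixes \<phi> :: "real \<Rightarrow> real"
  assumes mono: "\<And>s t. 0 < s \<Longrightarrow> s \<le> t \<Longrightarrow> \<phi> t \<le> \<phi> s" and nonneg: "\<And>t. 0 < t \<Longrightarrow> 0 \<le> \<phi> t"
    and x: "x \<notin> \<int>"
  shows "\<phi> \<bar>sin (pi * x)\<bar> \<le> \<phi> (frac x) + \<phi> (frac (- x))"
proof -
  have f: "0 < frac x" "frac x < 1" "frac (-x) = 1 - frac x"
    using x by (auto simp: frac_gt_0_iff frac_lt_1 frac_neg)
  then have "\<phi> \<bar>sin (pi * x)\<bar> \<le> \<phi> (min (frac x) (1 - frac x))"
    by (intro mono min_frac_le_abs_sin) auto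
  also have "\<dots> \<le> \<phi> (frac x) + \<phi> (1 - frac x)"
    using f nonneg[of "frac x"] nonneg[of "1 - frac x"] by (simp add: min_def)
  finally show ?thesis using f by simp
qed

section \<open>Abel means of the Fourier series of \<open>log_sine\<close>\<close>

definition log_sine :: "real \<Rightarrow> real" where
  "log_sine x = ln \<bar>2 * sin (pi * x)\<bar>"

text \<open>This is ln |1 - r exp(2\<pi>ix)|, because |1 - r exp(2\<pi>ix)|^2 = (1 - r)^2 + 4 r
  sin(\<pi>x)^2. At r = 1 it becomes \<open>log_sine\<close>.\<close>

definition log_sine_abel :: "real \<Rightarrow> real \<Rightarrow> real" where
  "log_sine_abel r x = ln ((1 - r)\<^sup>2 + r * (2 * sin (pi * x))\<^sup>2) / 2"

text \<open>Real part of the power series of ln(1 - z) at z = r exp(2\<pi>ix). The term at k = 0 is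
  a division by zero and therefore 0.\<close>

lemma log_sine_abel_sums:
  assumes r: "0 \<le> r" "r < 1"
  shows "(\<lambda>k. r ^ k * cos (2 * pi * real k * x) / real k) sums (- log_sine_abel r x)"
proof -
  define z where "z = of_real r * cis (2 * pi * x)"
  have z: "cmod z = r" using r by (simp add: z_def norm_mult)
  have nz: "1 - z \<noteq> 0" using z r by auto
  have "(\<lambda>n. - ((z) ^ n) / of_nat n) sums ln (1 - z)"
    using Ln_series'[of "-z"] z r by simp
  then have "(\<lambda>n. Re (- (z ^ n) / of_nat n)) sums Re (ln (1 - z))" by (rule sums_Re)
  moreover have "Re (- (z ^ n) / of_nat n) = - (r ^ n * cos (2 * pi * real n * x) / real n)" for n
  proof -
    have "z ^ n = of_real (r ^ n) * cis (2 * pi * real n * x)"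
      unfolding z_def power_mult_distrib Complex.DeMoivre by (simp add: mult_ac)
    then show ?thesis by (simp add: Re_divide_of_nat)
  qed
  moreover have "Re (ln (1 - z)) = log_sine_abel r x"
  proof -
    have "(cmod (1 - z))\<^sup>2 = (1 - r * cos (2 * pi * x))\<^sup>2 + (r * sin (2 * pi * x))\<^sup>2"
      by (simp add: z_def cmod_power2)
    also have "\<dots> = 1 - 2 * r * cos (2 * pi * x) + r\<^sup>2 * ((sin (2 * pi * x))\<^sup>2 + (cos (2 * pi * x))\<^sup>2)"
      by (simp add: power2_diff power_mult_distrib distrib_left del: sin_cos_squared_add sin_cos_squared_add2)
    also have "\<dots> = 1 - 2 * r * (1 - 2 * (sin (pi * x))\<^sup>2) + r\<^sup>2"
      unfolding sin_cos_squared_add by (simp add: mult.assoc cos_double_sin)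
    also have "\<dots> = (1 - r)\<^sup>2 + r * (2 * sin (pi * x))\<^sup>2"
      by (simp add: power2_eq_square algebra_simps)
    finally have eq: "(cmod (1 - z))\<^sup>2 = (1 - r)\<^sup>2 + r * (2 * sin (pi * x))\<^sup>2" .
    have "Re (ln (1 - z)) = ln (cmod (1 - z))" using nz by simp
    also have "\<dots> = ln ((cmod (1 - z))\<^sup>2) / 2" using nz by (simp add: ln_realpow)
    finally show ?thesis by (simp add: eq log_sine_abel_def)
  qed
  ultimately have "(\<lambda>n. - (r ^ n * cos (2 * pi * real n * x) / real n)) sums log_sine_abel r x"
    by (simp only:)
  from sums_minus[OF this] show ?thesis by simp
qed

text \<open>Factor out |2 sin(\<pi>x)|^2. What remains depends on x only through the ratio of 1 - r
  to the sine: the two functions differ appreciably only within distance about 1 - r of an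
  integer.\<close>

lemma log_sine_minus_abel:
  assumes r: "0 < r" and s: "sin (pi * x) \<noteq> 0"
  shows "log_sine x - log_sine_abel r x = - ln (r + ((1 - r) / (2 * \<bar>sin (pi * x)\<bar>))\<^sup>2) / 2"
proof -
  define w where "w = \<bar>2 * sin (pi * x)\<bar>"
  have w: "w > 0" "w\<^sup>2 = (2 * sin (pi * x))\<^sup>2" using s by (auto simp: w_def)
  have "(1 - r)\<^sup>2 + r * w\<^sup>2 = w\<^sup>2 * (r + ((1 - r) / w)\<^sup>2)"
    using w(1) by (simp add: distrib_left power_divide)
  then have "ln ((1 - r)\<^sup>2 + r * w\<^sup>2) = ln (w\<^sup>2 * (r + ((1 - r) / w)\<^sup>2))" by simp
  also have "\<dots> = 2 * ln w + ln (r + ((1 - r) / w)\<^sup>2)"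
    using w(1) add_pos_nonneg[OF r, of "((1 - r) / w)\<^sup>2"] by (subst ln_mult_pos) (auto simp: ln_realpow)
  finally have "ln ((1 - r)\<^sup>2 + r * w\<^sup>2) = 2 * ln w + ln (r + ((1 - r) / w)\<^sup>2)" .
  then show ?thesis unfolding log_sine_def log_sine_abel_def w(2)[symmetric]
    by (simp add: w_def abs_mult field_simps)
qed

lemma abs_ln_add_le:
  fixes r y :: real
  assumes "1/2 \<le> r" "r < 1" "0 \<le> y"
  shows "\<bar>ln (r + y)\<bar> \<le> 2 * (1 - r) + ln (1 + y)"
proof -
  have "ln (r + y) \<le> ln (1 + y)" "ln r \<le> ln (r + y)" using assms by (subst ln_le_cancel_iff; simp)+
  moreover have "- ln r \<le> 2 * (1 - r)"
  proof -
    have "- ln r = ln (1 / r)" using assms by (simp add: ln_div)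
    also have "\<dots> \<le> 1 / r - 1" using assms by (intro ln_le_minus_one) auto
    also have "\<dots> = (1 - r) * (1 / r)" using assms by (simp add: field_simps)
    also have "\<dots> \<le> (1 - r) * 2" using assms by (intro mult_left_mono) (auto simp: field_simps)
    finally show ?thesis by simp
  qed
  moreover have "0 \<le> ln (1 + y)" using assms by simp
  ultimately show ?thesis using assms unfolding abs_le_iff by (intro conjI) (smt (verit))+
qed

lemma abs_log_sine_minus_abel_le:
  assumes r: "1/2 \<le> r" "r < 1" and s: "sin (pi * x) \<noteq> 0"
  shows "\<bar>log_sine x - log_sine_abel r x\<bar> \<le> (1 - r) + ((1 - r) / \<bar>sin (pi * x)\<bar>)\<^sup>2"
proof -
  define y where "y = ((1 - r) / (2 * \<bar>sin (pi * x)\<bar>))\<^sup>2"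
  have "\<bar>log_sine x - log_sine_abel r x\<bar> = \<bar>ln (r + y)\<bar> / 2"
    unfolding y_def using r by (subst log_sine_minus_abel[OF _ s]) auto
  also have "\<dots> \<le> (2 * (1 - r) + ln (1 + y)) / 2"
    using r by (intro divide_right_mono abs_ln_add_le) (auto simp: y_def)
  also have "ln (1 + y) \<le> y" by (intro ln_add_one_self_le_self) (simp add: y_def)
  also have "(2 * (1 - r) + y) / 2 \<le> (1 - r) + ((1 - r) / \<bar>sin (pi * x)\<bar>)\<^sup>2"
    using s by (simp add: y_def power_divide power_mult_distrib field_simps)
  finally show ?thesis by simp
qed

text \<open>For fixed r the points come arbitrarily close to the integers, so the bound has to be
  integrable in x. The ratio of 1 - r to the sine is not, but its square root is. With u = t^4 one
  has ln(1 + t^8) \<le> 8 ln(1 + t) \<le> 8t, and t^2 is the square root of u.\<close>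

lemma log_sine_minus_abel_squared_le:
  assumes r: "1/2 \<le> r" "r < 1" and s: "sin (pi * x) \<noteq> 0"
  shows "(log_sine x - log_sine_abel r x)\<^sup>2 \<le> 2 * (1 - r) + 32 * sqrt ((1 - r) / \<bar>sin (pi * x)\<bar>)"
proof -
  define u where "u = (1 - r) / (2 * \<bar>sin (pi * x)\<bar>)"
  have u: "0 \<le> u" using r by (simp add: u_def)
  define t where "t = sqrt (sqrt u)"
  have t: "0 \<le> t" "t\<^sup>2 = sqrt u" using u by (simp_all add: t_def)
  have "t ^ 8 = (t\<^sup>2) ^ 4" by (simp flip: power_mult)
  also have "\<dots> = ((sqrt u)\<^sup>2)\<^sup>2" unfolding t(2) by (simp flip: power_mult)
  finally have t8: "t ^ 8 = u\<^sup>2" using u by simp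
  have "1 + t ^ 8 \<le> (1 + t) ^ 8"
    using t(1) by (simp add: eval_nat_numeral algebra_simps)
  then have "ln (1 + u\<^sup>2) \<le> ln ((1 + t) ^ 8)" using t by (simp add: t8 add_pos_nonneg)
  also have "\<dots> = 8 * ln (1 + t)" using t by (simp add: ln_realpow)
  also have "\<dots> \<le> 8 * t" using t ln_add_one_self_le_self[of t] by simp
  finally have l: "ln (1 + u\<^sup>2) \<le> 8 * t" .
  have "\<bar>log_sine x - log_sine_abel r x\<bar> = \<bar>ln (r + u\<^sup>2)\<bar> / 2"
    unfolding u_def using r by (subst log_sine_minus_abel[OF _ s]) auto
  also have "\<dots> \<le> (2 * (1 - r) + ln (1 + u\<^sup>2)) / 2"
    using r by (intro divide_right_mono abs_ln_add_le) auto
  also have "\<dots> \<le> (1 - r) + 4 * t" using l by simp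
  finally have "\<bar>log_sine x - log_sine_abel r x\<bar>\<^sup>2 \<le> ((1 - r) + 4 * t)\<^sup>2" by (intro power_mono) auto
  also have "\<dots> \<le> 2 * (1 - r)\<^sup>2 + 2 * (4 * t)\<^sup>2"
    using sum_squares_bound[of "1 - r" "4 * t"] by (simp add: power2_eq_square algebra_simps)
  also have "(1 - r)\<^sup>2 \<le> (1 - r)" using r by (simp add: power2_eq_square mult_left_le_one_le)
  also have "2 * (4 * t)\<^sup>2 = 32 * sqrt u" using t(2) by (simp add: power_mult_distrib)
  also have "sqrt u \<le> sqrt ((1 - r) / \<bar>sin (pi * x)\<bar>)"
    unfolding u_def using r s by (intro real_sqrt_le_mono divide_left_mono) auto
  finally show ?thesis by simp
qed

section \<open>Cosine sums and the sum of \<open>log_sine\<close> over the multiples of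
  \<alpha>\<close>

lemma sum_cos_le:
  assumes s: "sin (pi * x) \<noteq> 0"
  shows "\<bar>\<Sum>n=1..M. cos (2 * pi * real n * x)\<bar> \<le> 1 / \<bar>sin (pi * x)\<bar>"
proof -
  define z where "z = cis (2 * pi * x)"
  have z1: "cmod (1 - z) = 2 * \<bar>sin (pi * x)\<bar>"
    using dist_exp_i_1[of "2 * pi * x"] by (simp add: z_def cis_conv_exp norm_minus_commute)
  then have nz: "1 - z \<noteq> 0" using s by auto
  have "(\<Sum>n=1..M. cos (2 * pi * real n * x)) = Re (\<Sum>n=1..M. z ^ n)"
    unfolding z_def Complex.DeMoivre by (simp add: mult_ac)
  also have "(\<Sum>n=1..M. z ^ n) = (z - z ^ Suc M) / (1 - z)"
    using nz by (subst sum_gp) auto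
  finally have "\<bar>\<Sum>n=1..M. cos (2 * pi * real n * x)\<bar> \<le> cmod ((z - z ^ Suc M) / (1 - z))"
    using abs_Re_le_cmod by simp
  also have "\<dots> \<le> 2 / (2 * \<bar>sin (pi * x)\<bar>)"
    unfolding norm_divide z1 using norm_triangle_ineq4[of z "z ^ Suc M"]
    by (intro divide_right_mono) (auto simp: z_def norm_power norm_mult)
  finally show ?thesis by simp
qed

lemma harm_le_1_plus_ln: "1 \<le> n \<Longrightarrow> harm n \<le> (1 + ln (real n) :: real)"
  using decseqD[OF decseq_harm_diff_ln, of 0 "n - 1"] by (simp add: harm_expand)

context badly_approximable
begin

lemma sin_nonzero: "n \<ge> 1 \<Longrightarrow> sin (pi * (real n * \<alpha>)) \<noteq> 0"
  using not_Ints[of n] by (metis mult.commute sin_times_pi_eq_0)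

lemma abs_sin_ge:
  assumes "n \<ge> 1"
  shows "c / real n \<le> \<bar>sin (pi * (real n * \<alpha>))\<bar>"
proof -
  interpret neg: badly_approximable "- \<alpha>" c
    using badly_approximable_uminus badly_approximable_axioms .
  have "c / real n \<le> min (frac (real n * \<alpha>)) (1 - frac (real n * \<alpha>))"
    using frac_ge[OF assms] neg.frac_ge[OF assms] not_Ints[OF assms] by (simp add: frac_neg)
  then show ?thesis using min_frac_le_abs_sin order_trans by blast
qed

lemma sum_abs_sin_le:
  fixes \<phi> :: "real \<Rightarrow> real"
  assumes mono: "\<And>s t. 0 < s \<Longrightarrow> s \<le> t \<Longrightarrow> \<phi> t \<le> \<phi> s" and nonneg: "\<And>t. 0 < t \<Longrightarrow> 0 \<le> \<phi> t"
  shows "(\<Sum>n=1..M. \<phi> \<bar>sin (pi * (real n * \<alpha>))\<bar>) \<le> 2 * (\<Sum>j=1..nat \<lfloor>real M / c\<rfloor>. \<phi> (real j * c / real M))"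
proof -
  interpret neg: badly_approximable "- \<alpha>" c
    using badly_approximable_uminus badly_approximable_axioms .
  have "(\<Sum>n=1..M. \<phi> \<bar>sin (pi * (real n * \<alpha>))\<bar>) \<le>
      (\<Sum>n=1..M. \<phi> (frac (real n * \<alpha>)) + \<phi> (frac (- (real n * \<alpha>))))"
    by (intro sum_mono antimono_abs_sin_le mono nonneg) (auto intro!: not_Ints)
  also have "\<dots> = (\<Sum>n=1..M. \<phi> (frac (real n * \<alpha>))) + (\<Sum>n=1..M. \<phi> (frac (real n * - \<alpha>)))"
    by (simp add: sum.distrib)
  finally show ?thesis
    using sum_frac_le[of \<phi> M, OF mono nonneg] neg.sum_frac_le[of \<phi> M, OF mono nonneg] by linarith
qed

lemma sum_inverse_abs_sin_le:
  assumes "M \<ge> 1"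
  shows "(\<Sum>n=1..M. 1 / \<bar>sin (pi * (real n * \<alpha>))\<bar>) \<le> 2 * (real M / c) * (1 + ln (real M / c))"
proof -
  have Mc: "1 \<le> real M / c" using assms c by (simp add: field_simps)
  define J where "J = nat \<lfloor>real M / c\<rfloor>"
  have J: "1 \<le> J" "real J \<le> real M / c" using Mc unfolding J_def by linarith+
  have "(\<Sum>n=1..M. 1 / \<bar>sin (pi * (real n * \<alpha>))\<bar>) \<le> 2 * (\<Sum>j=1..J. 1 / (real j * c / real M))"
    unfolding J_def by (rule sum_abs_sin_le) (auto intro: divide_left_mono)
  also have "(\<Sum>j=1..J. 1 / (real j * c / real M)) = (real M / c) * harm J"
    by (simp add: harm_def sum_distrib_left field_simps)
  also have "2 * ((real M / c) * harm J) \<le> 2 * ((real M / c) * (1 + ln (real M / c)))"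
  proof (intro mult_left_mono)
    show "harm J \<le> 1 + ln (real M / c)"
      using harm_le_1_plus_ln[OF J(1)] ln_le_cancel_iff[of "real J" "real M / c"] J Mc by linarith
  qed (use Mc in auto)
  finally show ?thesis by (simp only: mult.assoc)
qed

text \<open>Each summand is a Fourier coefficient 1/k times the bound for a cosine sum. Dyadic
  blocks replace partial summation: for k from 2^L to 2^(L+1) the weight 1/k is at most 2^(-L), and
  the O(M log M) bound at M = 2^(L+1) leaves O(L + 1) for the block.\<close>

lemma dyadic_sum_inverse_abs_sin_le:
  "(\<Sum>k=1..<2^L. 1 / (real k * \<bar>sin (pi * (real k * \<alpha>))\<bar>)) \<le> (4 * (1 + ln (1 / c)) / c) * (real L + 1)\<^sup>2"
proof (induction L)
  case 0
  have "0 \<le> 4 * (1 + ln (1 / c)) / c" using c by (intro divide_nonneg_pos mult_nonneg_nonneg add_nonneg_nonneg) auto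
  then show ?case by simp
next
  case (Suc L)
  define A where "A = 1 + ln (1 / c)"
  have A: "A \<ge> 1" using c by (simp add: A_def)
  let ?B = "\<lambda>k. 1 / \<bar>sin (pi * (real k * \<alpha>))\<bar>"
  have "{1..<2 ^ Suc L} = {1..<2 ^ L} \<union> {2 ^ L..<2 ^ Suc L :: nat}" by (intro ivl_disj_un_two(3)[symmetric]) auto
  then have "(\<Sum>k=1..<2^Suc L. 1 / (real k * \<bar>sin (pi * (real k * \<alpha>))\<bar>)) =
      (\<Sum>k=1..<2^L. 1 / (real k * \<bar>sin (pi * (real k * \<alpha>))\<bar>)) +
      (\<Sum>k=2^L..<2^Suc L. 1 / (real k * \<bar>sin (pi * (real k * \<alpha>))\<bar>))"
    by (simp add: sum.union_disjoint)
  also have "(\<Sum>k=2^L..<2^Suc L. 1 / (real k * \<bar>sin (pi * (real k * \<alpha>))\<bar>)) \<le> (\<Sum>k=2^L..<2^Suc L. 1 / 2^L * ?B k)"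
  proof (rule sum_mono)
    fix k :: nat assume k: "k \<in> {2^L..<2^Suc L}"
    then have "1 / real k \<le> 1 / 2 ^ L" by (intro divide_left_mono) (auto simp: numeral_power_le_of_nat_cancel_iff)
    then have "1 / real k * ?B k \<le> 1 / 2 ^ L * ?B k" by (intro mult_right_mono) auto
    then show "1 / (real k * \<bar>sin (pi * (real k * \<alpha>))\<bar>) \<le> 1 / 2^L * ?B k" by simp
  qed
  also have "\<dots> \<le> (\<Sum>k=1..2^Suc L. 1 / 2^L * ?B k)"
    by (intro sum_mono2) (auto simp: Suc_le_eq intro: less_le_trans[of 0 "2 ^ L"])
  also have "\<dots> = 1 / 2 ^ L * (\<Sum>k=1..2^Suc L. ?B k)" by (simp only: sum_distrib_left)
  also have "\<dots> \<le> 1 / 2 ^ L * (2 * (real (2 ^ Suc L) / c) * (1 + ln (real (2 ^ Suc L) / c)))"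
    by (intro mult_left_mono sum_inverse_abs_sin_le) auto
  also have "\<dots> = (4 / c) * (1 + ln (2 ^ Suc L / c))" by simp
  also have "ln (2 ^ Suc L / c) = (real L + 1) * ln 2 + ln (1 / c)"
    using c by (simp add: ln_div ln_mult ln_realpow algebra_simps)
  also have "(4 / c) * (1 + ((real L + 1) * ln 2 + ln (1 / c))) \<le> (4 / c) * ((real L + 2) * A)"
  proof (intro mult_left_mono)
    have "(real L + 1) * ln 2 \<le> (real L + 1) * A"
      using A ln_2_less_1 by (intro mult_left_mono) auto
    then show "1 + ((real L + 1) * ln 2 + ln (1 / c)) \<le> (real L + 2) * A" by (simp add: A_def algebra_simps)
  qed (use c in auto)
  also note Suc.IH
  also have "4 * (1 + ln (1 / c)) / c * (real L + 1)\<^sup>2 + 4 / c * ((real L + 2) * A) =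
      4 * A / c * ((real L + 1)\<^sup>2 + (real L + 2))" by (simp add: A_def algebra_simps add_divide_distrib)
  also have "\<dots> \<le> 4 * A / c * (real (Suc L) + 1)\<^sup>2"
    using c A by (intro mult_left_mono) (auto simp: power2_eq_square algebra_simps)
  finally show ?case by (simp add: A_def)
qed

text \<open>The choice \<open>r = 1 - 1/M\<^sup>2\<close> makes the Abel mean indistinguishable from the function itself at the
  points \<open>n \<alpha>\<close>, whose distance from the integers is at least \<open>c / M\<close>, while the Fourier coefficients
  of index \<open>k \<ge> 2\<^sup>L \<ge> M\<^sup>3\<close> contribute at most \<open>1\<close>.\<close>
lemma sum_log_sine_le:
  assumes M: "M \<ge> 2" and L: "real M ^ 3 \<le> 2 ^ L"
  shows "\<bar>\<Sum>n=1..M. log_sine (real n * \<alpha>)\<bar> \<le> 2 + 1 / c\<^sup>2 + (4 * (1 + ln (1 / c)) / c) * (real L + 1)\<^sup>2"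
proof -
  define r where "r = 1 - 1 / (real M)\<^sup>2"
  have "4 \<le> (real M)\<^sup>2" using M power_mono[of 2 "real M" 2] by simp
  then have "1 / (real M)\<^sup>2 \<le> 1 / 4" by (intro frac_le) auto
  moreover have "0 < 1 / (real M)\<^sup>2" using M by simp
  ultimately have r: "1/2 \<le> r" "r < 1" "1 - r = 1 / (real M)\<^sup>2" unfolding r_def by linarith+
  \<comment> \<open>The factor of the k-th Fourier coefficient once the sums over n and k are
    exchanged. The geometric bound serves for k below 2^L, the trivial bound M beyond.\<close>
  define C where "C k = (\<Sum>n=1..M. cos (2 * pi * real k * (real n * \<alpha>)))" for k :: nat
  have C_le: "\<bar>C k\<bar> \<le> 1 / \<bar>sin (pi * (real k * \<alpha>))\<bar>" if "k \<ge> 1" for k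
    using sum_cos_le[OF sin_nonzero[OF that], of M] by (simp add: C_def mult_ac)
  have C_le': "\<bar>C k\<bar> \<le> real M" for k
  proof -
    have "\<bar>C k\<bar> \<le> (\<Sum>n=1..M. \<bar>cos (2 * pi * real k * (real n * \<alpha>))\<bar>)"
      unfolding C_def by (rule sum_abs)
    also have "\<dots> \<le> (\<Sum>n=1..M. 1)" by (intro sum_mono) simp
    finally show ?thesis by simp
  qed
  have "(\<lambda>k. \<Sum>n=1..M. r ^ k * cos (2 * pi * real k * (real n * \<alpha>)) / real k) sums
      (\<Sum>n=1..M. - log_sine_abel r (real n * \<alpha>))"
    using r by (intro sums_sum log_sine_abel_sums) auto
  also have "(\<lambda>k. \<Sum>n=1..M. r ^ k * cos (2 * pi * real k * (real n * \<alpha>)) / real k) = (\<lambda>k. r ^ k * C k / real k)"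
    by (simp add: C_def sum_distrib_left sum_divide_distrib)
  finally have sums: "(\<lambda>k. r ^ k * C k / real k) sums (- (\<Sum>n=1..M. log_sine_abel r (real n * \<alpha>)))"
    by (simp add: sum_negf)
  let ?K = "2 ^ L :: nat"
  have "(\<lambda>k. r ^ (k + ?K) * C (k + ?K) / real (k + ?K)) sums
      (- (\<Sum>n=1..M. log_sine_abel r (real n * \<alpha>)) - (\<Sum>k<?K. r ^ k * C k / real k))"
    using sums_split_initial_segment[OF sums] .
  moreover have "(\<lambda>k. real M / 2 ^ L * r ^ k) sums (real M / 2 ^ L * (1 / (1 - r)))"
    using r by (intro sums_mult geometric_sums) auto
  moreover have "\<bar>r ^ (k + ?K) * C (k + ?K) / real (k + ?K)\<bar> \<le> real M / 2 ^ L * r ^ k" for k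
  proof -
    have "\<bar>r ^ (k + ?K) * C (k + ?K) / real (k + ?K)\<bar> = r ^ k * (r ^ ?K * \<bar>C (k + ?K)\<bar>) / real (k + ?K)"
      using r by (simp add: abs_mult power_add)
    also have "\<dots> \<le> r ^ k * (1 * real M) / 2 ^ L"
      using r C_le' by (intro frac_le mult_left_mono mult_mono) (auto intro: power_le_one)
    finally show ?thesis by (simp add: mult_ac)
  qed
  ultimately have "\<bar>- (\<Sum>n=1..M. log_sine_abel r (real n * \<alpha>)) - (\<Sum>k<?K. r ^ k * C k / real k)\<bar> \<le>
      real M / 2 ^ L * (1 / (1 - r))"
    by (metis (no_types, lifting) norm_suminf_le real_norm_def sums_iff)
  also have "\<dots> = real M ^ 3 / 2 ^ L" by (simp add: r power2_eq_square power3_eq_cube)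
  also have "\<dots> \<le> 1" using L by simp
  finally have tail: "\<bar>- (\<Sum>n=1..M. log_sine_abel r (real n * \<alpha>)) - (\<Sum>k<?K. r ^ k * C k / real k)\<bar> \<le> 1" .
  have "\<bar>\<Sum>k<?K. r ^ k * C k / real k\<bar> = \<bar>\<Sum>k=1..<?K. r ^ k * C k / real k\<bar>"
    by (intro arg_cong[of _ _ abs] sum.mono_neutral_right) auto
  also have "\<dots> \<le> (\<Sum>k=1..<?K. \<bar>r ^ k * C k / real k\<bar>)" by (rule sum_abs)
  also have "\<dots> \<le> (\<Sum>k=1..<?K. 1 / (real k * \<bar>sin (pi * (real k * \<alpha>))\<bar>))"
  proof (rule sum_mono)
    fix k assume k: "k \<in> {1..<?K}"
    have "\<bar>r ^ k * C k / real k\<bar> = r ^ k * \<bar>C k\<bar> / real k" using r by (simp add: abs_mult)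
    also have "\<dots> \<le> 1 * (1 / \<bar>sin (pi * (real k * \<alpha>))\<bar>) / real k"
      using r k by (intro divide_right_mono mult_mono C_le) (auto intro: power_le_one)
    finally show "\<bar>r ^ k * C k / real k\<bar> \<le> 1 / (real k * \<bar>sin (pi * (real k * \<alpha>))\<bar>)" by (simp add: mult_ac)
  qed
  also note dyadic_sum_inverse_abs_sin_le
  finally have "\<bar>\<Sum>n=1..M. log_sine_abel r (real n * \<alpha>)\<bar> \<le> 1 + (4 * (1 + ln (1 / c)) / c) * (real L + 1)\<^sup>2"
    using tail by linarith
  moreover have "\<bar>\<Sum>n=1..M. (log_sine (real n * \<alpha>) - log_sine_abel r (real n * \<alpha>))\<bar> \<le> 1 + 1 / c\<^sup>2"
  proof -
    have "\<bar>\<Sum>n=1..M. (log_sine (real n * \<alpha>) - log_sine_abel r (real n * \<alpha>))\<bar> \<le>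
        (\<Sum>n=1..M. \<bar>log_sine (real n * \<alpha>) - log_sine_abel r (real n * \<alpha>)\<bar>)" by (rule sum_abs)
    \<comment> \<open>Here 1 - r = 1/M^2 and the sine is at least c/M, so their ratio is at most
      1/(cM); M errors of order 1/M^2 stay bounded in total.\<close>
    also have "\<dots> \<le> (\<Sum>n=1..M. 1 / (real M)\<^sup>2 * (1 + 1 / c\<^sup>2))"
    proof (rule sum_mono)
      fix n assume n: "n \<in> {1..M}"
      have "c / real M \<le> c / real n" using n c by (intro divide_left_mono) auto
      also have "\<dots> \<le> \<bar>sin (pi * (real n * \<alpha>))\<bar>" using n by (intro abs_sin_ge) auto
      finally have s: "c / real M \<le> \<bar>sin (pi * (real n * \<alpha>))\<bar>" .
      have "\<bar>log_sine (real n * \<alpha>) - log_sine_abel r (real n * \<alpha>)\<bar> \<le>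
          (1 - r) + ((1 - r) / \<bar>sin (pi * (real n * \<alpha>))\<bar>)\<^sup>2"
        using n by (intro abs_log_sine_minus_abel_le r sin_nonzero) auto
      also have "\<dots> \<le> (1 - r) + ((1 - r) / (c / real M))\<^sup>2"
        using s r divide_pos_pos[of c "real M"] c M by (intro add_left_mono power_mono frac_le) auto
      also have "\<dots> = 1 / (real M)\<^sup>2 * (1 + 1 / c\<^sup>2)"
        using M c by (simp add: r power2_eq_square field_simps)
      finally show "\<bar>log_sine (real n * \<alpha>) - log_sine_abel r (real n * \<alpha>)\<bar> \<le> 1 / (real M)\<^sup>2 * (1 + 1 / c\<^sup>2)" .
    qed
    also have "\<dots> = (1 / real M) * (1 + 1 / c\<^sup>2)" using M by (simp add: power2_eq_square)
    also have "\<dots> \<le> 1 * (1 + 1 / c\<^sup>2)" using M by (intro mult_right_mono) auto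
    finally show ?thesis by simp
  qed
  ultimately show ?thesis unfolding sum_subtractf by linarith
qed

lemma sum_log_sine_over_sqrt: "(\<lambda>M. (\<Sum>n=1..M. log_sine (real n * \<alpha>)) / sqrt (real M)) \<longlonglongrightarrow> 0"
proof (rule Lim_null_comparison)
  define A where "A = 2 + 1 / c\<^sup>2"
  define D where "D = 4 * (1 + ln (1 / c)) / c"
  have D: "D \<ge> 0"
    unfolding D_def using c by (intro divide_nonneg_pos mult_nonneg_nonneg add_nonneg_nonneg) auto
  show "\<forall>\<^sub>F M in sequentially. norm ((\<Sum>n=1..M. log_sine (real n * \<alpha>)) / sqrt (real M)) \<le>
      (A + D * (3 * log 2 (real M) + 2)\<^sup>2) / sqrt (real M)"
  proof (rule eventually_sequentiallyI[of 2])
    fix M :: nat assume M: "M \<ge> 2"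
    define L where "L = nat \<lceil>3 * log 2 (real M)\<rceil>"
    have l: "log 2 (real M) \<ge> 0" using M by simp
    then have L: "3 * log 2 (real M) \<le> real L" "real L \<le> 3 * log 2 (real M) + 1" unfolding L_def by linarith+
    have "real M ^ 3 = (2 powr log 2 (real M)) powr 3" using M by (simp add: powr_numeral)
    also have "\<dots> = 2 powr (3 * log 2 (real M))" by (simp only: powr_powr mult.commute)
    also have "\<dots> \<le> 2 powr (real L)" using L by simp
    finally have "real M ^ 3 \<le> 2 ^ L" by (simp add: powr_realpow)
    then have "\<bar>\<Sum>n=1..M. log_sine (real n * \<alpha>)\<bar> \<le> A + D * (real L + 1)\<^sup>2"
      unfolding A_def D_def using sum_log_sine_le[OF M] by blast
    also have "\<dots> \<le> A + D * (3 * log 2 (real M) + 2)\<^sup>2"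
      using D L l by (intro add_left_mono mult_left_mono power_mono) auto
    finally show "norm ((\<Sum>n=1..M. log_sine (real n * \<alpha>)) / sqrt (real M)) \<le>
      (A + D * (3 * log 2 (real M) + 2)\<^sup>2) / sqrt (real M)"
      by (simp add: divide_right_mono)
  qed
  show "(\<lambda>M. (A + D * (3 * log 2 (real M) + 2)\<^sup>2) / sqrt (real M)) \<longlonglongrightarrow> 0"
    by real_asymp
qed

end

section \<open>The mean square of \<open>log_sine\<close> along the multiples of \<alpha>\<close>

lemma sum_inverse_sqrt_le: "(\<Sum>j=1..J. 1 / sqrt (real j)) \<le> 2 * sqrt (real J)"
proof (induction J)
  case (Suc J)
  have "1 / sqrt (real (Suc J)) \<le> 2 * (sqrt (real (Suc J)) - sqrt (real J))"
  proof -
    define s t where "s = sqrt (real (Suc J))" and "t = sqrt (real J)"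
    have st: "0 < s" "t \<le> s" by (auto simp: s_def t_def)
    have "(s - t) * (s + t) = 1" by (simp add: s_def t_def algebra_simps)
    moreover have "(s - t) * (s + t) \<le> (s - t) * (2 * s)" using st by (intro mult_left_mono) auto
    ultimately have "1 \<le> 2 * (s - t) * s" by linarith
    then show ?thesis unfolding s_def[symmetric] t_def[symmetric] using st(1) by (simp only: pos_divide_le_eq)
  qed
  then show ?case using Suc.IH by (simp only: sum.cl_ivl_Suc) simp
qed simp

text \<open>Weyl's criterion for one frequency: for nonzero k the cosine sums are bounded in M. The
  frequency is an integer so that differences of frequencies are covered.\<close>

lemma cos_int_mean_tendsto:
  fixes k :: int
  assumes "\<alpha> \<notin> \<rat>"
  shows "(\<lambda>M. (\<Sum>n=1..M. cos (2 * pi * real_of_int k * (real n * \<alpha>))) / real M) \<longlonglongrightarrow> of_bool (k = 0)"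
proof (cases "k = 0")
  case True
  then show ?thesis by (auto intro!: tendsto_eventually eventually_sequentiallyI[of 1])
next
  case False
  have s: "sin (pi * (real_of_int k * \<alpha>)) \<noteq> 0"
  proof
    assume "sin (pi * (real_of_int k * \<alpha>)) = 0"
    then have "real_of_int k * \<alpha> \<in> \<int>" by (metis mult.commute sin_times_pi_eq_0)
    then have "real_of_int k * \<alpha> / real_of_int k \<in> \<rat>"
      using Ints_subset_Rats by (intro Rats_divide) auto
    then show False using False assms by simp
  qed
  have "(\<lambda>M. (\<Sum>n=1..M. cos (2 * pi * real_of_int k * (real n * \<alpha>))) / real M) \<longlonglongrightarrow> 0"
  proof (rule Lim_null_comparison)
    show "\<forall>\<^sub>F M in sequentially. norm ((\<Sum>n=1..M. cos (2 * pi * real_of_int k * (real n * \<alpha>))) / real M) \<le>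
        1 / \<bar>sin (pi * (real_of_int k * \<alpha>))\<bar> / real M"
    proof (rule always_eventually, rule allI)
      fix M
      have "\<bar>\<Sum>n=1..M. cos (2 * pi * real_of_int k * (real n * \<alpha>))\<bar> \<le> 1 / \<bar>sin (pi * (real_of_int k * \<alpha>))\<bar>"
        using sum_cos_le[OF s, of M] by (simp add: mult_ac)
      from divide_right_mono[OF this, of "real M"]
      show "norm ((\<Sum>n=1..M. cos (2 * pi * real_of_int k * (real n * \<alpha>))) / real M) \<le>
        1 / \<bar>sin (pi * (real_of_int k * \<alpha>))\<bar> / real M" by simp
    qed
    show "(\<lambda>M. 1 / \<bar>sin (pi * (real_of_int k * \<alpha>))\<bar> / real M) \<longlonglongrightarrow> 0" by real_asymp
  qed
  then show ?thesis using False by simp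
qed

text \<open>Parseval's identity along the orbit. Products of cosines become cosines of the
  frequencies k - l and k + l; as k and l are positive, only k = l contributes a nonzero mean, with
  weight 1/2.\<close>

lemma trig_poly_square_mean_tendsto:
  fixes b :: "nat \<Rightarrow> real"
  assumes \<alpha>: "\<alpha> \<notin> \<rat>"
  shows "(\<lambda>M. (\<Sum>n=1..M. (\<Sum>k=1..K. b k * cos (2 * pi * real k * (real n * \<alpha>)))\<^sup>2) / real M)
    \<longlonglongrightarrow> (\<Sum>k=1..K. (b k)\<^sup>2 / 2)"
proof -
  let ?c = "\<lambda>k n. cos (2 * pi * real_of_int k * (real n * \<alpha>))"
  define m where "m k M = (\<Sum>n=1..M. ?c k n) / real M" for k :: int and M :: nat
  have m: "m k \<longlonglongrightarrow> of_bool (k = 0)" for k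
    unfolding m_def using cos_int_mean_tendsto[OF \<alpha>] .
  have prod: "cos (2 * pi * real k * x) * cos (2 * pi * real l * x) =
     (cos (2 * pi * real_of_int (int k - int l) * x) + cos (2 * pi * real_of_int (int k + int l) * x)) / 2" for k l x
    by (simp add: cos_times_cos algebra_simps)
  have "(\<lambda>M. \<Sum>k=1..K. \<Sum>l=1..K. b k * b l / 2 * (m (int k - int l) M + m (int k + int l) M)) \<longlonglongrightarrow>
      (\<Sum>k=1..K. \<Sum>l=1..K. b k * b l / 2 * (of_bool (int k - int l = 0) + of_bool (int k + int l = 0)))"
    by (intro tendsto_intros m)
  also have "(\<Sum>k=1..K. \<Sum>l=1..K. b k * b l / 2 * (of_bool (int k - int l = 0) + of_bool (int k + int l = 0)))
      = (\<Sum>k=1..K. \<Sum>l=1..K. if l = k then (b k)\<^sup>2 / 2 else 0)"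
    by (intro sum.cong refl) (auto simp: power2_eq_square)
  also have "\<dots> = (\<Sum>k=1..K. (b k)\<^sup>2 / 2)"
    by (intro sum.cong refl) simp
  also have "(\<lambda>M. \<Sum>k=1..K. \<Sum>l=1..K. b k * b l / 2 * (m (int k - int l) M + m (int k + int l) M)) =
      (\<lambda>M. (\<Sum>n=1..M. (\<Sum>k=1..K. b k * cos (2 * pi * real k * (real n * \<alpha>)))\<^sup>2) / real M)"
  proof
    fix M
    have "(\<Sum>n=1..M. (\<Sum>k=1..K. b k * cos (2 * pi * real k * (real n * \<alpha>)))\<^sup>2) =
        (\<Sum>n=1..M. \<Sum>k=1..K. \<Sum>l=1..K. b k * b l / 2 * (?c (int k - int l) n + ?c (int k + int l) n))"
      unfolding power2_eq_square sum_product
    proof (intro sum.cong refl)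
      fix n k l
      show "b k * cos (2 * pi * real k * (real n * \<alpha>)) * (b l * cos (2 * pi * real l * (real n * \<alpha>))) =
        b k * b l / 2 * (?c (int k - int l) n + ?c (int k + int l) n)"
        using prod[of k "real n * \<alpha>" l] by (simp only: mult_ac) (simp add: algebra_simps)
    qed
    also have "\<dots> = (\<Sum>k=1..K. \<Sum>l=1..K. \<Sum>n=1..M. b k * b l / 2 * (?c (int k - int l) n + ?c (int k + int l) n))"
      by (subst sum.swap) (intro sum.cong refl sum.swap)
    finally have "(\<Sum>n=1..M. (\<Sum>k=1..K. b k * cos (2 * pi * real k * (real n * \<alpha>)))\<^sup>2) / real M =
        (\<Sum>k=1..K. \<Sum>l=1..K. \<Sum>n=1..M. b k * b l / 2 * (?c (int k - int l) n + ?c (int k + int l) n)) / real M"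
      by (rule arg_cong)
    also have "\<dots> = (\<Sum>k=1..K. \<Sum>l=1..K. b k * b l / 2 * (m (int k - int l) M + m (int k + int l) M))"
      unfolding m_def sum_divide_distrib
      by (intro sum.cong refl) (simp only: sum_divide_distrib[symmetric] sum_distrib_left[symmetric] sum.distrib distrib_left add_divide_distrib times_divide_eq_right)
    finally show "(\<Sum>k=1..K. \<Sum>l=1..K. b k * b l / 2 * (m (int k - int l) M + m (int k + int l) M)) =
      (\<Sum>n=1..M. (\<Sum>k=1..K. b k * cos (2 * pi * real k * (real n * \<alpha>)))\<^sup>2) / real M" by (rule sym)
  qed
  finally show ?thesis .
qed

definition log_sine_poly :: "real \<Rightarrow> nat \<Rightarrow> real \<Rightarrow> real" where
  "log_sine_poly r K x = (\<Sum>k=1..K. (- (r ^ k / real k)) * cos (2 * pi * real k * x))"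

lemma log_sine_abel_minus_poly:
  assumes r: "0 \<le> r" "r < 1"
  shows "\<bar>log_sine_abel r x - log_sine_poly r K x\<bar> \<le> r ^ Suc K / (1 - r)"
proof -
  let ?f = "\<lambda>k. r ^ k * cos (2 * pi * real k * x) / real k"
  have "(\<Sum>k<Suc K. ?f k) = (\<Sum>k=1..K. ?f k)"
    by (intro sum.mono_neutral_right) auto
  also have "\<dots> = - log_sine_poly r K x"
    by (simp add: log_sine_poly_def sum_negf)
  finally have s: "(\<lambda>k. ?f (k + Suc K)) sums (- log_sine_abel r x - (- log_sine_poly r K x))"
    using sums_split_initial_segment[OF log_sine_abel_sums[OF r, of x], of "Suc K"] by (simp only:)
  have g: "(\<lambda>k. r ^ Suc K * r ^ k) sums (r ^ Suc K * (1 / (1 - r)))"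
    using r by (intro sums_mult geometric_sums) auto
  have "norm (?f (k + Suc K)) \<le> r ^ Suc K * r ^ k" for k
  proof -
    have "norm (?f (k + Suc K)) = r ^ (k + Suc K) * \<bar>cos (2 * pi * real (k + Suc K) * x)\<bar> / real (k + Suc K)"
      using r by (simp only: real_norm_def abs_mult abs_divide abs_of_nonneg[OF of_nat_0_le_iff] abs_of_nonneg[OF zero_le_power])
    also have "\<dots> \<le> r ^ (k + Suc K) * 1 / 1"
      using r by (intro frac_le mult_left_mono) auto
    finally show ?thesis by (simp add: power_add mult_ac)
  qed
  then have "norm (\<Sum>k. ?f (k + Suc K)) \<le> (\<Sum>k. r ^ Suc K * r ^ k)"
    using g by (intro norm_suminf_le) (auto simp: sums_iff)
  then show ?thesis using s g by (simp add: sums_iff abs_minus_commute)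
qed

text \<open>The sum increases with K and never exceeds \<pi>^2/12, its limit for r = 1, so a lower
  bound at a single index suffices; there it is a finite sum, continuous in r. The threshold for K
  must not depend on r, since K is later chosen after r.\<close>

lemma abel_weights_close_to_zeta2:
  assumes "\<eta> > 0"
  shows "\<exists>(K\<^sub>0::nat) (a::real). a < 1 \<and> (\<forall>r K. a < r \<longrightarrow> 0 < r \<longrightarrow> r < 1 \<longrightarrow> K \<ge> K\<^sub>0 \<longrightarrow>
      \<bar>(\<Sum>k=1..K. (- (r ^ k / real k))\<^sup>2 / 2) - pi\<^sup>2 / 12\<bar> < \<eta>)"
proof -
  have s: "(\<lambda>n. 1 / (real (n + 1))\<^sup>2 / 2) sums (pi\<^sup>2 / 12)"
    using sums_divide[OF inverse_squares_sums, of 2] by (simp add: add.commute)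
  have eq: "(\<Sum>k=1..K. 1 / (real k)\<^sup>2 / 2) = (\<Sum>n<K. 1 / (real (n + 1))\<^sup>2 / 2)" for K
    by (rule sum.reindex_bij_witness[of _ Suc "\<lambda>k. k - 1"]) auto
  have "(\<lambda>K. \<Sum>k=1..K. 1 / (real k)\<^sup>2 / 2) \<longlonglongrightarrow> pi\<^sup>2 / 12"
    unfolding eq using s unfolding sums_def .
  then have "\<forall>\<^sub>F K in sequentially. pi\<^sup>2 / 12 - \<eta> < (\<Sum>k=1..K. 1 / (real k)\<^sup>2 / 2)"
    using assms by (intro order_tendstoD(1)) auto
  then obtain K\<^sub>0 where K0: "pi\<^sup>2 / 12 - \<eta> < (\<Sum>k=1..K\<^sub>0. 1 / (real k)\<^sup>2 / 2)"
    by (auto simp: eventually_sequentially)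
  have "((\<lambda>r::real. (\<Sum>k=1..K\<^sub>0. (- (r ^ k / real k))\<^sup>2 / 2)) \<longlongrightarrow> (\<Sum>k=1..K\<^sub>0. (- (1 ^ k / real k))\<^sup>2 / 2)) (at_left 1)"
    by (intro tendsto_intros) auto
  then have "\<forall>\<^sub>F r in at_left 1. pi\<^sup>2 / 12 - \<eta> < (\<Sum>k=1..K\<^sub>0. (- ((r::real) ^ k / real k))\<^sup>2 / 2)"
    using K0 by (intro order_tendstoD(1)) (auto simp: power_divide)
  then obtain e where e: "e < 1" "\<And>r. e < r \<Longrightarrow> r < 1 \<Longrightarrow> pi\<^sup>2 / 12 - \<eta> < (\<Sum>k=1..K\<^sub>0. (- ((r::real) ^ k / real k))\<^sup>2 / 2)"
    by (auto simp: eventually_at_left[of 0])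
  show ?thesis
  proof (intro exI[of _ K\<^sub>0] exI[of _ e] conjI allI impI)
    fix r :: real and K assume r: "e < r" "0 < r" "r < 1" and K: "K \<ge> K\<^sub>0"
    have "pi\<^sup>2 / 12 - \<eta> < (\<Sum>k=1..K\<^sub>0. (- (r ^ k / real k))\<^sup>2 / 2)" using e r by simp
    also have "\<dots> \<le> (\<Sum>k=1..K. (- (r ^ k / real k))\<^sup>2 / 2)" using K by (intro sum_mono2) auto
    finally have 1: "pi\<^sup>2 / 12 - \<eta> < (\<Sum>k=1..K. (- (r ^ k / real k))\<^sup>2 / 2)" .
    have "(\<Sum>k=1..K. (- (r ^ k / real k))\<^sup>2 / 2) \<le> (\<Sum>k=1..K. 1 / (real k)\<^sup>2 / 2)"
    proof (intro sum_mono divide_right_mono)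
      fix k
      have "(r ^ k)\<^sup>2 \<le> 1" using r by (intro power_le_one) auto
      then show "(- (r ^ k / real k))\<^sup>2 \<le> 1 / (real k)\<^sup>2" by (simp add: power_divide divide_right_mono)
    qed simp
    also have "\<dots> \<le> pi\<^sup>2 / 12"
      unfolding eq using s by (simp only: sums_iff) (metis (no_types, lifting) sum_le_suminf finite_lessThan divide_nonneg_pos zero_le_divide_1_iff zero_le_power2 zero_less_numeral)
    finally show "\<bar>(\<Sum>k=1..K. (- (r ^ k / real k))\<^sup>2 / 2) - pi\<^sup>2 / 12\<bar> < \<eta>" using 1 assms by simp
  qed (use e in simp)
qed

context badly_approximable
begin

lemma irrational: "\<alpha> \<notin> \<rat>"
proof
  assume "\<alpha> \<in> \<rat>"
  then obtain p q :: int where pq: "q > 0" "\<alpha> = p / q" by (metis Rats_cases')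
  then have "real (nat q) * \<alpha> \<in> \<int>" "nat q \<ge> 1" by auto
  then show False using not_Ints by blast
qed

text \<open>Spacing gives what equidistribution cannot for an unbounded function: a bound uniform in
  M that vanishes as r tends to 1. The factor 128 is 32 from the pointwise bound, 2 for the two
  sides of an integer and 2 from the sum of 1/sqrt(j).\<close>

lemma log_sine_minus_abel_mean_square_le:
  assumes r: "1/2 \<le> r" "r < 1" and M: "M \<ge> 1"
  shows "(\<Sum>n=1..M. (log_sine (real n * \<alpha>) - log_sine_abel r (real n * \<alpha>))\<^sup>2) / real M \<le>
    2 * (1 - r) + 128 * sqrt (1 - r) / c"
proof -
  define J where "J = nat \<lfloor>real M / c\<rfloor>"
  have J: "real J \<le> real M / c" using c unfolding J_def by simp
  have "(\<Sum>n=1..M. (log_sine (real n * \<alpha>) - log_sine_abel r (real n * \<alpha>))\<^sup>2) \<le>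
     (\<Sum>n=1..M. 2 * (1 - r) + 32 * sqrt ((1 - r) / \<bar>sin (pi * (real n * \<alpha>))\<bar>))"
    by (intro sum_mono log_sine_minus_abel_squared_le r sin_nonzero) auto
  also have "\<dots> = 2 * (1 - r) * real M + 32 * (\<Sum>n=1..M. sqrt ((1 - r) / \<bar>sin (pi * (real n * \<alpha>))\<bar>))"
    by (simp add: sum.distrib sum_distrib_left)
  also have "(\<Sum>n=1..M. sqrt ((1 - r) / \<bar>sin (pi * (real n * \<alpha>))\<bar>)) \<le> 4 * sqrt (1 - r) * (real M / c)"
  proof -
    have "(\<Sum>n=1..M. sqrt ((1 - r) / \<bar>sin (pi * (real n * \<alpha>))\<bar>)) \<le>
        2 * (\<Sum>j=1..J. sqrt ((1 - r) / (real j * c / real M)))"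
      unfolding J_def using r by (intro sum_abs_sin_le) (auto intro!: divide_left_mono)
    also have "(\<Sum>j=1..J. sqrt ((1 - r) / (real j * c / real M))) =
        sqrt (1 - r) * sqrt (real M / c) * (\<Sum>j=1..J. 1 / sqrt (real j))"
      unfolding sum_distrib_left by (intro sum.cong refl) (simp add: real_sqrt_mult real_sqrt_divide)
    also have "2 * \<dots> \<le> 2 * (sqrt (1 - r) * sqrt (real M / c) * (2 * sqrt (real M / c)))"
    proof (intro mult_left_mono mult_nonneg_nonneg)
      show "(\<Sum>j=1..J. 1 / sqrt (real j)) \<le> 2 * sqrt (real M / c)"
        using sum_inverse_sqrt_le[of J] real_sqrt_le_mono[OF J] by linarith
    qed (use r c in auto)
    also have "\<dots> = 4 * sqrt (1 - r) * (sqrt (real M / c))\<^sup>2" by (simp add: power2_eq_square)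
    also have "(sqrt (real M / c))\<^sup>2 = real M / c" using c by simp
    finally show ?thesis .
  qed
  also have "2 * (1 - r) * real M + 32 * (4 * sqrt (1 - r) * (real M / c)) = (2 * (1 - r) + 128 * sqrt (1 - r) / c) * real M"
    by (simp add: algebra_simps)
  finally have "(\<Sum>n=1..M. (log_sine (real n * \<alpha>) - log_sine_abel r (real n * \<alpha>))\<^sup>2) \<le>
      (2 * (1 - r) + 128 * sqrt (1 - r) / c) * real M" by simp
  then show ?thesis using M by (simp add: pos_divide_le_eq)
qed

text \<open>The polynomial is a truncated Abel mean. First r is chosen to make the mean square error
  small, then K, because the truncation error at fixed K blows up as r tends to 1. Two squared
  errors of \<eta>/4 combine to \<eta> through (x + y)^2 \<le> 2x^2 + 2y^2.\<close>

lemma log_sine_approx_trig_poly: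
  assumes "\<eta> > 0"
  shows "\<exists>(b :: nat \<Rightarrow> real) K.
    (\<forall>M\<ge>1. (\<Sum>n=1..M. (log_sine (real n * \<alpha>) - (\<Sum>k=1..K. b k * cos (2 * pi * real k * (real n * \<alpha>))))\<^sup>2) / real M \<le> \<eta>) \<and>
    \<bar>(\<Sum>k=1..K. (b k)\<^sup>2 / 2) - pi\<^sup>2 / 12\<bar> < \<eta>"
proof -
  obtain K\<^sub>0 d where d: "d < 1" "\<forall>r K. d < r \<longrightarrow> 0 < r \<longrightarrow> r < 1 \<longrightarrow> K \<ge> K\<^sub>0 \<longrightarrow>
      \<bar>(\<Sum>k=1..K. (- (r ^ k / real k))\<^sup>2 / 2) - pi\<^sup>2 / 12\<bar> < \<eta>"
    using abel_weights_close_to_zeta2[OF assms] by (elim exE conjE) (rule that)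
  have "((\<lambda>r. 2 * (1 - r) + 128 * sqrt (1 - r) / c) \<longlongrightarrow> 2 * (1 - 1) + 128 * sqrt (1 - 1) / c) (at_left 1)"
    using c by (intro tendsto_intros) auto
  then have "\<forall>\<^sub>F r in at_left 1. 2 * (1 - r) + 128 * sqrt (1 - r) / c < \<eta> / 4"
    using assms by (intro order_tendstoD(2)) auto
  moreover have "\<forall>\<^sub>F r in at_left 1. max (1/2) d < r \<and> r < (1::real)"
    using d(1) by (intro eventually_at_leftI[of "max (1/2) d"]) auto
  ultimately have "\<forall>\<^sub>F r in at_left 1. (2 * (1 - r) + 128 * sqrt (1 - r) / c < \<eta> / 4) \<and> (max (1/2) d < r \<and> r < (1::real))"
    by (rule eventually_conj)
  then obtain r where r: "2 * (1 - r) + 128 * sqrt (1 - r) / c < \<eta> / 4" "max (1/2) d < r" "r < 1"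
    using eventually_happens[of _ "at_left (1::real)"] by (auto simp: trivial_limit_at_left_real)
  have "(\<lambda>K. r ^ Suc K / (1 - r)) \<longlonglongrightarrow> 0 / (1 - r)"
    using r by (intro tendsto_intros LIMSEQ_Suc LIMSEQ_realpow_zero) auto
  then have "\<forall>\<^sub>F K in sequentially. r ^ Suc K / (1 - r) < sqrt (\<eta> / 4)"
    using assms by (intro order_tendstoD(2)) auto
  then obtain K where K: "K \<ge> K\<^sub>0" "r ^ Suc K / (1 - r) < sqrt (\<eta> / 4)"
    using eventually_happens[OF eventually_conj[OF _ eventually_ge_at_top[of K\<^sub>0]]] by fastforce
  show ?thesis
  proof (intro exI[of _ K] exI[of _ "\<lambda>k. - (r ^ k / real k)"] conjI allI impI)
    fix M :: nat assume M: "M \<ge> 1"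
    define f where "f n = log_sine (real n * \<alpha>)" for n
    define g where "g n = log_sine_abel r (real n * \<alpha>)" for n
    define h where "h n = log_sine_poly r K (real n * \<alpha>)" for n
    have "(\<Sum>n=1..M. (f n - h n)\<^sup>2) \<le> (\<Sum>n=1..M. 2 * (f n - g n)\<^sup>2 + \<eta> / 2)"
    proof (rule sum_mono)
      fix n
      have "\<bar>g n - h n\<bar> \<le> sqrt (\<eta> / 4)"
        unfolding g_def h_def using log_sine_abel_minus_poly[of r "real n * \<alpha>" K] r K by linarith
      then have "\<bar>g n - h n\<bar>\<^sup>2 \<le> (sqrt (\<eta> / 4))\<^sup>2" by (intro power_mono) auto
      then have "(g n - h n)\<^sup>2 \<le> \<eta> / 4" using assms by simp
      moreover have "(f n - h n)\<^sup>2 \<le> 2 * (f n - g n)\<^sup>2 + 2 * (g n - h n)\<^sup>2"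
        using sum_squares_bound[of "f n - g n" "g n - h n"] by (simp add: power2_eq_square algebra_simps)
      ultimately show "(f n - h n)\<^sup>2 \<le> 2 * (f n - g n)\<^sup>2 + \<eta> / 2" by linarith
    qed
    also have "\<dots> = 2 * (\<Sum>n=1..M. (f n - g n)\<^sup>2) + \<eta> / 2 * real M"
      by (simp add: sum.distrib sum_distrib_left)
    finally have "(\<Sum>n=1..M. (f n - h n)\<^sup>2) / real M \<le> (2 * (\<Sum>n=1..M. (f n - g n)\<^sup>2) + \<eta> / 2 * real M) / real M"
      by (rule divide_right_mono) simp
    also have "\<dots> = 2 * ((\<Sum>n=1..M. (f n - g n)\<^sup>2) / real M) + \<eta> / 2" using M by (simp add: field_simps)
    also have "(\<Sum>n=1..M. (f n - g n)\<^sup>2) / real M \<le> \<eta> / 4"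
      unfolding f_def g_def using log_sine_minus_abel_mean_square_le[of r M] r M by linarith
    finally show "(\<Sum>n=1..M. (log_sine (real n * \<alpha>) - (\<Sum>k=1..K. - (r ^ k / real k) * cos (2 * pi * real k * (real n * \<alpha>))))\<^sup>2) / real M \<le> \<eta>"
      by (simp add: f_def h_def log_sine_poly_def)
  next
    show "\<bar>(\<Sum>k=1..K. (- (r ^ k / real k))\<^sup>2 / 2) - pi\<^sup>2 / 12\<bar> < \<eta>"
      using d(2)[THEN spec, of r, THEN spec, of K] r(2,3) K(1) by simp
  qed
qed

text \<open>Comparing \<open>L\<^sup>2\<close> norms with respect to the empirical measure of the first \<open>M\<close> points avoids
  cross terms.\<close>
lemma log_sine_square_mean_tendsto:
  "(\<lambda>M. (\<Sum>n=1..M. (log_sine (real n * \<alpha>))\<^sup>2) / real M) \<longlonglongrightarrow> pi\<^sup>2 / 12"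
proof -
  define f where "f n = log_sine (real n * \<alpha>)" for n :: nat
  define N where "N h M = sqrt ((\<Sum>n=1..M. (h n)\<^sup>2) / real M)" for h :: "nat \<Rightarrow> real" and M
  have N_L2: "N h M = L2_set h {1..M} / sqrt (real M)" for h M
    by (simp add: N_def L2_set_def real_sqrt_divide)
  have N_triangle: "N (\<lambda>n. g n + h n) M \<le> N g M + N h M" for g h M
    unfolding N_L2 add_divide_distrib[symmetric] by (intro divide_right_mono L2_set_triangle_ineq) simp
  have N_diff: "\<bar>N g M - N h M\<bar> \<le> N (\<lambda>n. g n - h n) M" for g h M
    using N_triangle[of "\<lambda>n. g n - h n" h M] N_triangle[of "\<lambda>n. h n - g n" g M]
    by (simp add: N_def power2_commute)
  have "N f \<longlonglongrightarrow> sqrt (pi\<^sup>2 / 12)"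
  proof (rule tendstoI)
    fix e :: real assume e: "e > 0"
    have "\<forall>\<^sub>F x in at (pi\<^sup>2 / 12). dist (sqrt x) (sqrt (pi\<^sup>2 / 12)) < e / 4"
      using e by (intro tendstoD tendsto_intros) auto
    then obtain d where d: "d > 0"
      and d': "\<And>x. x \<noteq> pi\<^sup>2 / 12 \<Longrightarrow> \<bar>x - pi\<^sup>2 / 12\<bar> < d \<Longrightarrow> \<bar>sqrt x - sqrt (pi\<^sup>2 / 12)\<bar> < e / 4"
      unfolding eventually_at dist_real_def by blast
    have d'': "\<bar>sqrt x - sqrt (pi\<^sup>2 / 12)\<bar> < e / 4" if "\<bar>x - pi\<^sup>2 / 12\<bar> < d" for x
      by (metis abs_zero cancel_comm_monoid_add_class.diff_cancel d' e that zero_less_divide_iff zero_less_numeral)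
    \<comment> \<open>The cap d keeps the limiting norm of the polynomial near the target, by
      continuity of the square root; the cap (e/4)^2 keeps the polynomial within e/4 of f in
      norm.\<close>
    define \<eta> where "\<eta> = min d ((e / 4)\<^sup>2)"
    have \<eta>: "\<eta> > 0" "\<eta> \<le> d" "sqrt \<eta> \<le> e / 4" using d e real_sqrt_le_mono[of \<eta> "(e/4)\<^sup>2"] by (auto simp: \<eta>_def)
    obtain b K where bK:
      "\<And>M. M \<ge> 1 \<Longrightarrow> (\<Sum>n=1..M. (log_sine (real n * \<alpha>) - (\<Sum>k=1..K. b k * cos (2 * pi * real k * (real n * \<alpha>))))\<^sup>2) / real M \<le> \<eta>"
      "\<bar>(\<Sum>k=1..K. (b k)\<^sup>2 / 2) - pi\<^sup>2 / 12\<bar> < \<eta>"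
      using log_sine_approx_trig_poly[OF \<eta>(1)] by blast
    define p where "p n = (\<Sum>k=1..K. b k * cos (2 * pi * real k * (real n * \<alpha>)))" for n :: nat
    have "N p \<longlonglongrightarrow> sqrt (\<Sum>k=1..K. (b k)\<^sup>2 / 2)"
      unfolding N_def p_def by (intro tendsto_real_sqrt trig_poly_square_mean_tendsto irrational)
    then have "\<forall>\<^sub>F M in sequentially. dist (N p M) (sqrt (\<Sum>k=1..K. (b k)\<^sup>2 / 2)) < e / 4"
      using e by (intro tendstoD) auto
    then show "\<forall>\<^sub>F M in sequentially. dist (N f M) (sqrt (pi\<^sup>2 / 12)) < e"
      using eventually_ge_at_top[of 1]
    proof eventually_elim
      case (elim M)
      have "N (\<lambda>n. f n - p n) M \<le> sqrt \<eta>"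
        unfolding N_def p_def f_def using bK(1)[of M] elim by simp
      then have "\<bar>N f M - N p M\<bar> \<le> e / 4" using N_diff[of f M p] \<eta> by linarith
      moreover have "\<bar>sqrt (\<Sum>k=1..K. (b k)\<^sup>2 / 2) - sqrt (pi\<^sup>2 / 12)\<bar> < e / 4"
        using bK(2) \<eta> by (intro d'') auto
      ultimately show ?case using elim e unfolding dist_real_def by linarith
    qed
  qed
  then have "(\<lambda>M. (N f M)\<^sup>2) \<longlonglongrightarrow> (sqrt (pi\<^sup>2 / 12))\<^sup>2" by (intro tendsto_intros)
  moreover have "(N f M)\<^sup>2 = (\<Sum>n=1..M. (f n)\<^sup>2) / real M" for M
    by (simp add: N_def sum_nonneg)
  ultimately show ?thesis by (simp add: f_def)
qed

text \<open>Kolmogorov's condition: logarithmic growth makes every single weight negligible against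
  the standard deviation of its block, up to iterated logarithms.\<close>

lemma abs_log_sine_le:
  assumes "n \<ge> 1"
  shows "\<bar>log_sine (real n * \<alpha>)\<bar> \<le> ln (real n) + ln (2 / c)"
proof -
  define s where "s = \<bar>sin (pi * (real n * \<alpha>))\<bar>"
  have s: "0 < s" "c / real n \<le> s" "s \<le> 1"
    using sin_nonzero[OF assms] abs_sin_ge[OF assms] by (auto simp: s_def)
  have f: "log_sine (real n * \<alpha>) = ln 2 + ln s"
    using s(1) by (simp add: log_sine_def s_def abs_mult ln_mult)
  have "ln s \<le> 0" using s by simp
  moreover have "ln (c / real n) \<le> ln s" using s c assms by (intro ln_mono) auto
  then have "ln c - ln (real n) \<le> ln s" using c assms by (simp add: ln_div)
  moreover have "ln (real n) \<ge> 0" "ln c \<le> 0" "ln 2 \<ge> (0::real)" using assms c by auto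
  moreover have "ln (2 / c) = ln 2 - ln c" using c by (simp add: ln_div)
  ultimately show ?thesis unfolding f abs_le_iff by linarith
qed

end

section \<open>The law of the iterated logarithm for weighted Rademacher sums\<close>

lemma cosh_ge_quadratic: "1 + t\<^sup>2 / 2 \<le> cosh (t::real)"
proof -
  let ?f = "\<lambda>n. if even n then t ^ n /\<^sub>R fact n else 0"
  have "(\<Sum>n<3. ?f n) \<le> (\<Sum>n. ?f n)"
  proof (rule sum_le_suminf)
    show "summable ?f" using cosh_converges[of t] by (rule sums_summable)
    show "0 \<le> ?f n" for n using zero_le_even_power[of n t] by simp
  qed simp
  also have "(\<Sum>n. ?f n) = cosh t" using cosh_converges[of t] by (rule sums_unique[symmetric])
  finally show ?thesis by (simp add: numeral_3_eq_3 power2_eq_square)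
qed

text \<open>For small arguments the Gaussian bound is nearly attained; the loss comes from ln(1 + y)
  \<ge> y - y^2 at y = t^2/2, which is at most \<theta>^2/2.\<close>

lemma cosh_ge_exp:
  fixes t \<theta> :: real
  assumes "\<bar>t\<bar> \<le> \<theta>" "\<theta> \<le> 1"
  shows "exp ((1 - \<theta>\<^sup>2 / 2) * (t\<^sup>2 / 2)) \<le> cosh t"
proof -
  define y where "y = t\<^sup>2 / 2"
  have "t\<^sup>2 \<le> \<theta>\<^sup>2" using assms power_mono[of "\<bar>t\<bar>" \<theta> 2] by simp
  moreover have "\<theta>\<^sup>2 \<le> 1" using assms by (intro power_le_one) auto
  ultimately have y: "0 \<le> y" "y \<le> \<theta>\<^sup>2 / 2" "y \<le> 1" by (auto simp: y_def)
  have "(1 - \<theta>\<^sup>2 / 2) * y \<le> y - y\<^sup>2"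
    using y mult_right_mono[OF y(2,1)] by (simp add: algebra_simps power2_eq_square)
  also have "\<dots> \<le> ln (1 + y)" using y by (intro ln_one_plus_pos_lower_bound)
  finally have "exp ((1 - \<theta>\<^sup>2 / 2) * y) \<le> 1 + y" using y by (simp add: ln_ge_iff)
  also have "\<dots> \<le> cosh t" unfolding y_def by (rule cosh_ge_quadratic)
  finally show ?thesis by (simp add: y_def)
qed

text \<open>Termwise comparison of the even power series, by 2^n n! \<le> (2n)!. It makes weighted
  sums of signs sub-Gaussian.\<close>

lemma cosh_le_exp: "cosh (t::real) \<le> exp (t\<^sup>2 / 2)"
proof -
  let ?f = "\<lambda>n. if even n then t ^ n /\<^sub>R fact n else 0"
  have f: "?f sums cosh t" by (rule cosh_converges)
  have s1: "(\<lambda>n. ?f (2 * n)) sums cosh t"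
    by (rule sums_mono_reindex[THEN iffD2, OF _ _ f]) (auto simp: strict_mono_def elim!: evenE)
  have s2: "(\<lambda>n. (t\<^sup>2 / 2) ^ n /\<^sub>R fact n) sums exp (t\<^sup>2 / 2)" by (rule exp_converges)
  have le: "?f (2 * n) \<le> (t\<^sup>2 / 2) ^ n /\<^sub>R fact n" for n
  proof -
    have "2 ^ n * fact n \<le> (fact (2 * n) :: real)"
    proof (induction n)
      case (Suc n)
      have "(2::real) ^ Suc n * fact (Suc n) = (2 * (real n + 1)) * (2 ^ n * fact n)" by simp
      also have "\<dots> \<le> (2 * (real n + 1)) * fact (2 * n)" using Suc.IH by (intro mult_left_mono) auto
      also have "\<dots> \<le> ((2 * real n + 2) * (2 * real n + 1)) * fact (2 * n)"
        by (intro mult_right_mono) (auto simp: algebra_simps)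
      also have "\<dots> = fact (2 * Suc n)" by (simp add: algebra_simps)
      finally show ?case .
    qed simp
    then have "t\<^sup>2 ^ n / fact (2 * n) \<le> t\<^sup>2 ^ n / (2 ^ n * fact n)" by (intro divide_left_mono) auto
    moreover have "?f (2 * n) = t\<^sup>2 ^ n / fact (2 * n)" by (simp add: power_mult divide_inverse_commute)
    ultimately show ?thesis by (simp add: power_divide field_simps)
  qed
  show ?thesis by (rule sums_le[OF le s1 s2])
qed

locale rademacher = prob_space M for M :: "'a measure" +
  fixes r :: "nat \<Rightarrow> 'a \<Rightarrow> real"
  assumes indep: "indep_vars (\<lambda>_. borel) r UNIV"
    and r_values: "\<And>n \<omega>. \<omega> \<in> space M \<Longrightarrow> r n \<omega> \<in> {-1, 1}"
    and mean: "\<And>n. expectation (r n) = 0"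
begin

lemma rv [measurable]: "r n \<in> borel_measurable M"
  using indep unfolding indep_vars_def by auto

lemma abs_r: "\<omega> \<in> space M \<Longrightarrow> \<bar>r n \<omega>\<bar> = 1"
  using r_values[of \<omega> n] by auto

lemma integrable_bounded:
  fixes f :: "'a \<Rightarrow> real"
  assumes "f \<in> borel_measurable M" "\<And>\<omega>. \<omega> \<in> space M \<Longrightarrow> \<bar>f \<omega>\<bar> \<le> B"
  shows "integrable M f"
  by (rule integrable_const_bound[where B = B]) (use assms in auto)

lemma integrable_exp_r: "integrable M (\<lambda>\<omega>. exp (t * r n \<omega>))"
proof (rule integrable_bounded)
  show "\<bar>exp (t * r n \<omega>)\<bar> \<le> exp \<bar>t\<bar>" if "\<omega> \<in> space M" for \<omega>
    using r_values[OF that, of n] by auto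
qed simp

text \<open>On the values -1 and 1 the exponential agrees with the affine function
  \<open>cosh t + sinh t * x\<close>, so its expectation is determined by the mean.\<close>

lemma expectation_exp_r: "expectation (\<lambda>\<omega>. exp (t * r n \<omega>)) = cosh t"
proof -
  have i: "integrable M (r n)" by (rule integrable_bounded[of _ 1]) (auto simp: abs_r)
  have "expectation (\<lambda>\<omega>. exp (t * r n \<omega>)) = expectation (\<lambda>\<omega>. cosh t + sinh t * r n \<omega>)"
  proof (rule Bochner_Integration.integral_cong[OF refl])
    fix \<omega> assume "\<omega> \<in> space M"
    then have "r n \<omega> = 1 \<or> r n \<omega> = -1" using r_values[of \<omega> n] by auto
    then show "exp (t * r n \<omega>) = cosh t + sinh t * r n \<omega>"
      by (auto simp: cosh_plus_sinh cosh_minus_sinh)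
  qed
  also have "\<dots> = cosh t" using i by (simp add: mean prob_space)
  finally show ?thesis .
qed

lemma
  assumes I: "finite I"
  shows integrable_exp_sum: "integrable M (\<lambda>\<omega>. exp (t * (\<Sum>i\<in>I. b i * r i \<omega>)))"
    and expectation_exp_sum: "expectation (\<lambda>\<omega>. exp (t * (\<Sum>i\<in>I. b i * r i \<omega>))) = (\<Prod>i\<in>I. cosh (t * b i))"
proof -
  have eq: "exp (t * (\<Sum>i\<in>I. b i * r i \<omega>)) = (\<Prod>i\<in>I. exp ((t * b i) * r i \<omega>))" for \<omega>
    using I by (simp add: exp_sum sum_distrib_left mult_ac)
  have ind: "indep_vars (\<lambda>_. borel) (\<lambda>i \<omega>. exp ((t * b i) * r i \<omega>)) I"
    by (rule indep_vars_compose2[OF indep_vars_subset[OF indep]]) auto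
  show "integrable M (\<lambda>\<omega>. exp (t * (\<Sum>i\<in>I. b i * r i \<omega>)))"
    unfolding eq by (rule indep_vars_integrable[OF I ind integrable_exp_r])
  show "expectation (\<lambda>\<omega>. exp (t * (\<Sum>i\<in>I. b i * r i \<omega>))) = (\<Prod>i\<in>I. cosh (t * b i))"
    unfolding eq by (subst indep_vars_lebesgue_integral[OF I ind integrable_exp_r]) (simp add: expectation_exp_r)
qed

subsection \<open>Maximal inequality\<close>

text \<open>\<open>W\<^sub>n = C 1\<^bsub>hit\<^esub> + Z\<^sub>n 1\<^bsub>not hit\<^esub>\<close> is a supermartingale starting below \<open>1\<close>, where \<open>Z\<^sub>n\<close> is the
  exponential supermartingale and \<open>hit\<close> the event that it has reached \<open>C\<close> by time \<open>n\<close>.\<close>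
lemma exponential_supermartingale_maximal:
  fixes a :: "nat \<Rightarrow> real" and l C :: real and m :: nat
  defines "Z \<equiv> \<lambda>n \<omega>. exp (l * (\<Sum>i<n. a i * r i \<omega>) - l\<^sup>2 / 2 * (\<Sum>i<n. (a i)\<^sup>2))"
  assumes C: "C > 0"
  shows "prob {\<omega>\<in>space M. \<exists>n\<le>m. C \<le> Z n \<omega>} \<le> 1 / C"
proof -
  \<comment> \<open>\<open>g n\<close> writes \<open>Z n\<close> off the hitting event as a
    measurable function of the first n signs only, which makes it independent of the next factor
    \<open>X n\<close>.\<close>
  define z where "z n f = exp (l * (\<Sum>i<n. a i * f i) - l\<^sup>2 / 2 * (\<Sum>i<n. (a i)\<^sup>2))" for n and f :: "nat \<Rightarrow> real"
  define g where "g n f = (if \<forall>j\<in>{..n}. z j f < C then z n f else 0)" for n and f :: "nat \<Rightarrow> real"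
  define X where "X n \<omega> = exp (l * a n * r n \<omega> - l\<^sup>2 / 2 * (a n)\<^sup>2)" for n \<omega>
  define H where "H n = {\<omega>\<in>space M. \<exists>j\<le>n. C \<le> Z j \<omega>}" for n
  have [measurable]: "Z n \<in> borel_measurable M" for n unfolding Z_def by measurable
  have [measurable]: "H n \<in> sets M" for n unfolding H_def by measurable
  have Z_pos: "Z n \<omega> > 0" for n \<omega> by (simp add: Z_def)
  have Z_Suc: "Z (Suc n) \<omega> = Z n \<omega> * X n \<omega>" for n \<omega>
    by (simp add: Z_def X_def exp_add[symmetric] algebra_simps)
  have g: "Z n \<omega> * indicator (space M - H n) \<omega> = g n (\<lambda>i\<in>{..<n}. r i \<omega>)" if "\<omega> \<in> space M" for n \<omega>
  proof -
    have "z j (\<lambda>i\<in>{..<n}. r i \<omega>) = Z j \<omega>" if "j \<le> n" for j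
      using that by (auto simp: z_def Z_def intro!: sum.cong)
    then have "g n (\<lambda>i\<in>{..<n}. r i \<omega>) = (if \<forall>j\<in>{..n}. Z j \<omega> < C then Z n \<omega> else 0)"
      by (simp add: g_def)
    moreover have "(\<forall>j\<in>{..n}. Z j \<omega> < C) \<longleftrightarrow> \<omega> \<notin> H n" using that by (auto simp: H_def not_le) (metis not_le)
    ultimately show ?thesis using that by (simp add: indicator_def)
  qed
  have g_meas: "g n \<in> borel_measurable (Pi\<^sub>M {..<n} (\<lambda>_. borel))" for n
  proof -
    have z: "z j \<in> borel_measurable (Pi\<^sub>M {..<n} (\<lambda>_. borel))" if "j \<le> n" for j
      unfolding z_def
      by (intro measurable_compose[OF _ borel_measurable_exp] borel_measurable_diff borel_measurable_times borel_measurable_const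
          borel_measurable_sum measurable_component_singleton) (use that in auto)
    have "{f \<in> space (Pi\<^sub>M {..<n} (\<lambda>_. borel)). \<forall>j\<in>{..n}. z j f < C} \<in> sets (Pi\<^sub>M {..<n} (\<lambda>_. borel))"
      by (rule sets.sets_Collect_finite_All') (auto intro!: borel_measurable_less z)
    then show ?thesis unfolding g_def by (intro measurable_If z) auto
  qed
  have step: "expectation (\<lambda>\<omega>. Z (Suc n) \<omega> * indicator (space M - H n) \<omega>) \<le>
       expectation (\<lambda>\<omega>. Z n \<omega> * indicator (space M - H n) \<omega>)"
    and int1: "integrable M (\<lambda>\<omega>. Z (Suc n) \<omega> * indicator (space M - H n) \<omega>)"
    and int2: "integrable M (\<lambda>\<omega>. Z n \<omega> * indicator (space M - H n) \<omega>)" for n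
  proof -
    have int_Z: "integrable M (Z n)" for n
      unfolding Z_def exp_diff by (intro integrable_divide integrable_exp_sum) auto
    show int: "integrable M (\<lambda>\<omega>. Z n \<omega> * indicator (space M - H n) \<omega>)"
      by (intro integrable_real_mult_indicator int_Z) auto
    show "integrable M (\<lambda>\<omega>. Z (Suc n) \<omega> * indicator (space M - H n) \<omega>)"
      by (intro integrable_real_mult_indicator int_Z) auto
    have int_X: "integrable M (X n)"
      unfolding X_def exp_diff by (intro integrable_divide integrable_exp_r)
    have "indep_var borel (g n \<circ> (\<lambda>\<omega>. \<lambda>i\<in>{..<n}. r i \<omega>))
        borel ((\<lambda>f. exp (l * a n * f n - l\<^sup>2 / 2 * (a n)\<^sup>2)) \<circ> (\<lambda>\<omega>. \<lambda>i\<in>{n}. r i \<omega>))"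
      by (intro indep_var_compose[OF indep_var_restrict[OF indep]] g_meas) auto
    then have ind: "indep_var borel (\<lambda>\<omega>. g n (\<lambda>i\<in>{..<n}. r i \<omega>)) borel (X n)"
      by (simp add: comp_def X_def[abs_def])
    have int': "integrable M (\<lambda>\<omega>. g n (\<lambda>i\<in>{..<n}. r i \<omega>))"
    proof -
      have "integrable M (\<lambda>\<omega>. g n (\<lambda>i\<in>{..<n}. r i \<omega>)) \<longleftrightarrow>
          integrable M (\<lambda>\<omega>. Z n \<omega> * indicator (space M - H n) \<omega>)"
        by (intro Bochner_Integration.integrable_cong refl) (simp add: g)
      then show ?thesis using int by simp
    qed
    have "expectation (\<lambda>\<omega>. Z (Suc n) \<omega> * indicator (space M - H n) \<omega>) =
        expectation (\<lambda>\<omega>. g n (\<lambda>i\<in>{..<n}. r i \<omega>) * X n \<omega>)"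
      by (intro Bochner_Integration.integral_cong refl) (simp add: g[symmetric] Z_Suc)
    also have "\<dots> = expectation (\<lambda>\<omega>. g n (\<lambda>i\<in>{..<n}. r i \<omega>)) * expectation (X n)"
      by (rule indep_var_lebesgue_integral[OF ind int' int_X])
    also have "expectation (\<lambda>\<omega>. g n (\<lambda>i\<in>{..<n}. r i \<omega>)) = expectation (\<lambda>\<omega>. Z n \<omega> * indicator (space M - H n) \<omega>)"
      by (intro Bochner_Integration.integral_cong refl) (simp add: g)
    also have "expectation (X n) = cosh (l * a n) / exp ((l * a n)\<^sup>2 / 2)"
      unfolding X_def exp_diff by (simp add: expectation_exp_r power_mult_distrib)
    also have "expectation (\<lambda>\<omega>. Z n \<omega> * indicator (space M - H n) \<omega>) * (cosh (l * a n) / exp ((l * a n)\<^sup>2 / 2)) \<le>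
        expectation (\<lambda>\<omega>. Z n \<omega> * indicator (space M - H n) \<omega>) * 1"
      using cosh_le_exp[of "l * a n"] less_imp_le[OF Z_pos]
      by (intro mult_left_mono Bochner_Integration.integral_nonneg) auto
    finally show "expectation (\<lambda>\<omega>. Z (Suc n) \<omega> * indicator (space M - H n) \<omega>) \<le>
       expectation (\<lambda>\<omega>. Z n \<omega> * indicator (space M - H n) \<omega>)" by simp
  qed
  define W where "W n \<omega> = C * indicator (H n) \<omega> + Z n \<omega> * indicator (space M - H n) \<omega>" for n \<omega>
  have int_H: "integrable M (\<lambda>\<omega>. C * indicator (H n) \<omega>)" for n
    by (intro integrable_mult_right) (auto simp: emeasure_eq_measure)
  have int_W: "integrable M (W n)" for n
    unfolding W_def by (intro Bochner_Integration.integrable_add int_H int2)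
  have "expectation (W n) \<le> 1" for n
  proof (induction n)
    case 0
    \<comment> \<open>As \<open>Z 0\<close> is 1, a hit at time 0 means that C is at most 1.\<close>
    have "expectation (W 0) \<le> expectation (\<lambda>_. 1)"
    proof (rule integral_mono[OF int_W])
      fix \<omega> assume "\<omega> \<in> space M"
      then show "W 0 \<omega> \<le> 1" by (auto simp: W_def H_def Z_def indicator_def)
    qed simp
    then show ?case by (simp add: prob_space)
  next
    case (Suc n)
    \<comment> \<open>At a first hit at time \<open>Suc n\<close> the value C replaces the larger
      \<open>Z (Suc n)\<close>; everywhere else both sides agree.\<close>
    have "expectation (W (Suc n)) \<le>
        expectation (\<lambda>\<omega>. C * indicator (H n) \<omega> + Z (Suc n) \<omega> * indicator (space M - H n) \<omega>)"
    proof (rule integral_mono[OF int_W Bochner_Integration.integrable_add[OF int_H int1]])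
      fix \<omega> assume "\<omega> \<in> space M"
      then show "W (Suc n) \<omega> \<le> C * indicator (H n) \<omega> + Z (Suc n) \<omega> * indicator (space M - H n) \<omega>"
        by (auto simp: W_def H_def indicator_def le_Suc_eq)
    qed
    also have "\<dots> = expectation (\<lambda>\<omega>. C * indicator (H n) \<omega>) +
        expectation (\<lambda>\<omega>. Z (Suc n) \<omega> * indicator (space M - H n) \<omega>)"
      by (rule Bochner_Integration.integral_add[OF int_H int1])
    also have "\<dots> \<le> expectation (\<lambda>\<omega>. C * indicator (H n) \<omega>) +
        expectation (\<lambda>\<omega>. Z n \<omega> * indicator (space M - H n) \<omega>)"
      using step by simp
    also have "\<dots> = expectation (W n)"
      unfolding W_def by (rule Bochner_Integration.integral_add[OF int_H int2, symmetric])
    finally show ?case using Suc.IH by linarith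
  qed
  moreover have "expectation (\<lambda>\<omega>. C * indicator (H m) \<omega>) \<le> expectation (W m)"
    using less_imp_le[OF Z_pos] by (intro integral_mono int_H int_W) (auto simp: W_def)
  ultimately have "C * prob (H m) \<le> 1" using order_trans[of _ "expectation (W m)" 1] by simp
  then show ?thesis using C by (simp add: H_def field_simps)
qed

lemma maximal_inequality:
  assumes x: "x > 0" and v: "v > 0" "(\<Sum>i<m. (a i)\<^sup>2) \<le> v"
  shows "prob {\<omega>\<in>space M. \<exists>n\<le>m. x \<le> (\<Sum>i<n. a i * r i \<omega>)} \<le> exp (- (x\<^sup>2 / (2 * v)))"
proof -
  \<comment> \<open>The maximiser of \<open>l * x - l\<^sup>2 / 2 * v\<close>, with maximum
    x^2/(2v).\<close>
  define l where "l = x / v"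
  define Z where "Z n \<omega> = exp (l * (\<Sum>i<n. a i * r i \<omega>) - l\<^sup>2 / 2 * (\<Sum>i<n. (a i)\<^sup>2))" for n \<omega>
  have l: "l > 0" using x v by (simp add: l_def)
  have [measurable]: "Z n \<in> borel_measurable M" for n unfolding Z_def by measurable
  have "prob {\<omega>\<in>space M. \<exists>n\<le>m. x \<le> (\<Sum>i<n. a i * r i \<omega>)} \<le>
      prob {\<omega>\<in>space M. \<exists>n\<le>m. exp (x\<^sup>2 / (2 * v)) \<le> Z n \<omega>}"
  proof (rule finite_measure_mono)
    show "{\<omega>\<in>space M. \<exists>n\<le>m. x \<le> (\<Sum>i<n. a i * r i \<omega>)} \<subseteq>
      {\<omega>\<in>space M. \<exists>n\<le>m. exp (x\<^sup>2 / (2 * v)) \<le> Z n \<omega>}"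
    proof safe
      fix \<omega> n assume n: "n \<le> m" and "x \<le> (\<Sum>i<n. a i * r i \<omega>)"
      then have "l * x \<le> l * (\<Sum>i<n. a i * r i \<omega>)" using l by (intro mult_left_mono) auto
      moreover have "(\<Sum>i<n. (a i)\<^sup>2) \<le> (\<Sum>i<m. (a i)\<^sup>2)" using n by (intro sum_mono2) auto
      then have "l\<^sup>2 / 2 * (\<Sum>i<n. (a i)\<^sup>2) \<le> l\<^sup>2 / 2 * v" using v by (intro mult_left_mono) auto
      moreover have "l * x - l\<^sup>2 / 2 * v = x\<^sup>2 / (2 * v)"
        using v by (simp add: l_def power2_eq_square field_simps)
      ultimately have "x\<^sup>2 / (2 * v) \<le> l * (\<Sum>i<n. a i * r i \<omega>) - l\<^sup>2 / 2 * (\<Sum>i<n. (a i)\<^sup>2)" by linarith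
      then show "\<exists>n\<le>m. exp (x\<^sup>2 / (2 * v)) \<le> Z n \<omega>" using n unfolding Z_def by auto
    qed
  qed measurable
  also have "\<dots> \<le> 1 / exp (x\<^sup>2 / (2 * v))"
    unfolding Z_def by (rule exponential_supermartingale_maximal) simp
  finally show ?thesis by (simp add: exp_minus inverse_eq_divide)
qed

subsection \<open>Lower bound for the upper tail\<close>

text \<open>Under the measure tilted by \<open>exp (\<lambda>U)\<close> the sum \<open>U\<close> concentrates around \<open>\<mu> = \<lambda>s\<^sup>2\<close>. The two
  subtracted exponentials are Chernoff bounds for the two tails of the tilted measure, so that only
  moment generating functions of \<open>U\<close> are needed.\<close>
lemma tail_lower_bound:
  fixes b :: "nat \<Rightarrow> real" and l \<delta> :: real
  assumes I: "finite I" and l: "l > 0" and \<delta>: "0 < \<delta>" "\<delta> < 1"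
    and small: "\<And>i. i \<in> I \<Longrightarrow> \<bar>l * b i\<bar> \<le> \<delta>"
  defines "s2 \<equiv> \<Sum>i\<in>I. (b i)\<^sup>2"
  defines "L \<equiv> l\<^sup>2 * s2 / 2"
  shows "exp (- (2 * (1 + \<delta>) * L)) * (exp ((1 - \<delta>\<^sup>2 / 2) * L) - 2 * exp ((1 - \<delta>\<^sup>2) * L)) \<le>
    prob {\<omega>\<in>space M. (1 - \<delta>) * l * s2 \<le> (\<Sum>i\<in>I. b i * r i \<omega>)}"
proof -
  define U where "U \<omega> = (\<Sum>i\<in>I. b i * r i \<omega>)" for \<omega>
  have [measurable]: "U \<in> borel_measurable M" unfolding U_def by measurable
  define A where "A = {\<omega>\<in>space M. (1 - \<delta>) * l * s2 \<le> U \<omega>}"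
  have [measurable]: "A \<in> sets M" unfolding A_def by measurable
  have int: "integrable M (\<lambda>\<omega>. exp (t * U \<omega>))" for t
    unfolding U_def by (rule integrable_exp_sum[OF I])
  have mgf: "expectation (\<lambda>\<omega>. exp (t * U \<omega>)) = (\<Prod>i\<in>I. cosh (t * b i))" for t
    unfolding U_def by (rule expectation_exp_sum[OF I])
  have upper: "expectation (\<lambda>\<omega>. exp (t * U \<omega>)) \<le> exp (t\<^sup>2 * s2 / 2)" for t
  proof -
    have "(\<Prod>i\<in>I. cosh (t * b i)) \<le> (\<Prod>i\<in>I. exp ((t * b i)\<^sup>2 / 2))"
      by (intro prod_mono) (auto simp: cosh_le_exp)
    also have "\<dots> = exp (t\<^sup>2 * s2 / 2)"
      using I by (simp add: exp_sum[symmetric] s2_def sum_distrib_left sum_divide_distrib power_mult_distrib)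
    finally show ?thesis by (simp add: mgf)
  qed
  have lower: "exp ((1 - \<delta>\<^sup>2 / 2) * L) \<le> expectation (\<lambda>\<omega>. exp (l * U \<omega>))"
  proof -
    have "exp ((1 - \<delta>\<^sup>2 / 2) * L) = (\<Prod>i\<in>I. exp ((1 - \<delta>\<^sup>2 / 2) * ((l * b i)\<^sup>2 / 2)))"
      using I by (simp add: exp_sum[symmetric] L_def s2_def sum_distrib_left sum_divide_distrib power_mult_distrib mult_ac)
    also have "\<dots> \<le> (\<Prod>i\<in>I. cosh (l * b i))"
      using \<delta> by (intro prod_mono conjI cosh_ge_exp small) auto
    finally show ?thesis by (simp add: mgf)
  qed
  define \<mu> where "\<mu> = l * s2"
  have \<mu>: "\<mu> \<ge> 0" using l by (simp add: \<mu>_def s2_def sum_nonneg)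
  \<comment> \<open>An additional tilt by \<delta>l up or down is the Gaussian optimum for a
    deviation \<delta>\<mu> from \<mu>. Both expectations come out at most exp((1 - \<delta>^2) L),
    which for large L is negligible against the total mass, at least exp((1 - \<delta>^2/2)
    L).\<close>
  let ?E1 = "\<lambda>\<omega>. exp ((l + \<delta> * l) * U \<omega>) * exp (- (\<delta> * l * (\<mu> + \<delta> * \<mu>)))"
  let ?E2 = "\<lambda>\<omega>. exp ((l - \<delta> * l) * U \<omega>) * exp (\<delta> * l * (\<mu> - \<delta> * \<mu>))"
  \<comment> \<open>Outside the window of radius \<delta>\<mu> around \<mu> one of the subtracted
    terms exceeds exp(lU) and the left side is negative; inside it the event A holds and exp(lU) is
    at most its value at the upper end.\<close>
  have pointwise: "exp (l * U \<omega>) - ?E1 \<omega> - ?E2 \<omega> \<le> exp (l * (\<mu> + \<delta> * \<mu>)) * indicator A \<omega>"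
    if "\<omega> \<in> space M" for \<omega>
  proof -
    have E1: "?E1 \<omega> = exp (l * U \<omega>) * exp (\<delta> * l * (U \<omega> - (\<mu> + \<delta> * \<mu>)))"
      by (simp add: exp_add[symmetric] algebra_simps)
    have E2: "?E2 \<omega> = exp (l * U \<omega>) * exp (\<delta> * l * ((\<mu> - \<delta> * \<mu>) - U \<omega>))"
      by (simp add: exp_add[symmetric] algebra_simps)
    have dl: "\<delta> * l > 0" using \<delta> l by simp
    have pos: "0 < ?E1 \<omega>" "0 < ?E2 \<omega>" by simp_all
    consider "U \<omega> > \<mu> + \<delta> * \<mu>" | "U \<omega> < \<mu> - \<delta> * \<mu>" | "\<mu> - \<delta> * \<mu> \<le> U \<omega>" "U \<omega> \<le> \<mu> + \<delta> * \<mu>" by linarith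
    then show ?thesis
    proof cases
      case 1
      then have "exp (l * U \<omega>) * 1 \<le> ?E1 \<omega>" unfolding E1 using dl by (intro mult_left_mono) auto
      moreover have "0 \<le> exp (l * (\<mu> + \<delta> * \<mu>)) * indicator A \<omega>" by simp
      ultimately show ?thesis using pos by linarith
    next
      case 2
      then have "exp (l * U \<omega>) * 1 \<le> ?E2 \<omega>" unfolding E2 using dl by (intro mult_left_mono) auto
      moreover have "0 \<le> exp (l * (\<mu> + \<delta> * \<mu>)) * indicator A \<omega>" by simp
      ultimately show ?thesis using pos by linarith
    next
      case 3
      then have "\<omega> \<in> A" using that by (simp add: A_def \<mu>_def algebra_simps)
      then have ind: "indicator A \<omega> = (1::real)" by simp
      have "exp (l * U \<omega>) \<le> exp (l * (\<mu> + \<delta> * \<mu>))" using 3 l by (simp add: mult_left_mono)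
      then show ?thesis unfolding ind mult_1_right using pos by linarith
    qed
  qed
  have i1: "integrable M ?E1" "integrable M ?E2" by (intro integrable_mult_left int)+
  have "expectation (\<lambda>\<omega>. exp (l * U \<omega>) - ?E1 \<omega> - ?E2 \<omega>) \<le>
      expectation (\<lambda>\<omega>. exp (l * (\<mu> + \<delta> * \<mu>)) * indicator A \<omega>)"
    by (intro integral_mono pointwise Bochner_Integration.integrable_diff int i1 integrable_mult_right)
       (auto simp: emeasure_eq_measure)
  also have "\<dots> = exp (2 * (1 + \<delta>) * L) * prob A"
    by (simp add: L_def \<mu>_def power2_eq_square algebra_simps)
  also have "expectation (\<lambda>\<omega>. exp (l * U \<omega>) - ?E1 \<omega> - ?E2 \<omega>) =
      expectation (\<lambda>\<omega>. exp (l * U \<omega>)) - expectation ?E1 - expectation ?E2"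
    using int i1 by (subst Bochner_Integration.integral_diff; simp)+
  finally have main: "expectation (\<lambda>\<omega>. exp (l * U \<omega>)) - expectation ?E1 - expectation ?E2 \<le> exp (2 * (1 + \<delta>) * L) * prob A" .
  have "expectation ?E1 \<le> exp ((l + \<delta> * l)\<^sup>2 * s2 / 2) * exp (- (\<delta> * l * (\<mu> + \<delta> * \<mu>)))"
    using upper[of "l + \<delta> * l"] int by (simp add: mult_right_mono)
  also have "\<dots> = exp ((1 - \<delta>\<^sup>2) * L)"
    by (simp add: exp_add[symmetric] L_def \<mu>_def power2_eq_square algebra_simps)
  finally have e1: "expectation ?E1 \<le> exp ((1 - \<delta>\<^sup>2) * L)" .
  have "expectation ?E2 \<le> exp ((l - \<delta> * l)\<^sup>2 * s2 / 2) * exp (\<delta> * l * (\<mu> - \<delta> * \<mu>))"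
    using upper[of "l - \<delta> * l"] int by (simp add: mult_right_mono)
  also have "\<dots> = exp ((1 - \<delta>\<^sup>2) * L)"
    by (simp add: exp_add[symmetric] L_def \<mu>_def power2_eq_square field_simps)
  finally have e2: "expectation ?E2 \<le> exp ((1 - \<delta>\<^sup>2) * L)" .
  have "exp ((1 - \<delta>\<^sup>2 / 2) * L) - 2 * exp ((1 - \<delta>\<^sup>2) * L) \<le> exp (2 * (1 + \<delta>) * L) * prob A"
    using main e1 e2 lower by linarith
  then have "exp (- (2 * (1 + \<delta>) * L)) * (exp ((1 - \<delta>\<^sup>2 / 2) * L) - 2 * exp ((1 - \<delta>\<^sup>2) * L)) \<le>
      exp (- (2 * (1 + \<delta>) * L)) * (exp (2 * (1 + \<delta>) * L) * prob A)"
    by (intro mult_left_mono) auto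
  also have "\<dots> = prob A" by (simp add: exp_minus)
  finally show ?thesis by (simp add: A_def U_def)
qed

end

text \<open>By independence the probability that no event occurs from K on is at most exp of minus
  any partial sum of the p_k with k \<ge> K. Were it positive, minus its logarithm would bound all
  these partial sums and the series would converge.\<close>

lemma (in prob_space) second_borel_cantelli:
  fixes U :: "nat \<Rightarrow> 'a \<Rightarrow> real" and u :: "nat \<Rightarrow> real"
  assumes U: "indep_vars (\<lambda>_. borel) U UNIV"
    and ns: "\<not> summable (\<lambda>k. prob {\<omega>\<in>space M. u k \<le> U k \<omega>})"
  shows "AE \<omega> in M. \<exists>\<^sub>F k in sequentially. u k \<le> U k \<omega>"
proof -
  have [measurable]: "U k \<in> borel_measurable M" for k using U unfolding indep_vars_def by auto
  define p where "p k = prob {\<omega>\<in>space M. u k \<le> U k \<omega>}" for k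
  define B where "B K = {\<omega>\<in>space M. \<forall>k\<ge>K. U k \<omega> < u k}" for K
  have [measurable]: "B K \<in> sets M" for K unfolding B_def by measurable
  have le: "prob (B K) \<le> exp (- (\<Sum>k=K..<L. p k))" for K L
  proof (cases "K < L")
    case True
    have "prob (B K) \<le> prob (\<Inter>k\<in>{K..<L}. U k -` {..<u k} \<inter> space M)"
    proof (rule finite_measure_mono)
      show "B K \<subseteq> (\<Inter>k\<in>{K..<L}. U k -` {..<u k} \<inter> space M)" by (auto simp: B_def)
      show "(\<Inter>k\<in>{K..<L}. U k -` {..<u k} \<inter> space M) \<in> sets M"
        using True by (intro sets.finite_INT) auto
    qed
    also have "\<dots> = (\<Prod>k=K..<L. prob (U k -` {..<u k} \<inter> space M))"
      using True by (intro indep_varsD[OF U]) auto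
    also have "\<dots> = (\<Prod>k=K..<L. 1 - p k)"
    proof (rule prod.cong[OF refl])
      fix k
      have "U k -` {..<u k} \<inter> space M = space M - {\<omega>\<in>space M. u k \<le> U k \<omega>}" by auto
      then show "prob (U k -` {..<u k} \<inter> space M) = 1 - p k" unfolding p_def by (simp add: prob_compl)
    qed
    also have "\<dots> \<le> (\<Prod>k=K..<L. exp (- p k))"
    proof (rule prod_mono)
      fix k
      show "0 \<le> 1 - p k \<and> 1 - p k \<le> exp (- p k)"
        using exp_ge_add_one_self[of "- p k"] by (simp add: p_def)
    qed
    also have "\<dots> = exp (- (\<Sum>k=K..<L. p k))" by (simp add: exp_sum[symmetric] sum_negf)
    finally show ?thesis .
  qed simp
  have "prob (B K) = 0" for K
  proof (rule ccontr)
    assume "prob (B K) \<noteq> 0"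
    then have e: "prob (B K) > 0" using measure_nonneg[of M "B K"] by linarith
    have "summable (\<lambda>k. p (k + K))"
    proof (rule summableI_nonneg_bounded[where x = "- ln (prob (B K))"])
      fix n
      have "(\<Sum>k<n. p (k + K)) = (\<Sum>k=K..<n + K. p k)"
        by (subst sum.shift_bounds_nat_ivl[of p 0 K n, simplified]) (simp add: lessThan_atLeast0)
      moreover have "ln (prob (B K)) \<le> ln (exp (- (\<Sum>k=K..<n + K. p k)))"
        using le[of K "n + K"] e by (intro ln_mono) auto
      ultimately show "(\<Sum>k<n. p (k + K)) \<le> - ln (prob (B K))" by simp
    qed (simp add: p_def)
    then show False using ns unfolding p_def[symmetric] by (simp only: summable_iff_shift)
  qed
  then have "AE \<omega> in M. \<omega> \<notin> B K" for K
    by (intro AE_not_in) (auto simp: null_sets_def emeasure_eq_measure)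
  then have "AE \<omega> in M. \<forall>K. \<omega> \<notin> B K" by (simp add: AE_all_countable)
  with AE_space show ?thesis
    by eventually_elim (auto simp: B_def frequently_sequentially not_less)
qed

text \<open>Taking logarithms twice gives ln k + ln ln \<rho> \<le> ln ln n. The possibly negative
  constant ln ln \<rho> is absorbed by the factor \<rho> > 1, since ln k tends to infinity.\<close>

lemma ln_le_lnln:
  fixes \<rho> :: real
  assumes "\<rho> > 1"
  shows "\<forall>\<^sub>F k in sequentially. \<forall>n. \<rho> ^ k \<le> real n \<longrightarrow> ln (real k) \<le> \<rho> * ln (ln (real n))"
proof -
  have "filterlim (\<lambda>k. (\<rho> - 1) * ln (real k)) at_top sequentially"
    using assms by real_asymp
  then have "\<forall>\<^sub>F k in sequentially. - \<rho> * ln (ln \<rho>) \<le> (\<rho> - 1) * ln (real k)"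
    by (simp add: filterlim_at_top)
  then show ?thesis using eventually_gt_at_top[of 0]
  proof eventually_elim
    case (elim k)
    show ?case
    proof (intro allI impI)
      fix n assume n: "\<rho> ^ k \<le> real n"
      have lr: "ln \<rho> > 0" using assms by simp
      have "real k * ln \<rho> = ln (\<rho> ^ k)" using assms by (simp add: ln_realpow)
      also have "\<dots> \<le> ln (real n)" using n assms by (intro ln_mono) (auto intro: less_le_trans[of 0 "\<rho> ^ k"])
      finally have "ln (real k * ln \<rho>) \<le> ln (ln (real n))"
        using elim lr by (intro ln_mono) (auto intro: less_le_trans[of 0 "real k * ln \<rho>"])
      then have "\<rho> * (ln (real k) + ln (ln \<rho>)) \<le> \<rho> * ln (ln (real n))"
        using elim lr assms by (intro mult_left_mono) (auto simp: ln_mult)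
      then show "ln (real k) \<le> \<rho> * ln (ln (real n))" using elim by (simp add: algebra_simps)
    qed
  qed
qed

section \<open>The two halves of the law of the iterated logarithm\<close>

context rademacher
begin

text \<open>The maximal inequality treats all n between \<rho>^k and \<rho>^(k+1) at once, so that
  one event per k remains and the Borel-Cantelli lemma applies.\<close>

lemma upper_lil:
  fixes a :: "nat \<Rightarrow> real"
  assumes v: "0 < v" "v < v'" and ev: "\<forall>\<^sub>F m in sequentially. (\<Sum>i<m. (a i)\<^sup>2) \<le> v * real m"
  shows "AE \<omega> in M. \<forall>\<^sub>F n in sequentially. (\<Sum>i<n. a i * r i \<omega>) \<le> sqrt (2 * v' * real n * ln (ln (real n)))"
proof -
  \<comment> \<open>The cube pays for three losses of a factor \<rho>: the length of a block, the
    exponent -\<rho> that makes the probabilities summable, and the passage from ln k to ln ln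
    n.\<close>
  define \<rho> where "\<rho> = root 3 (v' / v)"
  have \<rho>: "\<rho> > 1" using v by (simp add: \<rho>_def)
  have "\<rho> ^ 3 = v' / v" unfolding \<rho>_def using v by (intro real_root_pow_pos) auto
  then have v': "v' = v * \<rho> ^ 3" using v by simp
  define T where "T n \<omega> = (\<Sum>i<n. a i * r i \<omega>)" for n \<omega>
  have [measurable]: "T n \<in> borel_measurable M" for n unfolding T_def by measurable
  define N where "N k = nat \<lfloor>\<rho> ^ (k + 1)\<rfloor>" for k
  define x where "x k = sqrt (2 * v * \<rho> ^ (k + 2) * ln (real k))" for k
  define A where "A k = {\<omega>\<in>space M. \<exists>n\<le>N k. x k \<le> T n \<omega>}" for k
  have [measurable]: "A k \<in> sets M" for k unfolding A_def by measurable
  have N_le: "real (N k) \<le> \<rho> ^ (k + 1)" for k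
    unfolding N_def using \<rho> by (simp add: of_nat_nat)
  have "filterlim N at_top sequentially" unfolding N_def using \<rho> by real_asymp
  from filterlim_iff[THEN iffD1, OF this, rule_format, OF ev]
  have "\<forall>\<^sub>F k in sequentially. (\<Sum>i<N k. (a i)\<^sup>2) \<le> v * real (N k)" .
  then have "\<forall>\<^sub>F k in sequentially. norm (prob (A k)) \<le> real k powr (- \<rho>)"
    using eventually_ge_at_top[of 2]
  proof eventually_elim
    case (elim k)
    have lnk: "ln (real k) > 0" using elim by simp
    have "(\<Sum>i<N k. (a i)\<^sup>2) \<le> v * \<rho> ^ (k + 1)"
      using elim(1) mult_left_mono[OF N_le[of k], of v] v by linarith
    moreover have "x k > 0" unfolding x_def using lnk v \<rho> by simp
    moreover have "v * \<rho> ^ (k + 1) > 0" using v \<rho> by simp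
    ultimately have "prob (A k) \<le> exp (- ((x k)\<^sup>2 / (2 * (v * \<rho> ^ (k + 1)))))"
      unfolding A_def T_def by (intro maximal_inequality)
    also have "(x k)\<^sup>2 = 2 * v * \<rho> ^ (k + 2) * ln (real k)"
      unfolding x_def using lnk v \<rho> by simp
    also have "exp (- (2 * v * \<rho> ^ (k + 2) * ln (real k) / (2 * (v * \<rho> ^ (k + 1))))) = real k powr (- \<rho>)"
      using v \<rho> elim by (simp add: powr_def)
    finally show ?case by simp
  qed
  moreover have "summable (\<lambda>k. real k powr (- \<rho>))" using \<rho> by (simp add: summable_real_powr_iff)
  ultimately have "summable (\<lambda>k. prob (A k))" by (rule summable_comparison_test_ev)
  then have "AE \<omega> in M. \<forall>\<^sub>F k in sequentially. \<omega> \<in> space M - A k"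
    by (intro borel_cantelli_AE1) (auto simp: emeasure_eq_measure)
  then show ?thesis
  proof eventually_elim
    case (elim \<omega>)
    obtain K where K: "\<And>k. k \<ge> K \<Longrightarrow> \<omega> \<in> space M - A k \<and> (\<forall>n. \<rho> ^ k \<le> real n \<longrightarrow> ln (real k) \<le> \<rho> * ln (ln (real n)))"
      using eventually_conj[OF elim ln_le_lnln[OF \<rho>]] unfolding eventually_sequentially by blast
    show ?case
    proof (rule eventually_sequentiallyI[of "nat \<lceil>\<rho> ^ K\<rceil>"])
      fix n assume "nat \<lceil>\<rho> ^ K\<rceil> \<le> n"
      then have n: "\<rho> ^ K \<le> real n" by linarith
      have "1 \<le> \<rho> ^ K" using \<rho> by simp
      then have n1: "real n \<ge> 1" using n by linarith
      define k where "k = nat \<lfloor>log \<rho> (real n)\<rfloor>"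
      have "0 \<le> log \<rho> (real n)" using \<rho> n1 by simp
      then have k: "real k \<le> log \<rho> (real n)" "log \<rho> (real n) < real (k + 1)" unfolding k_def by linarith+
      have "K \<le> log \<rho> (real n)" using n \<rho> n1 by (simp add: le_log_iff powr_realpow)
      then have "k \<ge> K" unfolding k_def by linarith
      have n_ge: "\<rho> ^ k \<le> real n" using k(1) \<rho> n1 by (simp add: le_log_iff powr_realpow)
      have "real n < \<rho> powr real (k + 1)" using k(2) \<rho> n1 by (subst (asm) log_less_iff) auto
      then have n_less: "real n < \<rho> ^ (k + 1)" using \<rho> by (subst (asm) powr_realpow) auto
      then have "n \<le> N k" unfolding N_def by (simp add: le_nat_floor)
      then have "T n \<omega> < x k" using K[OF \<open>k \<ge> K\<close>] by (auto simp: A_def not_le) (metis not_le)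
      also have "x k \<le> sqrt (2 * v' * real n * ln (ln (real n)))"
        unfolding x_def
      proof (rule real_sqrt_le_mono)
        have l: "0 \<le> ln (real k)" "ln (real k) \<le> \<rho> * ln (ln (real n))"
          using K[OF \<open>k \<ge> K\<close>] n_ge by (cases "k = 0"; simp)+
        have "2 * v * \<rho> ^ (k + 2) * ln (real k) = 2 * v * \<rho>\<^sup>2 * (\<rho> ^ k * ln (real k))"
          by (simp add: power_add power2_eq_square)
        also have "\<dots> \<le> 2 * v * \<rho>\<^sup>2 * (real n * (\<rho> * ln (ln (real n))))"
          using v \<rho> l n_ge by (intro mult_left_mono mult_mono) auto
        also have "\<dots> = 2 * v' * real n * ln (ln (real n))"
          by (simp add: v' power2_eq_square power3_eq_cube)
        finally show "2 * v * \<rho> ^ (k + 2) * ln (real k) \<le> 2 * v' * real n * ln (ln (real n))" .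
      qed
      finally show "(\<Sum>i<n. a i * r i \<omega>) \<le> sqrt (2 * v' * real n * ln (ln (real n)))" by (simp add: T_def)
    qed
  qed
qed

text \<open>The increments over the blocks \<open>[q\<^sup>k, q\<^sup>k\<^sup>+\<^sup>1)\<close> are independent; for large \<open>q\<close> each of them carries
  nearly the whole variance of the sum up to \<open>q\<^sup>k\<^sup>+\<^sup>1\<close>.\<close>
lemma lower_lil_blocks:
  fixes a :: "nat \<Rightarrow> real" and q :: nat and \<delta> v :: real
  assumes v: "0 < v" and lim: "(\<lambda>m. (\<Sum>i<m. (a i)\<^sup>2) / real m) \<longlonglongrightarrow> v"
    and bnd: "\<And>i. \<bar>a i\<bar> \<le> A * (1 + ln (real i + 1))"
    and q: "q \<ge> 2" and \<delta>: "0 < \<delta>" "\<delta> < 1"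
  defines "s2 \<equiv> \<lambda>k. \<Sum>i=q^k..<q^(k+1). (a i)\<^sup>2"
  shows "(\<lambda>k. s2 k / real q ^ (k + 1)) \<longlonglongrightarrow> v * (1 - 1 / real q)" (is ?lim)
    and "AE \<omega> in M. \<exists>\<^sub>F k in sequentially.
      (1 - \<delta>) * sqrt (2 * ln (real k) / (1 + 3 * \<delta>) * s2 k) \<le> (\<Sum>i=q^k..<q^(k+1). a i * r i \<omega>)"
proof -
  define Q where "Q = real q"
  have Q: "Q > 1" using q by (simp add: Q_def)
  define V where "V m = (\<Sum>i<m. (a i)\<^sup>2)" for m
  have sm: "strict_mono (\<lambda>k. q ^ k)" using q by (intro strict_monoI) simp
  have Vk: "(\<lambda>k. V (q ^ k) / Q ^ k) \<longlonglongrightarrow> v"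
    using LIMSEQ_subseq_LIMSEQ[OF lim sm] by (simp add: V_def comp_def Q_def)
  have s2: "s2 k = V (q ^ (k + 1)) - V (q ^ k)" for k
  proof -
    have "q ^ k \<le> q ^ (k + 1)" using q by (intro power_increasing) auto
    then have "V (q ^ (k + 1)) = V (q ^ k) + s2 k"
      unfolding V_def s2_def lessThan_atLeast0 by (intro sum.atLeastLessThan_concat[symmetric]) auto
    then show ?thesis by simp
  qed
  have "(\<lambda>k. V (q ^ (k + 1)) / Q ^ (k + 1) - V (q ^ k) / Q ^ k / Q) \<longlonglongrightarrow> v - v / Q"
    using Q by (intro tendsto_intros Vk LIMSEQ_ignore_initial_segment[OF Vk, of 1]) auto
  also have "(\<lambda>k. V (q ^ (k + 1)) / Q ^ (k + 1) - V (q ^ k) / Q ^ k / Q) = (\<lambda>k. s2 k / Q ^ (k + 1))"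
    by (simp add: s2 diff_divide_distrib mult.commute)
  also have "v - v / Q = v * (1 - 1 / Q)" by (simp add: algebra_simps)
  finally have lim_s: "(\<lambda>k. s2 k / Q ^ (k + 1)) \<longlonglongrightarrow> v * (1 - 1 / Q)" .
  then show ?lim by (simp add: Q_def)
  have vQ: "v * (1 - 1 / Q) > 0" using v Q by simp
  \<comment> \<open>The tail bound loses the exponent 2(1 + \<delta>) - (1 - \<delta>^2/2), which is
    at most 1 + 3\<delta>. With this L the probabilities are therefore at least of order 1/k and
    their series diverges. The tilt \<open>l k\<close> is the one with
    \<open>(l k)\<^sup>2 * s2 k / 2 = L k\<close>.\<close>
  define L where "L k = ln (real k) / (1 + 3 * \<delta>)" for k
  define l where "l k = sqrt (2 * L k / s2 k)" for k
  define p where "p k = prob {\<omega>\<in>space M. (1 - \<delta>) * sqrt (2 * L k * s2 k) \<le> (\<Sum>i=q^k..<q^(k+1). a i * r i \<omega>)}" for k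
  have L_top: "filterlim L at_top sequentially" unfolding L_def using \<delta> by real_asymp
  have s_pos: "\<forall>\<^sub>F k in sequentially. s2 k > 0"
    using order_tendstoD(1)[OF lim_s vQ]
  proof eventually_elim
    case (elim k)
    have "Q ^ (k + 1) > 0" using Q by simp
    from mult_pos_pos[OF elim this] show ?case using Q by simp
  qed
  \<comment> \<open>The left side dominates \<open>l k\<close> times every weight of the block: the
    tilt decays like sqrt(ln k / Q^(k+1)), while the weights grow only linearly in k.\<close>
  have "(\<lambda>k. sqrt (2 / (1 + 3 * \<delta>) / (s2 k / Q ^ (k + 1))) * A *
      (sqrt (ln (real k) / Q ^ (k + 1)) * (1 + (real k + 1) * ln Q))) \<longlonglongrightarrow>
      sqrt (2 / (1 + 3 * \<delta>) / (v * (1 - 1 / Q))) * A * 0"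
  proof (intro tendsto_mult tendsto_const tendsto_real_sqrt tendsto_divide lim_s)
    show "(\<lambda>k. sqrt (ln (real k) / Q ^ (k + 1)) * (1 + (real k + 1) * ln Q)) \<longlonglongrightarrow> 0"
      using Q by real_asymp
  qed (use vQ in auto)
  then have "\<forall>\<^sub>F k in sequentially. sqrt (2 / (1 + 3 * \<delta>) / (s2 k / Q ^ (k + 1))) * A *
      (sqrt (ln (real k) / Q ^ (k + 1)) * (1 + (real k + 1) * ln Q)) < \<delta>"
    using \<delta> by (intro order_tendstoD(2)) auto
  then have small: "\<forall>\<^sub>F k in sequentially. \<forall>i\<in>{q^k..<q^(k+1)}. \<bar>l k * a i\<bar> \<le> \<delta>"
    using s_pos eventually_ge_at_top[of 1]
  proof eventually_elim
    case (elim k)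
    have lnk: "0 \<le> ln (real k)" using elim by simp
    have l0: "0 \<le> l k" unfolding l_def L_def using lnk elim \<delta> by simp
    have "2 * L k / s2 k = 2 / (1 + 3 * \<delta>) / (s2 k / Q ^ (k + 1)) * (ln (real k) / Q ^ (k + 1))"
      using Q by (simp add: L_def)
    then have l_eq: "l k = sqrt (2 / (1 + 3 * \<delta>) / (s2 k / Q ^ (k + 1))) * sqrt (ln (real k) / Q ^ (k + 1))"
      unfolding l_def by (simp only: real_sqrt_mult)
    show ?case
    proof
      fix i assume i: "i \<in> {q^k..<q^(k+1)}"
      have A0: "A \<ge> 0" using bnd[of 0] by simp
      have "real i + 1 \<le> Q ^ (k + 1)" using i unfolding Q_def
        by (metis Suc_eq_plus1 Suc_leI atLeastLessThan_iff of_nat_Suc of_nat_le_iff of_nat_power add.commute)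
      then have "ln (real i + 1) \<le> ln (Q ^ (k + 1))" using Q by (intro ln_mono) auto
      also have "\<dots> = (real k + 1) * ln Q" using Q by (simp only: ln_realpow) simp
      finally have "A * (1 + ln (real i + 1)) \<le> A * (1 + (real k + 1) * ln Q)" using A0 by (intro mult_left_mono) auto
      with bnd[of i] have "\<bar>a i\<bar> \<le> A * (1 + (real k + 1) * ln Q)" by linarith
      then have "l k * \<bar>a i\<bar> \<le> l k * (A * (1 + (real k + 1) * ln Q))" using l0 by (rule mult_left_mono)
      also have "\<dots> < \<delta>" using elim(1) unfolding l_eq by (simp only: mult_ac)
      finally show "\<bar>l k * a i\<bar> \<le> \<delta>" using l0 by (simp add: abs_mult)
    qed
  qed
  have "((\<lambda>k. exp (- (\<delta>\<^sup>2 / 2 * L k))) \<longlongrightarrow> 0) sequentially"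
    by (rule filterlim_compose[OF _ L_top]) (use \<delta> in real_asymp)
  \<comment> \<open>With 1/4 the two subtracted exponentials use up at most half of the main
    term.\<close>
  then have "\<forall>\<^sub>F k in sequentially. exp (- (\<delta>\<^sup>2 / 2 * L k)) < 1 / 4" by (intro order_tendstoD(2)) auto
  then have p_ge: "\<forall>\<^sub>F k in sequentially. 1 / 2 * inverse (real k) \<le> p k"
    using small s_pos eventually_ge_at_top[of 2]
  proof eventually_elim
    case (elim k)
    have L0: "L k > 0" unfolding L_def using elim \<delta> by simp
    have l0: "l k > 0" unfolding l_def using L0 elim by simp
    have L_eq: "(l k)\<^sup>2 * s2 k / 2 = L k" unfolding l_def using L0 elim by simp
    have "(l k * s2 k)\<^sup>2 = 2 * L k * s2 k"
      unfolding l_def using L0 elim by (simp add: power_mult_distrib power2_eq_square[of "s2 k"])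
    then have u_eq: "l k * s2 k = sqrt (2 * L k * s2 k)"
      by (rule real_sqrt_unique[symmetric]) (use l0 elim in simp)
    have s2k: "(\<Sum>i=q^k..<q^(k+1). (a i)\<^sup>2) = s2 k" by (simp add: s2_def)
    have "exp (- (2 * (1 + \<delta>) * L k)) * (exp ((1 - \<delta>\<^sup>2 / 2) * L k) - 2 * exp ((1 - \<delta>\<^sup>2) * L k)) \<le>
        prob {\<omega>\<in>space M. (1 - \<delta>) * l k * s2 k \<le> (\<Sum>i=q^k..<q^(k+1). a i * r i \<omega>)}"
      by (rule tail_lower_bound[of "{q^k..<q^(k+1)}" "l k" \<delta> a, unfolded s2k L_eq]) (use l0 \<delta> elim(2) in auto)
    then have "exp (- (2 * (1 + \<delta>) * L k)) * (exp ((1 - \<delta>\<^sup>2 / 2) * L k) - 2 * exp ((1 - \<delta>\<^sup>2) * L k)) \<le> p k"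
      unfolding p_def u_eq[symmetric] by (simp only: mult.assoc)
    moreover have "2 * exp ((1 - \<delta>\<^sup>2) * L k) \<le> 1 / 2 * exp ((1 - \<delta>\<^sup>2 / 2) * L k)"
    proof -
      have "exp ((1 - \<delta>\<^sup>2) * L k) = exp ((1 - \<delta>\<^sup>2 / 2) * L k) * exp (- (\<delta>\<^sup>2 / 2 * L k))"
        by (simp add: exp_add[symmetric] algebra_simps)
      also have "\<dots> \<le> exp ((1 - \<delta>\<^sup>2 / 2) * L k) * (1 / 4)"
        using elim(1) by (intro mult_left_mono) auto
      finally show ?thesis by simp
    qed
    then have "exp (- (2 * (1 + \<delta>) * L k)) * (1 / 2 * exp ((1 - \<delta>\<^sup>2 / 2) * L k)) \<le>
        exp (- (2 * (1 + \<delta>) * L k)) * (exp ((1 - \<delta>\<^sup>2 / 2) * L k) - 2 * exp ((1 - \<delta>\<^sup>2) * L k))"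
      by (intro mult_left_mono) auto
    moreover have "1 / 2 * inverse (real k) \<le> exp (- (2 * (1 + \<delta>) * L k)) * (1 / 2 * exp ((1 - \<delta>\<^sup>2 / 2) * L k))"
    proof -
      have "inverse (real k) = exp (- ((1 + 3 * \<delta>) * L k))"
        unfolding L_def using \<delta> elim by (simp add: exp_minus)
      also have "\<dots> \<le> exp (- (2 * (1 + \<delta>) * L k) + (1 - \<delta>\<^sup>2 / 2) * L k)"
      proof -
        have "\<delta> * \<delta> \<le> \<delta> * 1" using \<delta> by (intro mult_left_mono) auto
        then have "0 \<le> (\<delta> - \<delta>\<^sup>2 / 2) * L k" using L0 \<delta> by (intro mult_nonneg_nonneg) (auto simp: power2_eq_square)
        then show ?thesis by (simp add: algebra_simps)
      qed
      finally show ?thesis unfolding exp_add by simp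
    qed
    ultimately show ?case by linarith
  qed
  have "\<not> summable p"
  proof
    assume "summable p"
    then have "summable (\<lambda>k. 1 / 2 * inverse (real k))"
      by (rule summable_comparison_test_ev[rotated]) (use p_ge in eventually_elim, simp)
    then have "summable (\<lambda>k. inverse (real k))" by (simp only: summable_cmult_iff) simp
    then show False using not_summable_harmonic[where 'a = real] by simp
  qed
  moreover have "indep_vars (\<lambda>_. borel) (\<lambda>k \<omega>. \<Sum>i=q^k..<q^(k+1). a i * r i \<omega>) UNIV"
  proof -
    have "disjoint_family_on (\<lambda>k. {q^k..<q^(k+1)}) UNIV"
      unfolding disjoint_family_on_def
    proof (intro ballI impI)
      fix j k :: nat
      assume "j \<noteq> k"
      show "{q^j..<q^(j+1)} \<inter> {q^k..<q^(k+1)} = {}"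
      proof -
        have "q ^ (j + 1) \<le> q ^ k \<or> q ^ (k + 1) \<le> q ^ j"
          using \<open>j \<noteq> k\<close> q power_increasing[of "j + 1" k q] power_increasing[of "k + 1" j q] by linarith
        then show ?thesis by auto
      qed
    qed
    from indep_vars_restrict[OF indep _ this]
    have "indep_vars (\<lambda>k. Pi\<^sub>M {q^k..<q^(k+1)} (\<lambda>_. borel)) (\<lambda>k \<omega>. \<lambda>i\<in>{q^k..<q^(k+1)}. r i \<omega>) UNIV" by simp
    then have "indep_vars (\<lambda>_. borel) (\<lambda>k \<omega>. (\<lambda>f. \<Sum>i=q^k..<q^(k+1). a i * f i) (\<lambda>i\<in>{q^k..<q^(k+1)}. r i \<omega>)) UNIV"
      by (rule indep_vars_compose2)
        (intro borel_measurable_times borel_measurable_const borel_measurable_sum measurable_component_singleton)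
    then show ?thesis by simp
  qed
  ultimately have "AE \<omega> in M. \<exists>\<^sub>F k in sequentially.
      (1 - \<delta>) * sqrt (2 * L k * s2 k) \<le> (\<Sum>i=q^k..<q^(k+1). a i * r i \<omega>)"
    unfolding p_def by (intro second_borel_cantelli)
  then show "AE \<omega> in M. \<exists>\<^sub>F k in sequentially.
      (1 - \<delta>) * sqrt (2 * ln (real k) / (1 + 3 * \<delta>) * s2 k) \<le> (\<Sum>i=q^k..<q^(k+1). a i * r i \<omega>)"
    by (simp add: L_def)
qed

text \<open>The sum up to q^(k+1) is the block sum plus the sum up to q^k. The latter can be very
  negative, but the upper half for the weights \<open>- a\<close> limits the damage to sqrt(6v/q) in
  the scale of q^(k+1). With \<delta> = 1/q the constant obtained tends to sqrt(2v) as q grows, so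
  some q beats \<kappa>.\<close>

lemma lower_lil:
  fixes a :: "nat \<Rightarrow> real"
  assumes v: "0 < v" and lim: "(\<lambda>m. (\<Sum>i<m. (a i)\<^sup>2) / real m) \<longlonglongrightarrow> v"
    and bnd: "\<And>i. \<bar>a i\<bar> \<le> A * (1 + ln (real i + 1))"
    and \<kappa>: "\<kappa> < sqrt (2 * v)"
  shows "AE \<omega> in M. \<exists>\<^sub>F m in sequentially. \<kappa> * sqrt (real m * ln (ln (real m))) \<le> (\<Sum>i<m. a i * r i \<omega>)"
proof -
  have "(\<lambda>q::nat. (1 - 1 / real q) * sqrt (2 / (1 + 3 * (1 / real q)) * (v * (1 - 1 / real q))) - sqrt (6 * v / real q))
      \<longlonglongrightarrow> (1 - 0) * sqrt (2 / (1 + 3 * 0) * (v * (1 - 0))) - sqrt 0"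
    by (intro tendsto_intros tendsto_real_sqrt lim_const_over_n lim_1_over_n) auto
  then have "\<forall>\<^sub>F q in sequentially. \<kappa> <
      (1 - 1 / real q) * sqrt (2 / (1 + 3 * (1 / real q)) * (v * (1 - 1 / real q))) - sqrt (6 * v / real q)"
    using \<kappa> by (intro order_tendstoD(1)) auto
  then obtain q :: nat where q: "q \<ge> 2"
    "\<kappa> < (1 - 1 / real q) * sqrt (2 / (1 + 3 * (1 / real q)) * (v * (1 - 1 / real q))) - sqrt (6 * v / real q)"
    using eventually_happens[OF eventually_conj[OF _ eventually_ge_at_top[of 2]]] by fastforce
  define Q where "Q = real q"
  have Q: "Q > 1" using q by (simp add: Q_def)
  define \<delta> where "\<delta> = 1 / Q"
  have \<delta>: "0 < \<delta>" "\<delta> < 1" using Q by (auto simp: \<delta>_def)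
  define s2 where "s2 k = (\<Sum>i=q^k..<q^(k+1). (a i)\<^sup>2)" for k
  define u where "u k = (1 - \<delta>) * sqrt (2 * ln (real k) / (1 + 3 * \<delta>) * s2 k)" for k
  note blocks = lower_lil_blocks[OF v lim bnd q(1) \<delta>, folded s2_def Q_def]
  define D where "D k = sqrt (Q ^ (k + 1) * ln (ln (Q ^ (k + 1))))" for k
  have D_pos: "\<forall>\<^sub>F k in sequentially. D k > 0"
    unfolding D_def using Q by real_asymp
  have "(\<lambda>k. (1 - \<delta>) * sqrt (2 / (1 + 3 * \<delta>) * (s2 k / Q ^ (k + 1)) * (ln (real k) / ln (ln (Q ^ (k + 1))))) -
        sqrt (6 * v / Q * (ln (ln (Q ^ k)) / ln (ln (Q ^ (k + 1))))))
      \<longlonglongrightarrow> (1 - \<delta>) * sqrt (2 / (1 + 3 * \<delta>) * (v * (1 - 1 / Q)) * 1) - sqrt (6 * v / Q * 1)"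
  proof (intro tendsto_diff tendsto_mult tendsto_const tendsto_real_sqrt blocks(1))
    show "(\<lambda>k. ln (real k) / ln (ln (Q ^ (k + 1)))) \<longlonglongrightarrow> 1" using Q by real_asymp
    show "(\<lambda>k. ln (ln (Q ^ k)) / ln (ln (Q ^ (k + 1)))) \<longlonglongrightarrow> 1" using Q by real_asymp
  qed
  then have "\<forall>\<^sub>F k in sequentially. \<kappa> < (1 - \<delta>) * sqrt (2 / (1 + 3 * \<delta>) * (s2 k / Q ^ (k + 1)) * (ln (real k) / ln (ln (Q ^ (k + 1))))) -
        sqrt (6 * v / Q * (ln (ln (Q ^ k)) / ln (ln (Q ^ (k + 1)))))"
    using q(2) by (intro order_tendstoD(1)) (auto simp: \<delta>_def Q_def)
  then have main: "\<forall>\<^sub>F k in sequentially. \<kappa> * D k \<le> u k - sqrt (6 * v * Q ^ k * ln (ln (Q ^ k)))"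
    using D_pos
  proof eventually_elim
    case (elim k)
    have D2: "Q ^ (k + 1) * ln (ln (Q ^ (k + 1))) > 0" using elim(2) by (simp add: D_def)
    then have ll: "ln (ln (Q ^ (k + 1))) > 0" by (rule zero_less_mult_pos) (use Q in simp)
    have "(1 - \<delta>) * sqrt (2 / (1 + 3 * \<delta>) * (s2 k / Q ^ (k + 1)) * (ln (real k) / ln (ln (Q ^ (k + 1))))) =
        u k / D k"
      unfolding u_def D_def times_divide_eq_right[symmetric] real_sqrt_divide[symmetric]
      by (simp add: mult_ac)
    moreover have "sqrt (6 * v / Q * (ln (ln (Q ^ k)) / ln (ln (Q ^ (k + 1))))) =
        sqrt (6 * v * Q ^ k * ln (ln (Q ^ k))) / D k"
      unfolding D_def real_sqrt_divide[symmetric] using Q by (simp add: mult_ac)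
    ultimately have "\<kappa> < (u k - sqrt (6 * v * Q ^ k * ln (ln (Q ^ k)))) / D k"
      using elim(1) by (simp add: diff_divide_distrib)
    then show ?case using elim(2) by (simp add: pos_less_divide_eq less_imp_le)
  qed
  have "\<forall>\<^sub>F m in sequentially. (\<Sum>i<m. (a i)\<^sup>2) / real m < 2 * v"
    using lim v by (intro order_tendstoD(2)) auto
  then have "\<forall>\<^sub>F m in sequentially. (\<Sum>i<m. (- a i)\<^sup>2) \<le> 2 * v * real m"
    using eventually_gt_at_top[of 0] by eventually_elim (simp add: pos_divide_less_eq less_imp_le)
  \<comment> \<open>The generous variance constants 2v and 3v do no harm, since this term is divided
    by sqrt q in the end.\<close>
  then have "AE \<omega> in M. \<forall>\<^sub>F n in sequentially.
      (\<Sum>i<n. (- a i) * r i \<omega>) \<le> sqrt (2 * (3 * v) * real n * ln (ln (real n)))"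
    using v by (intro upper_lil) auto
  with blocks(2) show ?thesis
  proof eventually_elim
    case (elim \<omega>)
    define T where "T n = (\<Sum>i<n. a i * r i \<omega>)" for n
    have sm: "strict_mono (\<lambda>k. q ^ k)" using q by (intro strict_monoI) simp
    have "\<forall>\<^sub>F k in sequentially. - T (q ^ k) \<le> sqrt (6 * v * Q ^ k * ln (ln (Q ^ k)))"
      using eventually_subseq[OF sm elim(2)] by (simp add: T_def sum_negf Q_def)
    then have "\<forall>\<^sub>F k in sequentially. u k \<le> (\<Sum>i=q^k..<q^(k+1). a i * r i \<omega>) \<longrightarrow>
        \<kappa> * sqrt (real (q ^ (k + 1)) * ln (ln (real (q ^ (k + 1))))) \<le> T (q ^ (k + 1))"
      using main
    proof eventually_elim
      case (elim k)
      have "q ^ k \<le> q ^ (k + 1)" using q by (intro power_increasing) auto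
      then have "T (q ^ (k + 1)) = T (q ^ k) + (\<Sum>i=q^k..<q^(k+1). a i * r i \<omega>)"
        unfolding T_def lessThan_atLeast0 by (intro sum.atLeastLessThan_concat[symmetric]) auto
      then show ?case using elim by (auto simp: D_def Q_def)
    qed
    from frequently_mp[OF this, folded u_def] elim(1)
    have freq: "\<exists>\<^sub>F k in sequentially. \<kappa> * sqrt (real (q ^ (k + 1)) * ln (ln (real (q ^ (k + 1))))) \<le> T (q ^ (k + 1))"
      unfolding u_def by simp
    show ?case unfolding frequently_sequentially
    proof
      fix n
      obtain k where k: "k \<ge> n" "\<kappa> * sqrt (real (q ^ (k + 1)) * ln (ln (real (q ^ (k + 1))))) \<le> T (q ^ (k + 1))"
        using freq unfolding frequently_sequentially by blast
      have "k < q ^ k" using q by (intro power_gt_expt) auto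
      also have "q ^ k \<le> q ^ (k + 1)" using q by simp
      finally have "n \<le> q ^ (k + 1)" using k(1) by simp
      then show "\<exists>m\<ge>n. \<kappa> * sqrt (real m * ln (ln (real m))) \<le> (\<Sum>i<m. a i * r i \<omega>)"
        using k(2) unfolding T_def by blast
    qed
  qed
qed

end

section \<open>Random products of sines\<close>

text \<open>The least index j whose element exceeds m equals the number of elements up to m. This
  translates between the time m and the number N of selected indices; \<open>enumerate\<close>
  counts from 0, hence the strict inequality.\<close>

lemma enumerate_initial_segment:
  fixes E :: "nat set"
  assumes E: "infinite E"
  shows "enumerate E ` {..<card (E \<inter> {..m})} = E \<inter> {..m}"
    and "enumerate E k \<le> m \<longleftrightarrow> k < card (E \<inter> {..m})"
proof -
  define j where "j = (LEAST k. m < enumerate E k)"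
  have ex: "\<exists>k. m < enumerate E k"
    using le_enumerate[OF E, of "Suc m"] by (intro exI[of _ "Suc m"]) simp
  have j: "m < enumerate E j" unfolding j_def by (rule LeastI_ex[OF ex])
  have less: "enumerate E k \<le> m \<longleftrightarrow> k < j" for k
  proof
    assume "k < j"
    then show "enumerate E k \<le> m" unfolding j_def using not_less_Least not_less by blast
  next
    assume "enumerate E k \<le> m"
    then show "k < j" using j enumerate_mono_le_iff[OF E, of j k] by linarith
  qed
  have eq: "enumerate E ` {..<j} = E \<inter> {..m}"
  proof
    show "enumerate E ` {..<j} \<subseteq> E \<inter> {..m}" using less enumerate_in_set[OF E] by auto
    show "E \<inter> {..m} \<subseteq> enumerate E ` {..<j}"
    proof
      fix x assume x: "x \<in> E \<inter> {..m}"
      then obtain k where "enumerate E k = x" using enumerate_Ex[OF E] by blast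
      then show "x \<in> enumerate E ` {..<j}" using x less[of k] by auto
    qed
  qed
  have "card (E \<inter> {..m}) = j"
    unfolding eq[symmetric] using inj_enumerate[OF E] by (simp add: card_image inj_on_subset)
  then show "enumerate E ` {..<card (E \<inter> {..m})} = E \<inter> {..m}"
    and "enumerate E k \<le> m \<longleftrightarrow> k < card (E \<inter> {..m})" using eq less by simp_all
qed

definition lil_scale :: "nat \<Rightarrow> real" where
  "lil_scale n = sqrt (real n * ln (ln (real n)))"

lemma lil_scale_pos: "\<forall>\<^sub>F n in sequentially. lil_scale n > 0"
  unfolding lil_scale_def by real_asymp

text \<open>Eventually X m lies between m/3 and m, where 1/3 is just some constant below 1/2. Such a
  factor does not affect iterated logarithms asymptotically, so only the ratio X m / m under the
  root matters.\<close>

lemma lil_scale_ratio: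
  fixes X :: "nat \<Rightarrow> nat"
  assumes X: "(\<lambda>m. real (X m) / real m) \<longlonglongrightarrow> 1 / 2" and X_le: "\<And>m. X m \<le> m"
  shows "(\<lambda>m. lil_scale (X m) / lil_scale m) \<longlonglongrightarrow> 1 / sqrt 2"
proof -
  have "\<forall>\<^sub>F m in sequentially. real (X m) / real m > 1 / 3"
    using X by (intro order_tendstoD(1)) auto
  then have ge: "\<forall>\<^sub>F m in sequentially. real m / 3 \<le> real (X m)"
    using eventually_gt_at_top[of 0] by eventually_elim (simp add: field_simps)
  have "(\<lambda>m. ln (ln (real (X m))) / ln (ln (real m))) \<longlonglongrightarrow> 1"
  proof (rule tendsto_sandwich)
    show "(\<lambda>m. ln (ln (real m / 3)) / ln (ln (real m))) \<longlonglongrightarrow> 1" by real_asymp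
    show "(\<lambda>m. 1) \<longlonglongrightarrow> (1::real)" by simp
    have ev: "\<forall>\<^sub>F m in sequentially. ln (ln (real m)) > 0" "\<forall>\<^sub>F m in sequentially. ln (real m / 3) > 0"
      by real_asymp+
    from ge ev eventually_gt_at_top[of 0]
    have "\<forall>\<^sub>F m in sequentially. ln (ln (real m / 3)) / ln (ln (real m)) \<le> ln (ln (real (X m))) / ln (ln (real m)) \<and>
        ln (ln (real (X m))) / ln (ln (real m)) \<le> 1"
    proof eventually_elim
      case (elim m)
      have "0 < real (X m)" using elim by linarith
      then have "ln (real m / 3) \<le> ln (real (X m))" "ln (real (X m)) \<le> ln (real m)"
        using elim X_le[of m] by (auto intro!: ln_mono)
      moreover from this have "ln (ln (real m / 3)) \<le> ln (ln (real (X m)))" "ln (ln (real (X m))) \<le> ln (ln (real m))"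
        using elim by (auto intro!: ln_mono)
      ultimately show ?case using elim by (auto intro!: divide_right_mono simp: divide_le_eq_1)
    qed
    then show "\<forall>\<^sub>F m in sequentially. ln (ln (real m / 3)) / ln (ln (real m)) \<le> ln (ln (real (X m))) / ln (ln (real m))"
      and "\<forall>\<^sub>F m in sequentially. ln (ln (real (X m))) / ln (ln (real m)) \<le> 1"
      by (auto elim: eventually_mono)
  qed
  then have "(\<lambda>m. sqrt (real (X m) / real m * (ln (ln (real (X m))) / ln (ln (real m))))) \<longlonglongrightarrow> sqrt (1 / 2 * 1)"
    by (intro tendsto_intros X)
  then show ?thesis by (simp add: lil_scale_def real_sqrt_divide)
qed

text \<open>The shift moves the index set from the positive integers to all naturals; independence
  is transported by restricting to the disjoint singletons \<open>{Suc n}\<close>.\<close>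

lemma (in prob_space) indep_vars_Suc:
  assumes "indep_vars (\<lambda>_. borel) (\<xi> :: nat \<Rightarrow> 'a \<Rightarrow> real) {1..}"
  shows "indep_vars (\<lambda>_. borel) (\<lambda>n \<omega>. 2 * \<xi> (Suc n) \<omega> - 1) UNIV"
proof -
  have "indep_vars (\<lambda>n. Pi\<^sub>M {Suc n} (\<lambda>_. borel)) (\<lambda>n \<omega>. \<lambda>i\<in>{Suc n}. \<xi> i \<omega>) UNIV"
    by (rule indep_vars_restrict[OF assms]) (auto simp: disjoint_family_on_def)
  then have "indep_vars (\<lambda>_. borel) (\<lambda>n \<omega>. (\<lambda>f. 2 * f (Suc n) - 1 :: real) (\<lambda>i\<in>{Suc n}. \<xi> i \<omega>)) UNIV"
    by (rule indep_vars_compose2)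
      (intro borel_measurable_diff borel_measurable_times borel_measurable_const measurable_component_singleton, simp)
  then show ?thesis by simp
qed

lemma random_sine_product_eq_exp:
  fixes \<xi> :: "nat \<Rightarrow> 'a \<Rightarrow> real"
  defines "E \<equiv> \<lambda>\<omega>. {n. n \<ge> 1 \<and> \<xi> n \<omega> = 1}"
  assumes E: "infinite (E \<omega>)" and nz: "\<And>n. n \<ge> 1 \<Longrightarrow> sin (pi * (real n * \<alpha>)) \<noteq> 0"
  shows "random_sine_product \<alpha> \<xi> \<omega> (card (E \<omega> \<inter> {..m})) = exp (\<Sum>n\<in>E \<omega> \<inter> {..m}. log_sine (real n * \<alpha>))"
proof -
  let ?f = "\<lambda>n. \<bar>2 * sin (pi * (real n * \<alpha>))\<bar>"
  have "random_sine_product \<alpha> \<xi> \<omega> (card (E \<omega> \<inter> {..m})) =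
      (\<Prod>k=1..card (E \<omega> \<inter> {..m}). ?f (enumerate (E \<omega>) (k - 1)))"
    by (simp add: random_sine_product_def random_index_def E_def mult.assoc)
  also have "\<dots> = (\<Prod>j<card (E \<omega> \<inter> {..m}). ?f (enumerate (E \<omega>) j))"
    by (rule prod.reindex_bij_witness[of _ Suc "\<lambda>k. k - 1"]) auto
  also have "\<dots> = (\<Prod>n\<in>enumerate (E \<omega>) ` {..<card (E \<omega> \<inter> {..m})}. ?f n)"
    using inj_enumerate[OF E] by (subst prod.reindex) (auto intro: inj_on_subset)
  also have "\<dots> = (\<Prod>n\<in>E \<omega> \<inter> {..m}. ?f n)" by (simp only: enumerate_initial_segment(1)[OF E])
  also have "\<dots> = (\<Prod>n\<in>E \<omega> \<inter> {..m}. exp (log_sine (real n * \<alpha>)))"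
    using nz by (intro prod.cong refl) (simp add: log_sine_def E_def)
  also have "\<dots> = exp (\<Sum>n\<in>E \<omega> \<inter> {..m}. log_sine (real n * \<alpha>))" by (simp add: exp_sum)
  finally show ?thesis .
qed

text \<open>For a fixed outcome the rest is deterministic. After X m selected indices the logarithm
  of the product is half of the weighted sign sum plus a negligible term, and the scale at X m is
  asymptotically that at m divided by sqrt 2, so the factor sqrt 2 in the hypotheses is exactly
  compensated. The bound \<open>lln\<close> gives X m ~ m/2 and with it the infinitude of the
  selected set.\<close>

lemma (in badly_approximable) pathwise_lil:
  fixes \<xi> :: "nat \<Rightarrow> 'a \<Rightarrow> real" and \<omega> :: 'a and \<sigma> \<epsilon> :: real
  defines "r \<equiv> \<lambda>i. 2 * \<xi> (Suc i) \<omega> - 1" and "a \<equiv> \<lambda>i. log_sine (real (Suc i) * \<alpha>)"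
  assumes \<xi>01: "\<And>n. n \<ge> 1 \<Longrightarrow> \<xi> n \<omega> \<in> {0, 1}" and \<epsilon>: "\<epsilon> > 0"
    and lln: "\<forall>\<^sub>F m in sequentially. \<bar>\<Sum>i<m. r i\<bar> \<le> 2 * lil_scale m"
    and up: "\<forall>\<^sub>F m in sequentially. (\<Sum>i<m. a i * r i) \<le> sqrt 2 * (\<sigma> + \<epsilon> / 2) * lil_scale m"
    and lo: "\<exists>\<^sub>F m in sequentially. sqrt 2 * (\<sigma> - \<epsilon> / 2) * lil_scale m \<le> (\<Sum>i<m. a i * r i)"
  shows "\<forall>\<^sub>F N in sequentially. random_sine_product \<alpha> \<xi> \<omega> N \<le> exp ((\<sigma> + \<epsilon>) * lil_scale N)"
    and "\<exists>\<^sub>F N in sequentially. random_sine_product \<alpha> \<xi> \<omega> N \<ge> exp ((\<sigma> - \<epsilon>) * lil_scale N)"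
proof -
  define E where "E = {n. n \<ge> 1 \<and> \<xi> n \<omega> = 1}"
  define X where "X m = card (E \<inter> {..m})" for m
  have E_sum: "(\<Sum>i<m. \<xi> (Suc i) \<omega> * h (Suc i)) = (\<Sum>n\<in>E \<inter> {..m}. h n)" for h :: "nat \<Rightarrow> real" and m
  proof -
    have "(\<Sum>i<m. \<xi> (Suc i) \<omega> * h (Suc i)) = (\<Sum>n=1..m. \<xi> n \<omega> * h n)"
      by (rule sum.reindex_bij_witness[of _ "\<lambda>k. k - 1" Suc]) auto
    also have "\<dots> = (\<Sum>n\<in>E \<inter> {..m}. h n)"
    proof (rule sum.mono_neutral_cong_right)
      show "\<forall>n\<in>{1..m} - E \<inter> {..m}. \<xi> n \<omega> * h n = 0" using \<xi>01 by (fastforce simp: E_def)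
    qed (auto simp: E_def)
    finally show ?thesis .
  qed
  have X_le: "X m \<le> m" for m
  proof -
    have "X m \<le> card {1..m}" unfolding X_def by (intro card_mono) (auto simp: E_def)
    then show ?thesis by simp
  qed
  have X_eq: "real (X m) / real m = (1 + (\<Sum>i<m. r i) / real m) / 2" if "m > 0" for m
  proof -
    have "(\<Sum>i<m. r i) = 2 * (\<Sum>i<m. \<xi> (Suc i) \<omega> * 1) - real m"
      by (simp add: r_def sum_subtractf sum_distrib_left)
    also have "(\<Sum>i<m. \<xi> (Suc i) \<omega> * 1) = real (X m)" using E_sum[of "\<lambda>_. 1" m] by (simp add: X_def)
    finally show ?thesis using that by (simp add: field_simps)
  qed
  have "(\<lambda>m. (\<Sum>i<m. r i) / real m) \<longlonglongrightarrow> 0"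
  proof (rule Lim_null_comparison)
    show "\<forall>\<^sub>F m in sequentially. norm ((\<Sum>i<m. r i) / real m) \<le> 2 * lil_scale m / real m"
      using lln by eventually_elim (simp add: divide_right_mono)
    show "(\<lambda>m. 2 * lil_scale m / real m) \<longlonglongrightarrow> 0" unfolding lil_scale_def by real_asymp
  qed
  then have lim: "(\<lambda>m. (1 + (\<Sum>i<m. r i) / real m) / 2) \<longlonglongrightarrow> (1 + 0) / 2" by (intro tendsto_intros) auto
  have "\<forall>\<^sub>F m in sequentially. (1 + (\<Sum>i<m. r i) / real m) / 2 = real (X m) / real m"
    using eventually_gt_at_top[of 0] by eventually_elim (simp only: X_eq)
  from Lim_transform_eventually[OF lim this]
  have X_lim: "(\<lambda>m. real (X m) / real m) \<longlonglongrightarrow> 1 / 2" by simp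
  have X_top: "filterlim X at_top sequentially"
  proof -
    have "filterlim (\<lambda>m. real (X m) / real m * real m) at_top sequentially"
      by (rule filterlim_tendsto_pos_mult_at_top[OF X_lim]) (auto intro: filterlim_real_sequentially)
    moreover have "\<forall>\<^sub>F m in sequentially. real (X m) / real m * real m = real (X m)"
      using eventually_gt_at_top[of 0] by eventually_elim simp
    ultimately have "filterlim (\<lambda>m. real (X m)) at_top sequentially"
      by (rule filterlim_cong[OF refl refl, THEN iffD1, rotated])
    then show ?thesis by (simp only: filterlim_sequentially_iff_filterlim_real)
  qed
  have inf: "infinite E"
  proof
    assume "finite E"
    then have "X m \<le> card E" for m unfolding X_def by (intro card_mono) auto
    moreover have "\<forall>\<^sub>F m in sequentially. Suc (card E) \<le> X m" using X_top by (simp only: filterlim_at_top)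
    ultimately show False by (auto simp: eventually_sequentially not_less_eq_eq[symmetric])
  qed
  define G where "G m = (\<Sum>n\<in>E \<inter> {..m}. log_sine (real n * \<alpha>))" for m
  have P_X: "random_sine_product \<alpha> \<xi> \<omega> (X m) = exp (G m)" for m
    unfolding X_def G_def E_def
    using inf sin_nonzero by (intro random_sine_product_eq_exp) (auto simp: E_def)
  define T where "T m = (\<Sum>i<m. a i * r i)" for m
  have G_eq: "G m = ((\<Sum>i<m. a i) + T m) / 2" for m
  proof -
    have "T m = 2 * (\<Sum>i<m. \<xi> (Suc i) \<omega> * log_sine (real (Suc i) * \<alpha>)) - (\<Sum>i<m. a i)"
      unfolding T_def r_def a_def sum_distrib_left sum_subtractf[symmetric]
      by (intro sum.cong refl) (simp add: algebra_simps)
    then have "T m = 2 * G m - (\<Sum>i<m. a i)"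
      by (simp only: E_sum[of "\<lambda>n. log_sine (real n * \<alpha>)"] G_def)
    then show ?thesis by simp
  qed
  have "(\<lambda>m. (\<Sum>n=1..m. log_sine (real n * \<alpha>)) / sqrt (real m) * (sqrt (real m) / lil_scale m)) \<longlonglongrightarrow> 0 * 0"
  proof (intro tendsto_mult sum_log_sine_over_sqrt)
    show "(\<lambda>m. sqrt (real m) / lil_scale m) \<longlonglongrightarrow> 0" unfolding lil_scale_def by real_asymp
  qed
  then have lim: "(\<lambda>m. (\<Sum>i<m. a i) / sqrt (real m) * (sqrt (real m) / lil_scale m)) \<longlonglongrightarrow> 0"
    by (simp add: sum.atLeast1_atMost_eq a_def del: of_nat_Suc)
  have "\<forall>\<^sub>F m in sequentially. (\<Sum>i<m. a i) / sqrt (real m) * (sqrt (real m) / lil_scale m) = (\<Sum>i<m. a i) / lil_scale m"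
    using eventually_gt_at_top[of 0] by eventually_elim simp
  from Lim_transform_eventually[OF lim this] have S_lim: "(\<lambda>m. (\<Sum>i<m. a i) / lil_scale m) \<longlonglongrightarrow> 0" .
  note ratio = lil_scale_ratio[OF X_lim X_le]
  have scale: "(\<tau> * (x / D) - (S / D + s) / 2) * D = \<tau> * x - (S + s * D) / 2" if "D > 0" for \<tau> x D S s :: real
    using that by (simp add: field_simps)
  \<comment> \<open>The normalised distance between the bound claimed with \<tau> and the one
    available with \<tau>'. Taking \<tau> = \<sigma> + \<epsilon> and \<tau>' = \<sigma> +
    \<epsilon>/2, or both with minus signs, gives a limit of definite sign, which absorbs all error
    terms.\<close>
  have gap: "(\<lambda>m. (\<tau> * (lil_scale (X m) / lil_scale m)) - ((\<Sum>i<m. a i) / lil_scale m + sqrt 2 * \<tau>') / 2)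
      \<longlonglongrightarrow> (\<tau> - \<tau>') / sqrt 2" for \<tau> \<tau>' :: real
  proof -
    have "(\<lambda>m. (\<tau> * (lil_scale (X m) / lil_scale m)) - ((\<Sum>i<m. a i) / lil_scale m + sqrt 2 * \<tau>') / 2)
        \<longlonglongrightarrow> \<tau> * (1 / sqrt 2) - (0 + sqrt 2 * \<tau>') / 2"
      by (intro tendsto_intros ratio S_lim) auto
    also have "\<tau> * (1 / sqrt 2) - (0 + sqrt 2 * \<tau>') / 2 = (\<tau> - \<tau>') / sqrt 2"
    proof -
      have "sqrt 2 * \<tau>' / 2 = sqrt 2 * \<tau>' / (sqrt 2 * sqrt 2)" by simp
      also have "\<dots> = \<tau>' / sqrt 2" by (simp del: real_sqrt_mult_self)
      finally show ?thesis by (simp add: diff_divide_distrib)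
    qed
    finally show ?thesis .
  qed
  have "\<forall>\<^sub>F m in sequentially. 0 < (\<sigma> + \<epsilon>) * (lil_scale (X m) / lil_scale m) -
      ((\<Sum>i<m. a i) / lil_scale m + sqrt 2 * (\<sigma> + \<epsilon> / 2)) / 2"
    using \<epsilon> by (intro order_tendstoD(1)[OF gap]) auto
  then have "\<forall>\<^sub>F m in sequentially. G m \<le> (\<sigma> + \<epsilon>) * lil_scale (X m)"
    using up lil_scale_pos
  proof eventually_elim
    case (elim m)
    have "((\<Sum>i<m. a i) + sqrt 2 * (\<sigma> + \<epsilon> / 2) * lil_scale m) / 2 \<le> (\<sigma> + \<epsilon>) * lil_scale (X m)"
      using mult_right_mono[OF less_imp_le[OF elim(1)], of "lil_scale m"] elim(3)
      unfolding scale[OF elim(3)] by simp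
    then show ?case using elim(2) unfolding G_eq T_def by simp
  qed
  \<comment> \<open>The upper bound concerns every large N: at the time m = n_N, the N-th selected
    index, exactly N indices have been selected. The shift by one asks for N > 0.\<close>
  moreover have "filterlim (\<lambda>N. enumerate E (N - 1)) at_top sequentially"
    by (rule filterlim_at_top_mono[of "\<lambda>N. N - 1"])
      (auto intro!: filterlim_minus_const_nat_at_top le_enumerate[OF inf] always_eventually)
  ultimately have "\<forall>\<^sub>F N in sequentially. G (enumerate E (N - 1)) \<le> (\<sigma> + \<epsilon>) * lil_scale (X (enumerate E (N - 1)))"
    by (rule eventually_compose_filterlim)
  then show "\<forall>\<^sub>F N in sequentially. random_sine_product \<alpha> \<xi> \<omega> N \<le> exp ((\<sigma> + \<epsilon>) * lil_scale N)"
    using eventually_gt_at_top[of 0]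
  proof eventually_elim
    case (elim N)
    have "j < X (enumerate E (N - 1)) \<longleftrightarrow> j < N" for j
      unfolding X_def enumerate_initial_segment(2)[OF inf, symmetric] using elim inf by auto
    then have XN: "X (enumerate E (N - 1)) = N" by (meson linorder_neqE_nat less_irrefl)
    show ?case using elim(1) P_X[of "enumerate E (N - 1)"] unfolding XN by simp
  qed
  have "\<forall>\<^sub>F m in sequentially. (\<sigma> - \<epsilon>) * (lil_scale (X m) / lil_scale m) -
      ((\<Sum>i<m. a i) / lil_scale m + sqrt 2 * (\<sigma> - \<epsilon> / 2)) / 2 < 0"
    using \<epsilon> by (intro order_tendstoD(2)[OF gap]) auto
  then have "\<forall>\<^sub>F m in sequentially. sqrt 2 * (\<sigma> - \<epsilon> / 2) * lil_scale m \<le> T m \<longrightarrow> (\<sigma> - \<epsilon>) * lil_scale (X m) \<le> G m"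
    using lil_scale_pos
  proof eventually_elim
    case (elim m)
    have "(\<sigma> - \<epsilon>) * lil_scale (X m) \<le> ((\<Sum>i<m. a i) + sqrt 2 * (\<sigma> - \<epsilon> / 2) * lil_scale m) / 2"
      using mult_right_mono[OF less_imp_le[OF elim(1)], of "lil_scale m"] elim(2)
      unfolding scale[OF elim(2)] by simp
    then show ?case unfolding G_eq by simp
  qed
  from frequently_mp[OF this] lo have freq: "\<exists>\<^sub>F m in sequentially. (\<sigma> - \<epsilon>) * lil_scale (X m) \<le> G m"
    by (simp add: T_def)
  show "\<exists>\<^sub>F N in sequentially. random_sine_product \<alpha> \<xi> \<omega> N \<ge> exp ((\<sigma> - \<epsilon>) * lil_scale N)"
    unfolding frequently_sequentially
  proof
    fix N\<^sub>0
    \<comment> \<open>Infinitely many good times m yield infinitely many values N = X m, because X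
      tends to infinity.\<close>
    have "\<forall>\<^sub>F m in sequentially. N\<^sub>0 \<le> X m" using X_top by (simp only: filterlim_at_top)
    from frequently_eventually_frequently[OF freq this]
    obtain m where "(\<sigma> - \<epsilon>) * lil_scale (X m) \<le> G m" "N\<^sub>0 \<le> X m" by (auto dest: frequently_ex)
    then show "\<exists>N\<ge>N\<^sub>0. exp ((\<sigma> - \<epsilon>) * lil_scale N) \<le> random_sine_product \<alpha> \<xi> \<omega> N"
      by (intro exI[of _ "X m"]) (simp add: P_X)
  qed
qed

theorem theorem7:
  fixes \<alpha> :: real
    and M :: "'a measure"
    and \<xi> :: "nat \<Rightarrow> 'a \<Rightarrow> real"
  assumes "\<alpha> \<notin> \<rat>"
    and "bounded_cf_coeffs \<alpha>"
    and "prob_space M"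
    and "prob_space.indep_vars M (\<lambda>_. borel) \<xi> {1..}"
    and "\<And>m n. m \<ge> 1 \<Longrightarrow> n \<ge> 1 \<Longrightarrow> distr M borel (\<xi> m) = distr M borel (\<xi> n)"
    and "\<And>n \<omega>. n \<ge> 1 \<Longrightarrow> \<omega> \<in> space M \<Longrightarrow> \<xi> n \<omega> \<in> {0, 1}"
    and "\<And>n. n \<ge> 1 \<Longrightarrow> prob_space.expectation M (\<xi> n) = 1 / 2"
  shows "\<forall>\<epsilon>>0. AE \<omega> in M.
           (\<forall>\<^sub>F N in sequentially.
              random_sine_product \<alpha> \<xi> \<omega> N
                \<le> exp ((pi / sqrt 12 + \<epsilon>) * sqrt (real N * ln (ln (real N))))) \<and>
           (\<exists>\<^sub>F N in sequentially.
              random_sine_product \<alpha> \<xi> \<omega> N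
                \<ge> exp ((pi / sqrt 12 - \<epsilon>) * sqrt (real N * ln (ln (real N)))))"
proof (intro allI impI)
  fix \<epsilon> :: real assume \<epsilon>: "\<epsilon> > 0"
  interpret prob_space M by fact
  obtain c where "badly_approximable \<alpha> c"
    using bounded_cf_coeffs_badly_approximable[OF assms(1,2)] by blast
  then interpret badly_approximable \<alpha> c .
  define r where "r n \<omega> = 2 * \<xi> (Suc n) \<omega> - 1" for n \<omega>
  interpret rademacher M r
  proof
    show "indep_vars (\<lambda>_. borel) r UNIV" unfolding r_def by (rule indep_vars_Suc) fact
    show "r n \<omega> \<in> {-1, 1}" if "\<omega> \<in> space M" for n \<omega>
      using assms(6)[of "Suc n" \<omega>] that by (auto simp: r_def)
    show "expectation (r n) = 0" for n
    proof -
      have [measurable]: "\<xi> (Suc n) \<in> borel_measurable M" using assms(4) unfolding indep_vars_def by simp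
      have "\<bar>\<xi> (Suc n) \<omega>\<bar> \<le> 1" if "\<omega> \<in> space M" for \<omega>
        using assms(6)[of "Suc n" \<omega>] that by auto
      then have "integrable M (\<xi> (Suc n))"
        by (intro integrable_const_bound[where B = 1]) (auto intro!: AE_I2)
      then show ?thesis using assms(7)[of "Suc n"] by (simp add: r_def[abs_def] prob_space)
    qed
  qed
  define \<sigma> where "\<sigma> = pi / sqrt 12"
  have \<sigma>: "\<sigma> > 0" "\<sigma>\<^sup>2 = pi\<^sup>2 / 12" by (simp_all add: \<sigma>_def power_divide)
  define a where "a i = log_sine (real (Suc i) * \<alpha>)" for i
  have a_lim: "(\<lambda>m. (\<Sum>i<m. (a i)\<^sup>2) / real m) \<longlonglongrightarrow> \<sigma>\<^sup>2"
    using log_sine_square_mean_tendsto by (simp add: \<sigma>(2) sum.atLeast1_atMost_eq a_def del: of_nat_Suc)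
  have a_bound: "\<bar>a i\<bar> \<le> (1 + ln (2 / c)) * (1 + ln (real i + 1))" for i
  proof -
    have "\<bar>a i\<bar> \<le> ln (real i + 1) + ln (2 / c)"
      using abs_log_sine_le[of "Suc i"] by (simp add: a_def add.commute)
    moreover have "0 \<le> ln (2 / c) * ln (real i + 1)" using c by (intro mult_nonneg_nonneg) auto
    ultimately show ?thesis by (simp add: algebra_simps)
  qed
  \<comment> \<open>Unit weights have v = 1; the choice v' = 2 produces the factor 2. The signs s =
    1 and s = -1 together give the two-sided bound.\<close>
  have lln: "AE \<omega> in M. \<forall>\<^sub>F m in sequentially. (\<Sum>i<m. s * r i \<omega>) \<le> 2 * lil_scale m" if "\<bar>s\<bar> = 1" for s :: real
  proof -
    have "s\<^sup>2 = 1" using that by (simp add: abs_square_eq_1)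
    then have "AE \<omega> in M. \<forall>\<^sub>F m in sequentially. (\<Sum>i<m. s * r i \<omega>) \<le> sqrt (2 * 2 * real m * ln (ln (real m)))"
      by (intro upper_lil[of 1]) auto
    moreover have "sqrt (2 * 2 * real m * ln (ln (real m))) = 2 * lil_scale m" for m
      using real_sqrt_mult[of 4] by (simp add: lil_scale_def mult.assoc)
    ultimately show ?thesis by simp
  qed
  have up: "AE \<omega> in M. \<forall>\<^sub>F m in sequentially. (\<Sum>i<m. a i * r i \<omega>) \<le> sqrt 2 * (\<sigma> + \<epsilon> / 2) * lil_scale m"
  proof -
    \<comment> \<open>The upper half needs an eventual bound v for the mean variance, hence v above
      its limit \<sigma>^2, and then v' > v; the points \<sigma> + \<epsilon>/4 and \<sigma> +
      \<epsilon>/2 make room for both.\<close>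
    have lt: "\<sigma>\<^sup>2 < (\<sigma> + \<epsilon> / 4)\<^sup>2" "(\<sigma> + \<epsilon> / 4)\<^sup>2 < (\<sigma> + \<epsilon> / 2)\<^sup>2"
      using \<sigma> \<epsilon> by (intro power_strict_mono; simp)+
    have "\<forall>\<^sub>F m in sequentially. (\<Sum>i<m. (a i)\<^sup>2) / real m < (\<sigma> + \<epsilon> / 4)\<^sup>2"
      using a_lim lt by (intro order_tendstoD(2)) auto
    then have "\<forall>\<^sub>F m in sequentially. (\<Sum>i<m. (a i)\<^sup>2) \<le> (\<sigma> + \<epsilon> / 4)\<^sup>2 * real m"
      using eventually_gt_at_top[of 0] by eventually_elim (simp add: pos_divide_less_eq less_imp_le)
    then have "AE \<omega> in M. \<forall>\<^sub>F m in sequentially.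
        (\<Sum>i<m. a i * r i \<omega>) \<le> sqrt (2 * (\<sigma> + \<epsilon> / 2)\<^sup>2 * real m * ln (ln (real m)))"
      using \<sigma> \<epsilon> lt by (intro upper_lil[of "(\<sigma> + \<epsilon> / 4)\<^sup>2"]) auto
    moreover have "sqrt (2 * (\<sigma> + \<epsilon> / 2)\<^sup>2 * real m * ln (ln (real m))) = sqrt 2 * (\<sigma> + \<epsilon> / 2) * lil_scale m" for m
      using \<sigma> \<epsilon> by (simp add: lil_scale_def real_sqrt_mult mult.assoc)
    ultimately show ?thesis by simp
  qed
  have lo: "AE \<omega> in M. \<exists>\<^sub>F m in sequentially. sqrt 2 * (\<sigma> - \<epsilon> / 2) * lil_scale m \<le> (\<Sum>i<m. a i * r i \<omega>)"
    unfolding lil_scale_def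
  proof (rule lower_lil[OF _ a_lim a_bound])
    show "sqrt 2 * (\<sigma> - \<epsilon> / 2) < sqrt (2 * \<sigma>\<^sup>2)" using \<sigma> \<epsilon> by (simp add: real_sqrt_mult)
  qed (use \<sigma> in simp)
  have "AE \<omega> in M.
      (\<forall>\<^sub>F N in sequentially. random_sine_product \<alpha> \<xi> \<omega> N \<le> exp ((\<sigma> + \<epsilon>) * lil_scale N)) \<and>
      (\<exists>\<^sub>F N in sequentially. random_sine_product \<alpha> \<xi> \<omega> N \<ge> exp ((\<sigma> - \<epsilon>) * lil_scale N))"
    using AE_space lln[of 1, simplified] lln[of "-1", simplified] up lo
  proof eventually_elim
    case (elim \<omega>)
    have "\<forall>\<^sub>F m in sequentially. \<bar>\<Sum>i<m. r i \<omega>\<bar> \<le> 2 * lil_scale m"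
      using elim(2,3) by eventually_elim (simp add: sum_negf abs_le_iff)
    then show ?case
      using pathwise_lil[of \<xi> \<omega> \<epsilon> \<sigma>] elim(1,4,5) assms(6) \<epsilon> unfolding r_def a_def by blast
  qed
  then show "AE \<omega> in M.
           (\<forall>\<^sub>F N in sequentially.
              random_sine_product \<alpha> \<xi> \<omega> N
                \<le> exp ((pi / sqrt 12 + \<epsilon>) * sqrt (real N * ln (ln (real N))))) \<and>
           (\<exists>\<^sub>F N in sequentially.
              random_sine_product \<alpha> \<xi> \<omega> N
                \<ge> exp ((pi / sqrt 12 - \<epsilon>) * sqrt (real N * ln (ln (real N)))))"
    unfolding \<sigma>_def lil_scale_def .
qed

end
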